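(* Let $\mathrm{m}\in\{1,2\}$, let $\Omega\subset\mathbb{R}^2$ be a bounded polygonal domain with Lipschitz continuous boundary, and let $V=H^{\mathrm{m}}_0(\Omega)$. There exists $\sigma\in(0,1]$, depending only on the geometry of the domain $\Omega$ (for the given $\mathrm{m}$), such that the following holds. Let $0<T<\infty$, $f\in L^2(0,T;L^2(\Omega))$ and $u_0\in V$, and suppose that $u$ is a weak solution (in the sense recalled in the context) of $$\partial_t u+(-1)^{\mathrm{m}}\Delta^{\mathrm{m}}u+u^3-u=f\ \text{ in }(0,T]\times\Omega,\qquad \frac{\partial^j u}{\partial \boldsymbol{n}^j}=0\ \text{ on }\partial\Omega\ \text{ for }0\le j\le \mathrm{m}-1,\qquad u(0,\cdot)=u_0\ \text{ on }\Omega.$$ Then $$u\in L^2(0,T;H^{\mathrm{m}+\sigma}(\Omega)).$$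
   Context: All functions are real valued. $(\cdot,\cdot)$ denotes the $L^2(\Omega)$ inner product. $V=H^{\mathrm{m}}_0(\Omega)$ carries the norm $\|v\|_V=\|\mathrm{D}^{\mathrm{m}}v\|_{L^2(\Omega)}$, where $\mathrm{D}^1$ is the gradient and $\mathrm{D}^2$ is the Hessian. Define $\mathcal{A}_{\mathrm{m}}(v,w)=(\mathrm{D}^{\mathrm{m}}v,\mathrm{D}^{\mathrm{m}}w)$ for $v,w\in V$, and $\phi(s)=s^3-s$. The vector $\boldsymbol{n}$ is the unit outward normal to $\partial\Omega$. $H^{\mathrm{m}+\sigma}(\Omega)$ is the (fractional) Sobolev–Slobodeckij space. $\partial_t u$ is the weak time derivative. Weak solution: for given $u_0\in V$, a weak solution is a function $u:(0,T)\times\Omega\to\mathbb{R}$, with $u\in L^\infty(0,T;V)$ and $\partial_t u\in L^2(0,T;L^2(\Omega))$, such that for almost every $t\in(0,T)$ $$(\partial_t u,w)+\mathcal{A}_{\mathrm{m}}(u,w)+(\phi(u),w)=(f(t,\cdot),w)\quad\text{for all }w\in V,$$ and $u(0,\cdot)=u_0$. (The value $u(0,\cdot)$ is meaningful because a function $u$ of this regularity has a representative in $C([0,T];L^2(\Omega))$.) *)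

theory Defs
  imports "HOL-Analysis.Analysis"
begin

text \<open>Elements of the function spaces below are represented by functions on the whole space;
  only their values on \<open>\<Omega>\<close>, up to null sets, matter.\<close>

subsection \<open>Polygonal Lipschitz domains\<close>

definition lipschitz_boundary :: "(real^2) set \<Rightarrow> bool" where
  "lipschitz_boundary \<Omega> \<longleftrightarrow> (\<forall>x\<in>frontier \<Omega>. \<exists>e1 e2 g L r.
     norm e1 = 1 \<and> norm e2 = 1 \<and> e1 \<bullet> e2 = 0 \<and> L-lipschitz_on UNIV (g :: real \<Rightarrow> real) \<and> r > 0 \<and>
     (\<forall>y\<in>ball x r. y \<in> \<Omega> \<longleftrightarrow> g (y \<bullet> e1) < y \<bullet> e2))"

text \<open>Holes are allowed; slits, cracks and isolated boundary points are excluded by the Lipschitz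
  condition.\<close>

definition polygonal_lipschitz_domain :: "(real^2) set \<Rightarrow> bool" where
  "polygonal_lipschitz_domain \<Omega> \<longleftrightarrow>
     open \<Omega> \<and> connected \<Omega> \<and> \<Omega> \<noteq> {} \<and> bounded \<Omega> \<and>
     (\<exists>S. finite S \<and> frontier \<Omega> = (\<Union>(a, b)\<in>S. closed_segment a b)) \<and>
     lipschitz_boundary \<Omega>"


subsection \<open>Test functions and weak derivatives\<close>

text \<open>A partial derivative of order \<open>k\<close> is indexed by the list of the \<open>k\<close> directions of
  differentiation.\<close>

fun partial_deriv :: "'a list \<Rightarrow> ('a::euclidean_space \<Rightarrow> real) \<Rightarrow> 'a \<Rightarrow> real" where
  "partial_deriv [] f = f"
| "partial_deriv (b # bs) f = (\<lambda>x. frechet_derivative (partial_deriv bs f) (at x) b)"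

definition directions :: "nat \<Rightarrow> 'a::euclidean_space list set" where
  "directions k = {bs. set bs \<subseteq> Basis \<and> length bs = k}"

definition test_function :: "'a::euclidean_space set \<Rightarrow> ('a \<Rightarrow> real) \<Rightarrow> bool" where
  "test_function \<Omega> \<phi> \<longleftrightarrow>
     (\<forall>k. \<forall>bs\<in>directions k. \<forall>x. partial_deriv bs \<phi> differentiable (at x)) \<and>
     compact (closure {x. \<phi> x \<noteq> 0}) \<and> closure {x. \<phi> x \<noteq> 0} \<subseteq> \<Omega>"

definition locally_integrable :: "'a::euclidean_space set \<Rightarrow> ('a \<Rightarrow> real) \<Rightarrow> bool" where
  "locally_integrable \<Omega> u \<longleftrightarrow> (\<forall>K. compact K \<and> K \<subseteq> \<Omega> \<longrightarrow> integrable (lebesgue_on K) u)"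

definition has_weak_deriv ::
    "'a::euclidean_space set \<Rightarrow> 'a list \<Rightarrow> ('a \<Rightarrow> real) \<Rightarrow> ('a \<Rightarrow> real) \<Rightarrow> bool" where
  "has_weak_deriv \<Omega> bs u v \<longleftrightarrow> locally_integrable \<Omega> u \<and> locally_integrable \<Omega> v \<and>
     (\<forall>\<phi>. test_function \<Omega> \<phi> \<longrightarrow>
        (\<integral>x. u x * partial_deriv bs \<phi> x \<partial>lebesgue_on \<Omega>)
          = (- 1) ^ length bs * (\<integral>x. v x * \<phi> x \<partial>lebesgue_on \<Omega>))"

text \<open>Weak derivatives are unique up to null sets, so the choice is immaterial.\<close>

definition weak_deriv ::
    "'a::euclidean_space set \<Rightarrow> 'a list \<Rightarrow> ('a \<Rightarrow> real) \<Rightarrow> 'a \<Rightarrow> real" where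
  "weak_deriv \<Omega> bs u = (SOME v. has_weak_deriv \<Omega> bs u v)"


subsection \<open>Lebesgue and Sobolev spaces\<close>

definition L2 :: "'a::euclidean_space set \<Rightarrow> ('a \<Rightarrow> real) set" where
  "L2 \<Omega> = {u \<in> borel_measurable (lebesgue_on \<Omega>). integrable (lebesgue_on \<Omega>) (\<lambda>x. (u x)\<^sup>2)}"

definition L2_inner :: "'a::euclidean_space set \<Rightarrow> ('a \<Rightarrow> real) \<Rightarrow> ('a \<Rightarrow> real) \<Rightarrow> real" where
  "L2_inner \<Omega> u v = (\<integral>x. u x * v x \<partial>lebesgue_on \<Omega>)"

definition L2_norm :: "'a::euclidean_space set \<Rightarrow> ('a \<Rightarrow> real) \<Rightarrow> real" where
  "L2_norm \<Omega> u = sqrt (L2_inner \<Omega> u u)"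

definition sobolev :: "'a::euclidean_space set \<Rightarrow> nat \<Rightarrow> ('a \<Rightarrow> real) set" where
  "sobolev \<Omega> k =
     {u \<in> L2 \<Omega>. \<forall>j\<le>k. \<forall>bs\<in>directions j. \<exists>v\<in>L2 \<Omega>. has_weak_deriv \<Omega> bs u v}"

definition sobolev_norm :: "'a::euclidean_space set \<Rightarrow> nat \<Rightarrow> ('a \<Rightarrow> real) \<Rightarrow> real" where
  "sobolev_norm \<Omega> k u =
     sqrt (\<Sum>j\<le>k. \<Sum>bs\<in>directions j. (L2_norm \<Omega> (weak_deriv \<Omega> bs u))\<^sup>2)"

text \<open>\<open>H\<^sup>k\<^sub>0(\<Omega>)\<close>: the closure of the test functions in \<open>H\<^sup>k(\<Omega>)\<close>.\<close>

definition sobolev0 :: "'a::euclidean_space set \<Rightarrow> nat \<Rightarrow> ('a \<Rightarrow> real) set" where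
  "sobolev0 \<Omega> k = {u \<in> sobolev \<Omega> k.
     \<exists>\<phi>. (\<forall>n. test_function \<Omega> (\<phi> n)) \<and>
         (\<lambda>n. sobolev_norm \<Omega> k (\<lambda>x. u x - \<phi> n x)) \<longlonglongrightarrow> 0}"

text \<open>The form \<open>(D\<^sup>m v, D\<^sup>m w)\<close> (for \<open>m = 2\<close> the Frobenius product of the Hessians) and the norm it
  induces on \<open>H\<^sup>m\<^sub>0(\<Omega>)\<close>.\<close>

definition bilin :: "'a::euclidean_space set \<Rightarrow> nat \<Rightarrow> ('a \<Rightarrow> real) \<Rightarrow> ('a \<Rightarrow> real) \<Rightarrow> real" where
  "bilin \<Omega> m v w =
     (\<Sum>bs\<in>directions m. L2_inner \<Omega> (weak_deriv \<Omega> bs v) (weak_deriv \<Omega> bs w))"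

definition V_norm :: "'a::euclidean_space set \<Rightarrow> nat \<Rightarrow> ('a \<Rightarrow> real) \<Rightarrow> real" where
  "V_norm \<Omega> m v = sqrt (bilin \<Omega> m v v)"

text \<open>The space \<open>H\<^sup>s(\<Omega>)\<close> for real \<open>s \<ge> 0\<close>; for integer \<open>s\<close> it is the ordinary Sobolev space. The
  kernel is \<open>0\<close> on the diagonal, which is a null set.\<close>

definition slobodeckij_kernel ::
    "real \<Rightarrow> ('a::euclidean_space \<Rightarrow> real) \<Rightarrow> 'a \<times> 'a \<Rightarrow> real" where
  "slobodeckij_kernel \<theta> v =
     (\<lambda>(x, y). \<bar>v x - v y\<bar>\<^sup>2 / norm (x - y) powr (real DIM('a) + 2 * \<theta>))"

definition frac_sobolev :: "'a::euclidean_space set \<Rightarrow> real \<Rightarrow> ('a \<Rightarrow> real) set" where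
  "frac_sobolev \<Omega> s = (let k = nat \<lfloor>s\<rfloor>; \<theta> = frac s in
     {u \<in> sobolev \<Omega> k. \<theta> > 0 \<longrightarrow> (\<forall>bs\<in>directions k.
        integrable (lebesgue_on \<Omega> \<Otimes>\<^sub>M lebesgue_on \<Omega>)
          (slobodeckij_kernel \<theta> (weak_deriv \<Omega> bs u)))})"

definition frac_sobolev_norm :: "'a::euclidean_space set \<Rightarrow> real \<Rightarrow> ('a \<Rightarrow> real) \<Rightarrow> real" where
  "frac_sobolev_norm \<Omega> s u = (let k = nat \<lfloor>s\<rfloor>; \<theta> = frac s in
     sqrt ((sobolev_norm \<Omega> k u)\<^sup>2 +
       (if \<theta> > 0
        then (\<Sum>bs\<in>directions k. \<integral>z. slobodeckij_kernel \<theta> (weak_deriv \<Omega> bs u) z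
                \<partial>(lebesgue_on \<Omega> \<Otimes>\<^sub>M lebesgue_on \<Omega>))
        else 0)))"


subsection \<open>Bochner spaces of functions with values in a function space\<close>

text \<open>The function spaces above depend on \<open>\<Omega>\<close> and are not types, so the Bochner notions are spelled
  out for a set \<open>X\<close> of functions with a norm \<open>N\<close>.\<close>

definition X_simple :: "'t measure \<Rightarrow> ('a \<Rightarrow> real) set \<Rightarrow> ('t \<Rightarrow> 'a \<Rightarrow> real) \<Rightarrow> bool" where
  "X_simple M X s \<longleftrightarrow> simple_function M s \<and> s ` space M \<subseteq> X"

definition strongly_measurable ::
    "'t measure \<Rightarrow> ('a \<Rightarrow> real) set \<Rightarrow> (('a \<Rightarrow> real) \<Rightarrow> real) \<Rightarrow> ('t \<Rightarrow> 'a \<Rightarrow> real) \<Rightarrow> bool" where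
  "strongly_measurable M X N u \<longleftrightarrow> (AE t in M. u t \<in> X) \<and>
     (\<exists>s. (\<forall>n. X_simple M X (s n)) \<and>
          (AE t in M. (\<lambda>n. N (\<lambda>x. u t x - s n t x)) \<longlonglongrightarrow> 0))"

definition bochner_L2 ::
    "real \<Rightarrow> ('a \<Rightarrow> real) set \<Rightarrow> (('a \<Rightarrow> real) \<Rightarrow> real) \<Rightarrow> (real \<Rightarrow> 'a \<Rightarrow> real) set" where
  "bochner_L2 T X N = {u. strongly_measurable (lebesgue_on {0<..<T}) X N u \<and>
     integrable (lebesgue_on {0<..<T}) (\<lambda>t. (N (u t))\<^sup>2)}"

definition bochner_Linf ::
    "real \<Rightarrow> ('a \<Rightarrow> real) set \<Rightarrow> (('a \<Rightarrow> real) \<Rightarrow> real) \<Rightarrow> (real \<Rightarrow> 'a \<Rightarrow> real) set" where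
  "bochner_Linf T X N = {u. strongly_measurable (lebesgue_on {0<..<T}) X N u \<and>
     (\<exists>C. AE t in lebesgue_on {0<..<T}. N (u t) \<le> C)}"

text \<open>The Bochner integral, for a finite measure \<open>M\<close>; the analogue of \<^const>\<open>has_bochner_integral\<close>.\<close>

definition X_simple_integral :: "'t measure \<Rightarrow> ('t \<Rightarrow> 'a \<Rightarrow> real) \<Rightarrow> 'a \<Rightarrow> real" where
  "X_simple_integral M s = (\<lambda>x. \<Sum>v\<in>s ` space M. measure M {t \<in> space M. s t = v} * v x)"

definition has_X_integral ::
    "'t measure \<Rightarrow> ('a \<Rightarrow> real) set \<Rightarrow> (('a \<Rightarrow> real) \<Rightarrow> real) \<Rightarrow> ('t \<Rightarrow> 'a \<Rightarrow> real) \<Rightarrow> ('a \<Rightarrow> real) \<Rightarrow> bool"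
  where
  "has_X_integral M X N u I \<longleftrightarrow> strongly_measurable M X N u \<and> I \<in> X \<and>
     (\<exists>s. (\<forall>n. X_simple M X (s n)) \<and>
          (\<lambda>n. \<integral>\<^sup>+ t. ennreal (N (\<lambda>x. u t x - s n t x)) \<partial>M) \<longlonglongrightarrow> 0 \<and>
          (\<lambda>n. N (\<lambda>x. I x - X_simple_integral M (s n) x)) \<longlonglongrightarrow> 0)"

text \<open>\<open>g\<close> is the weak time derivative of \<open>u\<close>: \<open>\<integral> \<psi>' u dt = - \<integral> \<psi> g dt\<close> in \<open>L\<^sup>2(\<Omega>)\<close> for all
  \<open>\<psi> \<in> C\<^sup>\<infinity>\<^sub>c(0,T)\<close>.\<close>

definition has_weak_time_deriv ::
    "'a::euclidean_space set \<Rightarrow> real \<Rightarrow> (real \<Rightarrow> 'a \<Rightarrow> real) \<Rightarrow> (real \<Rightarrow> 'a \<Rightarrow> real) \<Rightarrow> bool" where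
  "has_weak_time_deriv \<Omega> T u g \<longleftrightarrow> (\<forall>\<psi>. test_function {0<..<T} \<psi> \<longrightarrow>
     (\<exists>I. has_X_integral (lebesgue_on {0<..<T}) (L2 \<Omega>) (L2_norm \<Omega>) (\<lambda>t x. deriv \<psi> t * u t x) I \<and>
          has_X_integral (lebesgue_on {0<..<T}) (L2 \<Omega>) (L2_norm \<Omega>) (\<lambda>t x. \<psi> t * g t x) (\<lambda>x. - I x)))"

text \<open>The initial condition is imposed on the representative of \<open>u\<close> in \<open>C([0,T]; L\<^sup>2(\<Omega>))\<close>.\<close>

definition has_initial_value ::
    "'a::euclidean_space set \<Rightarrow> real \<Rightarrow> (real \<Rightarrow> 'a \<Rightarrow> real) \<Rightarrow> ('a \<Rightarrow> real) \<Rightarrow> bool" where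
  "has_initial_value \<Omega> T u u0 \<longleftrightarrow> (\<exists>w.
     (\<forall>t\<in>{0..T}. w t \<in> L2 \<Omega> \<and> ((\<lambda>s. L2_norm \<Omega> (\<lambda>x. w s x - w t x)) \<longlongrightarrow> 0) (at t within {0..T})) \<and>
     (AE t in lebesgue_on {0<..<T}. AE x in lebesgue_on \<Omega>. w t x = u t x) \<and>
     (AE x in lebesgue_on \<Omega>. w 0 x = u0 x))"


subsection \<open>Weak solutions\<close>

definition phi :: "real \<Rightarrow> real" where
  "phi s = s ^ 3 - s"

text \<open>The boundary conditions are encoded in \<open>u(t) \<in> H\<^sup>m\<^sub>0(\<Omega>)\<close>.\<close>

definition weak_solution ::
    "nat \<Rightarrow> (real^2) set \<Rightarrow> real \<Rightarrow> (real \<Rightarrow> real^2 \<Rightarrow> real) \<Rightarrow> (real^2 \<Rightarrow> real)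
      \<Rightarrow> (real \<Rightarrow> real^2 \<Rightarrow> real) \<Rightarrow> bool" where
  "weak_solution m \<Omega> T f u0 u \<longleftrightarrow>
     u \<in> bochner_Linf T (sobolev0 \<Omega> m) (V_norm \<Omega> m) \<and>
     (\<exists>dtu \<in> bochner_L2 T (L2 \<Omega>) (L2_norm \<Omega>).
        has_weak_time_deriv \<Omega> T u dtu \<and>
        (AE t in lebesgue_on {0<..<T}. \<forall>w\<in>sobolev0 \<Omega> m.
           L2_inner \<Omega> (dtu t) w + bilin \<Omega> m (u t) w + L2_inner \<Omega> (\<lambda>x. phi (u t x)) w
             = L2_inner \<Omega> (f t) w)) \<and>
     has_initial_value \<Omega> T u u0"

end

theory Submission
  imports Defs
begin

text \<open>
  At almost every time \<open>u(t)\<close> solves the elliptic problem \<open>(-1)\<^sup>m \<Delta>\<^sup>m u = G\<close> with \<open>G = f - \<partial>\<^sub>t u - \<phi>(u)\<close>. The nonlinear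
  term lies in \<open>L\<^sup>2(\<Omega>)\<close> because \<open>H\<^sup>1\<^sub>0 \<subseteq> L\<^sup>6\<close> in the plane (\<open>cube_in_L2\<close>), so \<open>G(t) \<in> L\<^sup>2(\<Omega>)\<close> with a norm that is
  square-integrable in time. It remains to gain a fraction of a derivative in the elliptic problem,
  with an estimate that is also strong enough for measurability in time.

  The gain comes from translations, in the spirit of Savare's regularity theory on Lipschitz domains.
  Extend \<open>u\<close> by zero and write \<open>u\<^sub>h(x) = u(x + h)\<close>. Near a boundary point, the translations in an open cone of
  directions push the support of \<open>u\<close> into \<open>\<Omega>\<close> (\<open>Lipschitz_cone\<close>), so for a cutoff \<open>\<phi>\<close> the function \<open>w = \<phi> (u\<^sub>h - u)\<close>
  belongs to \<open>H\<^sup>m\<^sub>0\<close> and may be used in the weak equation. Modulo commutators of size \<open>O(|h|)\<close>,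

    \<open>\<integral> \<phi> |D\<^sup>m u\<^sub>h - D\<^sup>m u|\<^sup>2 = \<integral> (\<phi>(x - h) - \<phi>(x)) |D\<^sup>m u|\<^sup>2 - 2 (D\<^sup>m u, D\<^sup>m w)\<close>,

  and \<open>(D\<^sup>m u, D\<^sup>m w) = (G, w)\<close>, so all terms on the right are \<open>O(|h|)\<close> (\<open>translation_energy\<close>,
  \<open>local_translation_estimate\<close>). Every small vector is a difference of two vectors of the cone, and finitely
  many neighbourhoods cover \<open>\<Omega>\<close>; hence \<open>\<parallel>D\<^sup>m u\<^sub>h - D\<^sup>m u\<parallel>\<^sup>2 \<le> C |h| (\<parallel>u\<parallel>\<^sub>V + \<parallel>G\<parallel>)\<^sup>2\<close> for all \<open>h\<close> (\<open>translation_estimate\<close>).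

  Integrating against \<open>|h|\<^sup>-\<^sup>2\<^sup>-\<^sup>2\<^sup>\<theta>\<close> bounds the Slobodeckij seminorm for \<open>\<theta> < 1/2\<close>. Interpolating first with the
  trivial bound \<open>\<parallel>D\<^sup>m u\<^sub>h - D\<^sup>m u\<parallel> \<le> 2 \<parallel>D\<^sup>m u\<parallel>\<close> restricts \<open>\<theta>\<close> to \<open>\<theta> < 1/4\<close>, but yields
  \<open>\<parallel>u\<parallel>\<^sup>2 \<le> C \<parallel>u\<parallel>\<^sub>V (\<parallel>u\<parallel>\<^sub>V + \<parallel>G\<parallel>)\<close> for the norm of \<open>H\<^sup>m\<^sup>+\<^sup>\<theta>\<close> (\<open>fractional_regularity\<close>); the proof takes \<open>\<sigma> = \<theta> = 1/8\<close>.
  Applied to differences of solutions, this turns approximation of \<open>u\<close> in \<open>V\<close> by simple functions with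
  values among those of \<open>u\<close> (\<open>simple_approximation_by_values\<close>) into approximation in \<open>H\<^sup>m\<^sup>+\<^sup>\<sigma>\<close>, and hence into strong
  measurability (\<open>bochner_fractional_regularity\<close>).

  All estimates are made for test functions on the whole plane and passed to the limit. For them the
  increment bound \<open>\<parallel>f(x + h) - f(x)\<parallel> \<le> C |h| \<parallel>\<nabla>f\<parallel>\<close> (\<open>l2norm_increment_le\<close>) also yields Poincare's inequality, and
  weak derivatives are compared with classical ones through the fundamental lemma of the calculus of
  variations (\<open>fundamental_lemma\<close>).
\<close>

section \<open>Square-integrable functions\<close>

definition square_integrable :: "'a measure \<Rightarrow> ('a \<Rightarrow> real) \<Rightarrow> bool" where
  "square_integrable M f \<longleftrightarrow> f \<in> borel_measurable M \<and> integrable M (\<lambda>x. (f x)\<^sup>2)"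

definition l2norm :: "'a measure \<Rightarrow> ('a \<Rightarrow> real) \<Rightarrow> real" where
  "l2norm M f = sqrt (\<integral>x. (f x)\<^sup>2 \<partial>M)"

lemma L2_iff: "u \<in> L2 \<Omega> \<longleftrightarrow> square_integrable (lebesgue_on \<Omega>) u"
  by (simp add: L2_def square_integrable_def)

lemma L2_norm_eq: "L2_norm \<Omega> u = l2norm (lebesgue_on \<Omega>) u"
  by (simp add: L2_norm_def L2_inner_def l2norm_def power2_eq_square)

lemma l2norm_nonneg [simp]: "0 \<le> l2norm M f"
  by (simp add: l2norm_def)

lemma l2norm_sq: "(l2norm M f)\<^sup>2 = (\<integral>x. (f x)\<^sup>2 \<partial>M)"
  by (simp add: l2norm_def)

lemma square_integrable_zero [simp]: "square_integrable M (\<lambda>x. 0)"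
  by (simp add: square_integrable_def)

lemma l2norm_zero [simp]: "l2norm M (\<lambda>x. 0) = 0"
  by (simp add: l2norm_def)

lemma square_integrableD:
  assumes "square_integrable M f"
  shows "f \<in> borel_measurable M" "integrable M (\<lambda>x. (f x)\<^sup>2)"
  using assms by (auto simp: square_integrable_def)

lemma integrable_mult_square_integrable:
  assumes f: "square_integrable M f" and g: "square_integrable M g"
  shows "integrable M (\<lambda>x. f x * g x)"
proof (rule Bochner_Integration.integrable_bound)
  show "integrable M (\<lambda>x. (f x)\<^sup>2 + (g x)\<^sup>2)"
    using f g by (auto simp: square_integrable_def)
  show "(\<lambda>x. f x * g x) \<in> borel_measurable M"
    using f g by (auto simp: square_integrable_def)
  have "\<bar>a * b\<bar> \<le> a\<^sup>2 + b\<^sup>2" for a b :: real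
    using sum_squares_bound[of "\<bar>a\<bar>" "\<bar>b\<bar>"] mult_nonneg_nonneg[of "\<bar>a\<bar>" "\<bar>b\<bar>"]
    unfolding abs_mult power2_abs by linarith
  then show "AE x in M. norm (f x * g x) \<le> norm ((f x)\<^sup>2 + (g x)\<^sup>2)"
    by (auto simp: abs_mult)
qed

lemma square_integrable_scale [intro]:
  "square_integrable M f \<Longrightarrow> square_integrable M (\<lambda>x. c * f x)"
  by (auto simp: square_integrable_def power_mult_distrib)

lemma square_integrable_minus:
  "square_integrable M f \<Longrightarrow> square_integrable M (\<lambda>x. - f x)"
  using square_integrable_scale[of M f "-1"] by simp

lemma square_integrable_add [intro]:
  assumes f: "square_integrable M f" and g: "square_integrable M g"
  shows "square_integrable M (\<lambda>x. f x + g x)"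
  using f g integrable_mult_square_integrable[OF f g]
  by (auto simp: square_integrable_def power2_sum mult.assoc)

lemma square_integrable_diff [intro]:
  assumes f: "square_integrable M f" and g: "square_integrable M g"
  shows "square_integrable M (\<lambda>x. f x - g x)"
  using square_integrable_add[OF f square_integrable_minus[OF g]] by simp

lemma square_integrable_sum:
  assumes "\<And>i. i \<in> I \<Longrightarrow> square_integrable M (f i)"
  shows "square_integrable M (\<lambda>x. \<Sum>i\<in>I. f i x)"
  using assms by (induction I rule: infinite_finite_induct) auto

lemma square_integrable_abs:
  "square_integrable M f \<Longrightarrow> square_integrable M (\<lambda>x. \<bar>f x\<bar>)"
  by (auto simp: square_integrable_def)

lemma square_integrable_dominated:
  assumes g: "square_integrable M g" and f: "f \<in> borel_measurable M" 
    and le: "AE x in M. \<bar>f x\<bar> \<le> \<bar>g x\<bar>"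
  shows "square_integrable M f" "l2norm M f \<le> l2norm M g"
proof -
  have *: "integrable M (\<lambda>x. (f x)\<^sup>2)"
    by (rule Bochner_Integration.integrable_bound[OF square_integrableD(2)[OF g]])
      (use f le in \<open>auto simp flip: abs_le_square_iff\<close>)
  then show "square_integrable M f" using f by (simp add: square_integrable_def)
  have "(\<integral>x. (f x)\<^sup>2 \<partial>M) \<le> (\<integral>x. (g x)\<^sup>2 \<partial>M)"
    using * g le by (intro integral_mono_AE)
      (auto simp: square_integrable_def simp flip: abs_le_square_iff)
  then show "l2norm M f \<le> l2norm M g" by (simp add: l2norm_def)
qed

lemma l2norm_cong_AE:
  assumes "f \<in> borel_measurable M" "g \<in> borel_measurable M" "AE x in M. f x = g x"
  shows "l2norm M f = l2norm M g"
proof -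
  have "(\<integral>x. (f x)\<^sup>2 \<partial>M) = (\<integral>x. (g x)\<^sup>2 \<partial>M)"
    using assms by (intro integral_cong_AE) auto
  then show ?thesis by (simp add: l2norm_def)
qed

lemma Cauchy_Schwarz_l2norm:
  assumes f: "square_integrable M f" and g: "square_integrable M g"
  shows "\<bar>\<integral>x. f x * g x \<partial>M\<bar> \<le> l2norm M f * l2norm M g"
proof -
  define A B I where "A = (\<integral>x. (f x)\<^sup>2 \<partial>M)" and "B = (\<integral>x. (g x)\<^sup>2 \<partial>M)"
    and "I = (\<integral>x. f x * g x \<partial>M)"
  note fg = integrable_mult_square_integrable[OF f g]
  have A: "A \<ge> 0" and B: "B \<ge> 0" by (auto simp: A_def B_def)
  \<comment> \<open>The discriminant of this nonnegative quadratic in \<open>t\<close> gives the inequality; if \<open>A = 0\<close> it is affine in \<open>t\<close>.\<close>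
  have quad: "0 \<le> t\<^sup>2 * A - 2 * t * I + B" for t
  proof -
    have "0 \<le> (\<integral>x. (t * f x - g x)\<^sup>2 \<partial>M)" by simp
    also have "\<dots> = (\<integral>x. t\<^sup>2 * (f x)\<^sup>2 - (2 * t) * (f x * g x) + (g x)\<^sup>2 \<partial>M)"
      by (intro Bochner_Integration.integral_cong) (auto simp: power2_eq_square algebra_simps)
    also have "\<dots> = t\<^sup>2 * A - 2 * t * I + B"
      using square_integrableD[OF f] square_integrableD[OF g] fg by (simp add: A_def B_def I_def)
    finally show ?thesis .
  qed
  have "I\<^sup>2 \<le> A * B"
  proof (cases "A = 0")
    case True
    have "I = 0"
    proof (rule ccontr)
      assume "I \<noteq> 0"
      with quad[of "(B + 1) / (2 * I)"] True show False by (auto simp: field_simps)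
    qed
    with True show ?thesis by simp
  next
    case False
    with A have "A > 0" by simp
    with quad[of "I / A"] show ?thesis by (simp add: power2_eq_square field_simps)
  qed
  then have "sqrt (I\<^sup>2) \<le> sqrt (A * B)" by (rule real_sqrt_le_mono)
  then show ?thesis by (simp add: l2norm_def A_def B_def I_def real_sqrt_mult)
qed

lemma l2norm_triangle:
  assumes f: "square_integrable M f" and g: "square_integrable M g"
  shows "l2norm M (\<lambda>x. f x + g x) \<le> l2norm M f + l2norm M g"
proof (rule power2_le_imp_le)
  have "(l2norm M (\<lambda>x. f x + g x))\<^sup>2 = (\<integral>x. (f x)\<^sup>2 + 2 * (f x * g x) + (g x)\<^sup>2 \<partial>M)"
    unfolding l2norm_sq by (intro Bochner_Integration.integral_cong) (auto simp: power2_eq_square algebra_simps)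
  also have "\<dots> = (l2norm M f)\<^sup>2 + 2 * (\<integral>x. f x * g x \<partial>M) + (l2norm M g)\<^sup>2"
    using square_integrableD[OF f] square_integrableD[OF g] integrable_mult_square_integrable[OF f g]
    by (simp add: l2norm_sq)
  also have "\<dots> \<le> (l2norm M f)\<^sup>2 + 2 * (l2norm M f * l2norm M g) + (l2norm M g)\<^sup>2"
    using Cauchy_Schwarz_l2norm[OF f g] by simp
  also have "\<dots> = (l2norm M f + l2norm M g)\<^sup>2" by (simp add: power2_sum)
  finally show "(l2norm M (\<lambda>x. f x + g x))\<^sup>2 \<le> (l2norm M f + l2norm M g)\<^sup>2" .
qed simp

lemma l2norm_scale: "l2norm M (\<lambda>x. c * f x) = \<bar>c\<bar> * l2norm M f"
  by (simp add: l2norm_def power_mult_distrib real_sqrt_mult)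

lemma l2norm_minus: "l2norm M (\<lambda>x. - f x) = l2norm M f"
  by (simp add: l2norm_def)

lemma l2norm_abs: "l2norm M (\<lambda>x. \<bar>f x\<bar>) = l2norm M f"
  by (simp add: l2norm_def)

lemma l2norm_commute: "l2norm M (\<lambda>x. f x - g x) = l2norm M (\<lambda>x. g x - f x)"
  by (simp add: l2norm_def power2_commute)

lemma l2norm_diff_le:
  assumes f: "square_integrable M f" and g: "square_integrable M g"
  shows "l2norm M (\<lambda>x. f x - g x) \<le> l2norm M f + l2norm M g"
  using l2norm_triangle[OF f square_integrable_minus[OF g]] by (simp add: l2norm_minus)

lemma l2norm_sum_le:
  assumes "\<And>i. i \<in> I \<Longrightarrow> square_integrable M (f i)"
  shows "l2norm M (\<lambda>x. \<Sum>i\<in>I. f i x) \<le> (\<Sum>i\<in>I. l2norm M (f i))"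
  using assms
proof (induction I rule: infinite_finite_induct)
  case (insert i I)
  have "l2norm M (\<lambda>x. f i x + (\<Sum>i\<in>I. f i x)) \<le> l2norm M (f i) + l2norm M (\<lambda>x. \<Sum>i\<in>I. f i x)"
    by (intro l2norm_triangle square_integrable_sum) (auto intro: insert.prems)
  with insert show ?case by fastforce
qed auto

lemma l2norm_sub_triangle:
  assumes "square_integrable M f" "square_integrable M g" "square_integrable M h"
  shows "l2norm M (\<lambda>x. f x - h x) \<le> l2norm M (\<lambda>x. f x - g x) + l2norm M (\<lambda>x. g x - h x)"
  using l2norm_triangle[OF square_integrable_diff[OF assms(1,2)] square_integrable_diff[OF assms(2,3)]]
  by simp

lemma tendsto_l2norm:
  assumes "square_integrable M f" "\<And>n. square_integrable M (g n)"
    and "(\<lambda>n. l2norm M (\<lambda>x. f x - g n x)) \<longlonglongrightarrow> 0"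
  shows "(\<lambda>n. l2norm M (g n)) \<longlonglongrightarrow> l2norm M f"
proof (rule Lim_transform_bound[OF _ assms(3), THEN LIM_zero_cancel])
  show "\<forall>\<^sub>F n in sequentially. norm (l2norm M (g n) - l2norm M f) \<le> norm (l2norm M (\<lambda>x. f x - g n x))"
  proof (intro always_eventually allI)
    fix n
    have "l2norm M f \<le> l2norm M (\<lambda>x. f x - g n x) + l2norm M (g n)"
      using l2norm_triangle[OF square_integrable_diff[OF assms(1) assms(2)[of n]] assms(2)[of n]] by simp
    moreover have "l2norm M (g n) \<le> l2norm M f + l2norm M (\<lambda>x. f x - g n x)"
      using l2norm_diff_le[OF assms(1) square_integrable_diff[OF assms(1) assms(2)[of n]]] by simp
    ultimately show "norm (l2norm M (g n) - l2norm M f) \<le> norm (l2norm M (\<lambda>x. f x - g n x))" by simp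
  qed
qed

section \<open>Smooth functions\<close>

definition smooth :: "('a::euclidean_space \<Rightarrow> real) \<Rightarrow> bool" where
  "smooth f \<longleftrightarrow> (\<forall>bs. set bs \<subseteq> Basis \<longrightarrow> (\<forall>x. partial_deriv bs f differentiable (at x)))"

abbreviation pd :: "'a \<Rightarrow> ('a::euclidean_space \<Rightarrow> real) \<Rightarrow> 'a \<Rightarrow> real" where
  "pd b f \<equiv> partial_deriv [b] f"

lemma pd_apply: "pd b f = (\<lambda>x. frechet_derivative f (at x) b)"
  by simp

lemma pd_eq:
  assumes "(f has_derivative f') (at x)"
  shows "pd b f x = f' b"
  using frechet_derivative_at[OF assms] by (simp add: pd_apply)

lemma partial_deriv_append: "partial_deriv (bs @ cs) f = partial_deriv bs (partial_deriv cs f)"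
  by (induction bs) auto

lemma partial_deriv_snoc: "partial_deriv (bs @ [b]) f = partial_deriv bs (pd b f)"
  by (rule partial_deriv_append)

declare partial_deriv.simps(2) [simp del]

lemma directions_0 [simp]: "directions 0 = {[]}"
  by (auto simp: directions_def)

lemma finite_directions [simp]: "finite (directions k :: 'a::euclidean_space list set)"
  unfolding directions_def using finite_lists_length_eq[of "Basis :: 'a set" k] by simp

lemma directionsD: "bs \<in> directions k \<Longrightarrow> set bs \<subseteq> Basis" "bs \<in> directions k \<Longrightarrow> length bs = k"
  by (auto simp: directions_def)

lemma directionsI: "set bs \<subseteq> Basis \<Longrightarrow> bs \<in> directions (length bs)"
  by (auto simp: directions_def)

lemma rev_directions [simp]: "rev bs \<in> directions k \<longleftrightarrow> bs \<in> directions k"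
  by (auto simp: directions_def)

lemma sum_rev_directions: "(\<Sum>bs\<in>directions k. F (rev bs)) = (\<Sum>bs\<in>directions k. F bs)"
  by (rule sum.reindex_bij_witness[of _ rev rev]) auto

lemma sum_directions_Suc:
  "(\<Sum>bs\<in>directions (Suc k). F bs) = (\<Sum>bs\<in>directions k. \<Sum>b\<in>Basis. F (b # bs))"
proof -
  have "(\<Sum>bs\<in>directions k. \<Sum>b\<in>Basis. F (b # bs)) = (\<Sum>p\<in>directions k \<times> Basis. F (snd p # fst p))"
    by (simp add: sum.cartesian_product case_prod_beta)
  also have "\<dots> = (\<Sum>bs\<in>directions (Suc k). F bs)"
    by (rule sum.reindex_bij_witness[of _ "\<lambda>bs. (tl bs, hd bs)" "\<lambda>p. snd p # fst p"])
      (auto simp: directions_def length_Suc_conv)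
  finally show ?thesis ..
qed

lemma sum_directions_Suc_snoc:
  "(\<Sum>bs\<in>directions (Suc k). F bs) = (\<Sum>bs\<in>directions k. \<Sum>b\<in>Basis. F (bs @ [b]))"
proof -
  have "(\<Sum>bs\<in>directions k. \<Sum>b\<in>Basis. F (bs @ [b])) = (\<Sum>p\<in>directions k \<times> Basis. F (fst p @ [snd p]))"
    by (simp add: sum.cartesian_product case_prod_beta)
  also have "\<dots> = (\<Sum>bs\<in>directions (Suc k). F bs)"
    by (rule sum.reindex_bij_witness[of _ "\<lambda>bs. (butlast bs, last bs)" "\<lambda>p. fst p @ [snd p]"])
      (auto simp: directions_def length_Suc_conv_rev)
  finally show ?thesis ..
qed

lemma smooth_differentiable: "smooth f \<Longrightarrow> f differentiable (at x)"
  unfolding smooth_def using partial_deriv.simps(1)[of f] by (metis empty_subsetI list.set(1))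

lemma smooth_partial_deriv: 
  assumes "smooth f" "set cs \<subseteq> Basis"
  shows "smooth (partial_deriv cs f)"
  unfolding smooth_def
proof (intro allI impI)
  fix bs :: "'a list" and x assume "set bs \<subseteq> Basis"
  then show "partial_deriv bs (partial_deriv cs f) differentiable at x"
    using assms unfolding smooth_def partial_deriv_append[symmetric] by simp
qed

lemma smooth_pd: "smooth f \<Longrightarrow> b \<in> Basis \<Longrightarrow> smooth (pd b f)"
  by (rule smooth_partial_deriv) auto

lemma smooth_continuous: "smooth f \<Longrightarrow> continuous_on S f"
  by (meson continuous_at_imp_continuous_on differentiable_imp_continuous_within smooth_differentiable)

lemma smooth_has_derivative:
  "smooth f \<Longrightarrow> (f has_derivative frechet_derivative f (at x)) (at x)"
  using smooth_differentiable frechet_derivative_works by blast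

text \<open>Coinduction spares the computation of higher derivatives: it is enough to find a set of
  differentiable functions that is stable under all \<open>\<partial>\<^sub>b\<close>.\<close>

lemma smooth_coinduct:
  assumes f: "f \<in> S"
    and diff: "\<And>g x. g \<in> S \<Longrightarrow> g differentiable (at x)"
    and closed: "\<And>g b. g \<in> S \<Longrightarrow> b \<in> Basis \<Longrightarrow> pd b g \<in> S"
  shows "smooth f"
proof -
  have "partial_deriv bs f \<in> S" if "set bs \<subseteq> Basis" for bs
    using that
  proof (induction bs)
    case (Cons b bs)
    then have "pd b (partial_deriv bs f) \<in> S" by (intro closed) auto
    then show ?case by (simp add: partial_deriv_append[symmetric])
  qed (simp add: f)
  then show ?thesis unfolding smooth_def using diff by blast
qed

text \<open>Sums and products are how derivatives of products and of compositions look; closing a generating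
  set under them gives a set to which coinduction applies.\<close>

inductive_set algebra_hull :: "('a \<Rightarrow> real) set \<Rightarrow> ('a \<Rightarrow> real) set" for G where
  gen: "f \<in> G \<Longrightarrow> f \<in> algebra_hull G"
| add: "f \<in> algebra_hull G \<Longrightarrow> g \<in> algebra_hull G \<Longrightarrow> (\<lambda>x. f x + g x) \<in> algebra_hull G"
| mult: "f \<in> algebra_hull G \<Longrightarrow> g \<in> algebra_hull G \<Longrightarrow> (\<lambda>x. f x * g x) \<in> algebra_hull G"

lemma pd_add:
  assumes "f differentiable at x" "g differentiable at x"
  shows "pd b (\<lambda>x. f x + g x) x = pd b f x + pd b g x"
proof -
  have "pd b (\<lambda>x. f x + g x) x = frechet_derivative f (at x) b + frechet_derivative g (at x) b"
    by (rule pd_eq, rule has_derivative_add) (use assms in \<open>auto simp: frechet_derivative_works\<close>)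
  then show ?thesis by (simp add: pd_apply)
qed

lemma pd_mult:
  assumes "f differentiable at x" "g differentiable at x"
  shows "pd b (\<lambda>x. f x * g x) x = pd b f x * g x + f x * pd b g x"
proof -
  have "pd b (\<lambda>x. f x * g x) x = f x * frechet_derivative g (at x) b + frechet_derivative f (at x) b * g x"
    by (rule pd_eq, rule has_derivative_mult) (use assms in \<open>auto simp: frechet_derivative_works\<close>)
  then show ?thesis by (simp add: pd_apply)
qed

text \<open>By the product rule it suffices to differentiate the generators.\<close>

lemma smooth_algebra_hull:
  assumes f: "f \<in> algebra_hull G"
    and diff: "\<And>g x. g \<in> G \<Longrightarrow> g differentiable (at x)"
    and closed: "\<And>g b. g \<in> G \<Longrightarrow> b \<in> Basis \<Longrightarrow> pd b g \<in> algebra_hull G"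
  shows "smooth f"
proof -
  have D: "g differentiable (at x)" if "g \<in> algebra_hull G" for g x
    using that by induction (auto intro: diff)
  show ?thesis
  proof (rule smooth_coinduct[OF f D])
    fix g :: "'a \<Rightarrow> real" and b :: 'a assume "g \<in> algebra_hull G" and b: "b \<in> Basis"
    then show "pd b g \<in> algebra_hull G"
    proof induction
      case (gen f) then show ?case using closed b by blast
    next
      case (add f g)
      have "pd b (\<lambda>x. f x + g x) = (\<lambda>x. pd b f x + pd b g x)"
        by (intro ext pd_add D add)
      then show ?case using add by (simp add: algebra_hull.add)
    next
      case (mult f g)
      have "pd b (\<lambda>x. f x * g x) = (\<lambda>x. pd b f x * g x + f x * pd b g x)"
        by (intro ext pd_mult D mult)
      then show ?case using mult by (simp add: algebra_hull.add algebra_hull.mult)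
    qed
  qed
qed

lemma smooth_add: "smooth f \<Longrightarrow> smooth g \<Longrightarrow> smooth (\<lambda>x. f x + g x)"
  by (rule smooth_algebra_hull[of _ "{f. smooth f}"])
    (auto intro: algebra_hull.intros smooth_differentiable smooth_pd)

lemma smooth_mult: "smooth f \<Longrightarrow> smooth g \<Longrightarrow> smooth (\<lambda>x. f x * g x)"
  by (rule smooth_algebra_hull[of _ "{f. smooth f}"])
    (auto intro: algebra_hull.intros smooth_differentiable smooth_pd)

lemma smooth_const [simp]: "smooth (\<lambda>x. c)"
proof (rule smooth_coinduct[of _ "range (\<lambda>c x. c)"])
  fix g :: "'a \<Rightarrow> real" and b :: 'a assume "g \<in> range (\<lambda>c x. c)"
  then obtain c where g: "g = (\<lambda>x. c)" by auto
  have "pd b g = (\<lambda>x. 0)" unfolding g by (intro ext pd_eq[OF has_derivative_const])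
  then show "pd b g \<in> range (\<lambda>c x. c)" by auto
qed auto

lemma smooth_inner: "smooth (\<lambda>x. x \<bullet> b)"
proof (rule smooth_coinduct[of _ "insert (\<lambda>x. x \<bullet> b) {f. smooth f}"])
  fix g :: "'a \<Rightarrow> real" and c :: 'a assume "g \<in> insert (\<lambda>x. x \<bullet> b) {f. smooth f}" and c: "c \<in> Basis"
  then consider "g = (\<lambda>x. x \<bullet> b)" | "smooth g" by auto
  then show "pd c g \<in> insert (\<lambda>x. x \<bullet> b) {f. smooth f}"
  proof cases
    case 1
    have "pd c g = (\<lambda>x. c \<bullet> b)" unfolding 1 by (intro ext pd_eq) (auto intro!: derivative_eq_intros)
    then show ?thesis by simp
  next
    case 2 then show ?thesis using smooth_pd[OF _ c] by auto
  qed
qed (auto intro: smooth_differentiable)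

lemma smooth_minus: "smooth f \<Longrightarrow> smooth (\<lambda>x. - f x)"
  using smooth_mult[OF smooth_const[of "-1"]] by fastforce

lemma smooth_diff: "smooth f \<Longrightarrow> smooth g \<Longrightarrow> smooth (\<lambda>x. f x - g x)"
  using smooth_add[OF _ smooth_minus] by fastforce

lemma smooth_prod: "(\<And>i. i \<in> I \<Longrightarrow> smooth (f i)) \<Longrightarrow> smooth (\<lambda>x. \<Prod>i\<in>I. f i x)"
  by (induction I rule: infinite_finite_induct) (auto intro: smooth_mult)

lemma partial_deriv_add:
  assumes "smooth f" "smooth g" "set bs \<subseteq> Basis"
  shows "partial_deriv bs (\<lambda>x. f x + g x) = (\<lambda>x. partial_deriv bs f x + partial_deriv bs g x)"
  using assms(3)
proof (induction bs)
  case (Cons b bs)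
  then have "partial_deriv (b # bs) (\<lambda>x. f x + g x) = pd b (\<lambda>x. partial_deriv bs f x + partial_deriv bs g x)"
    using partial_deriv_append[of "[b]" bs "\<lambda>x. f x + g x"] by simp
  also have "\<dots> = (\<lambda>x. pd b (partial_deriv bs f) x + pd b (partial_deriv bs g) x)"
    using assms Cons by (intro ext pd_add smooth_differentiable smooth_partial_deriv) auto
  finally show ?case using partial_deriv_append[of "[b]" bs] by simp
qed simp

lemma partial_deriv_scale:
  assumes "smooth f" "set bs \<subseteq> Basis"
  shows "partial_deriv bs (\<lambda>x. c * f x) = (\<lambda>x. c * partial_deriv bs f x)"
  using assms(2)
proof (induction bs)
  case (Cons b bs)
  then have "partial_deriv (b # bs) (\<lambda>x. c * f x) = pd b (\<lambda>x. c * partial_deriv bs f x)"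
    using partial_deriv_append[of "[b]" bs "\<lambda>x. c * f x"] by simp
  also have "\<dots> = (\<lambda>x. c * pd b (partial_deriv bs f) x)"
  proof
    fix x
    have "(partial_deriv bs f) differentiable at x"
      using assms Cons by (intro smooth_differentiable smooth_partial_deriv) auto
    then have "((\<lambda>x. c * partial_deriv bs f x) has_derivative (\<lambda>h. c * frechet_derivative (partial_deriv bs f) (at x) h)) (at x)"
      by (intro has_derivative_mult_right) (simp add: frechet_derivative_works)
    then show "pd b (\<lambda>x. c * partial_deriv bs f x) x = c * pd b (partial_deriv bs f) x"
      by (subst pd_eq) (auto simp: pd_apply)
  qed
  finally show ?case using partial_deriv_append[of "[b]" bs] by simp
qed simp

lemma partial_deriv_diff:
  assumes "smooth f" "smooth g" "set bs \<subseteq> Basis"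
  shows "partial_deriv bs (\<lambda>x. f x - g x) = (\<lambda>x. partial_deriv bs f x - partial_deriv bs g x)"
  using partial_deriv_add[OF assms(1) smooth_minus[OF assms(2)] assms(3)]
    partial_deriv_scale[OF assms(2,3), of "-1"] by simp

lemma pd_translate:
  assumes "smooth f"
  shows "pd b (\<lambda>x. f (x + h)) = (\<lambda>x. pd b f (x + h))"
proof
  fix x
  have "((\<lambda>x. f (x + h)) has_derivative (\<lambda>v. frechet_derivative f (at (x + h)) v)) (at x)"
    by (rule has_derivative_compose[of "\<lambda>x. x + h" "\<lambda>v. v"])
      (auto intro!: derivative_eq_intros smooth_has_derivative assms)
  then show "pd b (\<lambda>x. f (x + h)) x = pd b f (x + h)"
    by (subst pd_eq) (auto simp: pd_apply)
qed

lemma partial_deriv_translate: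
  assumes "smooth f" "set bs \<subseteq> Basis"
  shows "partial_deriv bs (\<lambda>x. f (x + h)) = (\<lambda>x. partial_deriv bs f (x + h))"
  using assms(2)
proof (induction bs)
  case (Cons b bs)
  then have "partial_deriv (b # bs) (\<lambda>x. f (x + h)) = pd b (\<lambda>x. partial_deriv bs f (x + h))"
    using partial_deriv_append[of "[b]" bs "\<lambda>x. f (x + h)"] by simp
  also have "\<dots> = (\<lambda>x. pd b (partial_deriv bs f) (x + h))"
    using assms Cons by (intro pd_translate smooth_partial_deriv) auto
  finally show ?case using partial_deriv_append[of "[b]" bs] by simp
qed simp

lemma smooth_translate: "smooth f \<Longrightarrow> smooth (\<lambda>x. f (x + h))"
  unfolding smooth_def
proof (intro allI impI)
  fix bs :: "'a list" and x
  assume f: "\<forall>bs. set bs \<subseteq> Basis \<longrightarrow> (\<forall>x. partial_deriv bs f differentiable at x)" and bs: "set bs \<subseteq> Basis"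
  then have "partial_deriv bs f differentiable at (x + h)" by auto
  then have "(\<lambda>x. partial_deriv bs f (x + h)) differentiable at x"
    unfolding differentiable_def
    using has_derivative_compose[of "\<lambda>x. x + h" "\<lambda>v. v" x UNIV "partial_deriv bs f"]
      has_derivative_add_const[OF has_derivative_ident] by blast
  then show "partial_deriv bs (\<lambda>x. f (x + h)) differentiable at x"
    using partial_deriv_translate[of f bs h] f bs by (simp add: smooth_def)
qed

lemma partial_deriv_zero_on_open:
  assumes "open S" "\<And>x. x \<in> S \<Longrightarrow> f x = 0" "x \<in> S"
  shows "partial_deriv bs f x = 0"
  using assms(3)
proof (induction bs arbitrary: x)
  case (Cons b bs)
  have "((\<lambda>x. 0 :: real) has_derivative (\<lambda>h. 0)) (at x)" by simp
  then have "(partial_deriv bs f has_derivative (\<lambda>h. 0)) (at x)"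
    by (rule has_derivative_transform_within_open[OF _ assms(1) Cons.prems]) (simp add: Cons.IH)
  then have "pd b (partial_deriv bs f) x = 0" by (rule pd_eq)
  then show ?case by (simp add: partial_deriv_append[symmetric])
qed (simp add: assms)

lemma partial_deriv_support: "{x. partial_deriv bs f x \<noteq> 0} \<subseteq> closure {x. f x \<noteq> 0}"
proof -
  have "partial_deriv bs f x = 0" if "x \<notin> closure {x. f x \<noteq> 0}" for x
    by (rule partial_deriv_zero_on_open[of "- closure {x. f x \<noteq> 0}"]) 
      (use that closure_subset[of "{x. f x \<noteq> 0}"] in auto)
  then show ?thesis by blast
qed

section \<open>Smooth bump functions\<close>

text \<open>The functions that differentiation generates from \<open>exp (-1/t)\<close>: the derivative of each is a combination of
  two others.\<close>

definition flat_exp :: "nat \<Rightarrow> real \<Rightarrow> real" where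
  "flat_exp k t = (if t > 0 then (1 / t) ^ k * exp (- (1 / t)) else 0)"

lemma power_le_fact_exp:
  fixes x :: real assumes "x \<ge> 0" shows "x ^ n \<le> fact n * exp x"
proof -
  have "(\<Sum>k\<in>{n}. x ^ k /\<^sub>R fact k) \<le> (\<Sum>k. x ^ k /\<^sub>R fact k)"
    using assms by (intro sum_le_suminf) (auto simp: summable_exp)
  also have "\<dots> = exp x" using exp_converges[of x] by (simp add: sums_iff)
  finally show ?thesis by (simp add: field_simps)
qed

lemma flat_exp_nonneg [simp]: "0 \<le> flat_exp k t"
  by (simp add: flat_exp_def)

text \<open>From \<open>x\<^sup>n \<le> n! exp x\<close> at \<open>x = 1/t\<close> and \<open>n = k + 2\<close>. The quadratic decay makes the derivative at \<open>0\<close> vanish.\<close>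

lemma flat_exp_le_quadratic: "flat_exp k t \<le> fact (k + 2) * t\<^sup>2"
proof (cases "t > 0")
  case True
  have "(1 / t) ^ (k + 2) \<le> fact (k + 2) * exp (1 / t)"
    using True by (intro power_le_fact_exp) auto
  then have "(1 / t) ^ (k + 2) * (exp (- (1 / t)) * t\<^sup>2) \<le> fact (k + 2) * exp (1 / t) * (exp (- (1 / t)) * t\<^sup>2)"
    by (rule mult_right_mono) auto
  moreover have "fact (k + 2) * exp (1 / t) * (exp (- (1 / t)) * t\<^sup>2) = fact (k + 2) * t\<^sup>2"
    by (simp add: exp_minus del: fact_Suc)
  moreover have "(1 / t) ^ (k + 2) * (exp (- (1 / t)) * t\<^sup>2) = (1 / t) ^ k * exp (- (1 / t))"
    using True by (simp add: power_divide power2_eq_square)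
  ultimately have "(1 / t) ^ k * exp (- (1 / t)) \<le> fact (k + 2) * t\<^sup>2" by metis
  then show ?thesis using True by (simp add: flat_exp_def)
qed (simp add: flat_exp_def)

lemma has_derivative_flat_exp:
  "(flat_exp k has_real_derivative - real k * flat_exp (Suc k) t + flat_exp (k + 2) t) (at t)"
proof -
  consider "t < 0" | "t > 0" | "t = 0" by linarith
  then show ?thesis
  proof cases
    case 1
    have "((\<lambda>t. 0) has_real_derivative 0) (at t)" by simp
    then have "(flat_exp k has_real_derivative 0) (at t)"
      by (rule has_field_derivative_transform_within_open[of _ _ _ "{..<0}"])
        (use 1 in \<open>auto simp: flat_exp_def\<close>)
    then show ?thesis using 1 by (simp add: flat_exp_def)
  next
    case 2
    have "((\<lambda>t. (1 / t) ^ k * exp (- (1 / t))) has_real_derivative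
        - real k * (1 / t) ^ Suc k * exp (- (1 / t)) + (1 / t) ^ (k + 2) * exp (- (1 / t))) (at t)"
    proof -
      have *: "real k * (- 1 / t\<^sup>2) * (1 / t) ^ (k - 1) * exp (- (1 / t)) + (1 / t) ^ k * (exp (- (1 / t)) * (1 / t\<^sup>2))
        = - real k * (1 / t) ^ Suc k * exp (- (1 / t)) + (1 / t) ^ (k + 2) * exp (- (1 / t))"
        by (cases k) (auto simp: power2_eq_square simp del: of_nat_Suc)
      have inv: "((\<lambda>t. 1 / t) has_real_derivative (- 1 / t\<^sup>2)) (at t)"
        using 2 by (auto intro!: derivative_eq_intros simp: power2_eq_square)
      show ?thesis unfolding *[symmetric]
        by (rule DERIV_cong, rule DERIV_mult[OF DERIV_power[OF inv] DERIV_fun_exp[OF DERIV_minus[OF inv]]]) (simp add: field_simps)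
    qed
    then have "(flat_exp k has_real_derivative
        - real k * (1 / t) ^ Suc k * exp (- (1 / t)) + (1 / t) ^ (k + 2) * exp (- (1 / t))) (at t)"
      by (rule has_field_derivative_transform_within_open[of _ _ _ "{0<..}"])
        (use 2 in \<open>auto simp: flat_exp_def\<close>)
    then show ?thesis using 2 by (simp add: flat_exp_def mult.assoc)
  next
    case 3
    have "(flat_exp k has_real_derivative 0) (at 0)"
      unfolding DERIV_def
    proof (rule Lim_transform_bound)
      show "\<forall>\<^sub>F h in at 0. norm ((flat_exp k (0 + h) - flat_exp k 0) / h) \<le> norm (fact (k + 2) * h)"
      proof (intro always_eventually allI)
        fix h :: real
        show "norm ((flat_exp k (0 + h) - flat_exp k 0) / h) \<le> norm (fact (k + 2) * h)"
        proof (cases "h = 0")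
          case False
          have "flat_exp k h \<le> (fact (k + 2) * \<bar>h\<bar>) * \<bar>h\<bar>"
            using flat_exp_le_quadratic[of k h] by (simp add: power2_eq_square mult.assoc del: fact_Suc)
          then show ?thesis
            using False by (simp add: flat_exp_def[of _ 0] abs_mult pos_divide_le_eq del: fact_Suc)
        qed (simp add: flat_exp_def)
      qed
      show "((\<lambda>h. fact (k + 2) * h) \<longlongrightarrow> (0::real)) (at 0)"
        by (auto intro!: tendsto_eq_intros)
    qed
    then show ?thesis using 3 by (simp add: flat_exp_def)
  qed
qed

lemma smooth_flat_exp_compose:
  assumes g: "smooth g" shows "smooth (\<lambda>x. flat_exp k (g x))"
proof -
  define G :: "('a \<Rightarrow> real) set" where "G = {f. smooth f} \<union> (\<lambda>k x. flat_exp k (g x)) ` UNIV"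
  have D: "((\<lambda>x. flat_exp k (g x)) has_derivative
      (\<lambda>h. (- real k * flat_exp (Suc k) (g x) + flat_exp (k + 2) (g x)) * frechet_derivative g (at x) h)) (at x)" for k x
    using has_derivative_compose[OF smooth_has_derivative[OF g, of x], of "flat_exp k"
        "\<lambda>h. (- real k * flat_exp (Suc k) (g x) + flat_exp (k + 2) (g x)) * h"]
      has_derivative_flat_exp[of k "g x"] by (simp add: has_field_derivative_def)
  show ?thesis
  proof (rule smooth_algebra_hull[of _ G])
    show "(\<lambda>x. flat_exp k (g x)) \<in> algebra_hull G" by (rule algebra_hull.gen) (auto simp: G_def)
  next
    fix f x assume "f \<in> G" then show "f differentiable at x"
      using D by (auto simp: G_def smooth_differentiable) (auto simp: differentiable_def)
  next
    fix f and b :: 'a assume "f \<in> G" and b: "b \<in> Basis"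
    then consider "smooth f" | k where "f = (\<lambda>x. flat_exp k (g x))" by (auto simp: G_def)
    then show "pd b f \<in> algebra_hull G"
    proof cases
      case 1 then show ?thesis by (auto simp: G_def intro!: algebra_hull.gen smooth_pd b)
    next
      case 2
      have "pd b f = (\<lambda>x. ((\<lambda>x. - real k) x * flat_exp (Suc k) (g x) + flat_exp (k + 2) (g x)) * pd b g x)"
        unfolding 2 by (intro ext, subst pd_eq[OF D]) (simp add: partial_deriv.simps)
      also have "\<dots> \<in> algebra_hull G"
        by (intro algebra_hull.mult algebra_hull.add; rule algebra_hull.gen)
           (auto simp: G_def intro!: smooth_pd b g)
      finally show ?thesis .
    qed
  qed
qed

text \<open>Positive exactly on the open box \<open>(a, c)\<close>; the parameter \<open>n\<close> makes the factors steeper.\<close>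

definition box_bump :: "real \<Rightarrow> 'a \<Rightarrow> 'a \<Rightarrow> 'a::euclidean_space \<Rightarrow> real" where
  "box_bump n a c x = (\<Prod>b\<in>Basis. flat_exp 0 (n * (x \<bullet> b - a \<bullet> b)) * flat_exp 0 (n * (c \<bullet> b - x \<bullet> b)))"

lemma smooth_box_bump: "smooth (box_bump n a c)"
  unfolding box_bump_def[abs_def]
  by (intro smooth_prod smooth_mult smooth_flat_exp_compose smooth_diff smooth_inner smooth_const)

lemma flat_exp_0_le_1: "flat_exp 0 t \<le> 1"
  by (simp add: flat_exp_def)

lemma box_bump_nonneg: "0 \<le> box_bump n a c x"
  by (simp add: box_bump_def prod_nonneg)

lemma box_bump_le_1: "box_bump n a c x \<le> 1"
  unfolding box_bump_def by (intro prod_le_1) (auto simp: flat_exp_0_le_1 intro!: mult_le_one)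

lemma box_bump_outside: 
  assumes "n > 0" "x \<notin> box a c" shows "box_bump n a c x = 0"
proof -
  obtain b where "b \<in> Basis" "\<not> (a \<bullet> b < x \<bullet> b \<and> x \<bullet> b < c \<bullet> b)"
    using assms(2) by (auto simp: mem_box)
  then show ?thesis unfolding box_bump_def using assms(1)
    by (intro prod_zero) (auto simp: flat_exp_def intro!: bexI[of _ b] dest: zero_less_mult_pos)
qed

lemma box_bump_pos: 
  assumes "n > 0" "x \<in> box a c" shows "box_bump n a c x > 0"
  using assms unfolding box_bump_def by (intro prod_pos) (auto simp: flat_exp_def mem_box)

text \<open>Each factor is \<open>exp (-1/(n t))\<close> with \<open>t > 0\<close> inside the box. Smooth functions thus approximate the
  indicator of a box boundedly, which is what the fundamental lemma needs.\<close>

lemma box_bump_tendsto: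
  assumes "x \<in> box a c"
  shows "(\<lambda>n. box_bump (real (Suc n)) a c x) \<longlonglongrightarrow> 1"
proof -
  have *: "(\<lambda>n. flat_exp 0 (real (Suc n) * t)) \<longlonglongrightarrow> 1" if "t > 0" for t
  proof -
    have "(\<lambda>n. exp (- (inverse (real (Suc n)) * (1 / t)))) \<longlonglongrightarrow> exp (- (0 * (1 / t)))"
      by (intro tendsto_intros LIMSEQ_inverse_real_of_nat)
    moreover have "flat_exp 0 (real (Suc n) * t) = exp (- (inverse (real (Suc n)) * (1 / t)))" for n
      using that by (simp add: flat_exp_def inverse_eq_divide del: of_nat_Suc)
    ultimately show ?thesis by (simp del: of_nat_Suc)
  qed
  have "(\<lambda>n. box_bump (real (Suc n)) a c x) \<longlonglongrightarrow> (\<Prod>b\<in>(Basis::'a set). 1 * 1)"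
    unfolding box_bump_def using assms
    by (intro tendsto_prod tendsto_mult *) (auto simp: mem_box)
  then show ?thesis by simp
qed

text \<open>A bump on a box centred at \<open>x0\<close>, divided by its minimum over a small ball. A cutoff only has to be at
  least \<open>1\<close> near \<open>x0\<close>, so it need not be constant there.\<close>

lemma smooth_cutoff:
  fixes x0 :: "'a::euclidean_space"
  assumes "R > 0"
  obtains \<rho> \<phi> where "0 < \<rho>" "smooth \<phi>" "\<And>x. 0 \<le> \<phi> x" "\<And>x. x \<in> cball x0 \<rho> \<Longrightarrow> 1 \<le> \<phi> x"
    "\<And>x. x \<notin> cball x0 R \<Longrightarrow> \<phi> x = 0"
proof -
  define s where "s = R / DIM('a)"
  define a c where "a = x0 - s *\<^sub>R One" and "c = x0 + s *\<^sub>R (One :: 'a)"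
  have s: "s > 0" using assms by (simp add: s_def)
  have sub: "x \<in> box a c" if "x \<in> cball x0 (s / 2)" for x
  proof -
    have *: "\<bar>(x - x0) \<bullet> b\<bar> \<le> s / 2" if "b \<in> Basis" for b
      using Basis_le_norm[OF that, of "x - x0"] \<open>x \<in> cball x0 (s / 2)\<close> by (simp add: dist_norm norm_minus_commute)
    have "x0 \<bullet> b - s < x \<bullet> b" "x \<bullet> b < x0 \<bullet> b + s" if "b \<in> Basis" for b
      using *[OF that] s unfolding inner_diff_left by linarith+
    then show ?thesis by (auto simp: mem_box a_def c_def inner_diff_left inner_add_left)
  qed
  have out: "box a c \<subseteq> cball x0 R"
  proof
    fix x assume x: "x \<in> box a c"
    have "norm (x - x0) \<le> (\<Sum>b\<in>Basis. \<bar>(x - x0) \<bullet> b\<bar>)" by (rule norm_le_l1)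
    also have "\<dots> \<le> (\<Sum>b\<in>(Basis::'a set). s)"
      using x by (intro sum_mono) (auto simp: mem_box a_def c_def inner_diff_left inner_add_left abs_le_iff less_imp_le algebra_simps)
    also have "\<dots> = R" by (simp add: s_def)
    finally show "x \<in> cball x0 R" by (simp add: dist_norm norm_minus_commute)
  qed
  have "continuous_on (cball x0 (s / 2)) (box_bump 1 a c)"
    by (intro smooth_continuous smooth_box_bump)
  then obtain y where y: "y \<in> cball x0 (s / 2)" "\<And>x. x \<in> cball x0 (s / 2) \<Longrightarrow> box_bump 1 a c y \<le> box_bump 1 a c x"
    using continuous_attains_inf[of "cball x0 (s / 2)" "box_bump 1 a c"] s by auto
  define k where "k = box_bump 1 a c y"
  have k: "k > 0" unfolding k_def by (intro box_bump_pos sub y) auto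
  show ?thesis
  proof (rule that[of "s / 2" "\<lambda>x. (1 / k) * box_bump 1 a c x"])
    show "smooth (\<lambda>x. (1 / k) * box_bump 1 a c x)" by (intro smooth_mult smooth_const smooth_box_bump)
    show "x \<in> cball x0 (s / 2) \<Longrightarrow> 1 \<le> (1 / k) * box_bump 1 a c x" for x
      using y(2) k by (auto simp: k_def[symmetric] field_simps)
    show "x \<notin> cball x0 R \<Longrightarrow> (1 / k) * box_bump 1 a c x = 0" for x
    proof -
      assume "x \<notin> cball x0 R"
      then have "x \<notin> box a c" using out by blast
      then show ?thesis using box_bump_outside[of 1 x a c] by simp
    qed
  qed (use s k in \<open>auto simp: box_bump_nonneg\<close>)
qed

section \<open>The Leibniz rule modulo lower order\<close>

definition lower_order :: "nat \<Rightarrow> ('a::euclidean_space \<Rightarrow> real) \<Rightarrow> 'a \<Rightarrow> real" where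
  "lower_order k v x = (\<Sum>j<k. \<Sum>cs\<in>directions j. \<bar>partial_deriv cs v x\<bar>)"

lemma lower_order_nonneg: "0 \<le> lower_order k v x"
  unfolding lower_order_def by (intro sum_nonneg) auto

lemma lower_order_mono: "k \<le> l \<Longrightarrow> lower_order k v x \<le> lower_order l v x"
  unfolding lower_order_def by (intro sum_mono2) (auto intro: sum_nonneg)

lemma partial_deriv_le_lower_order:
  "bs \<in> directions j \<Longrightarrow> j < k \<Longrightarrow> \<bar>partial_deriv bs v x\<bar> \<le> lower_order k v x"
proof -
  assume bs: "bs \<in> directions j" and j: "j < k"
  have "\<bar>partial_deriv bs v x\<bar> \<le> (\<Sum>cs\<in>directions j. \<bar>partial_deriv cs v x\<bar>)"
    using bs by (intro member_le_sum) auto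
  also have "\<dots> \<le> lower_order k v x"
    unfolding lower_order_def using j
    by (intro member_le_sum[of j "{..<k}" "\<lambda>j. \<Sum>cs\<in>directions j. \<bar>partial_deriv cs v x\<bar>"]) (auto intro: sum_nonneg)
  finally show ?thesis .
qed

lemma lower_order_pd_le:
  assumes "b \<in> Basis" shows "lower_order k (pd b v) x \<le> lower_order (Suc k) v x"
proof -
  have "lower_order k (pd b v) x = (\<Sum>j<k. \<Sum>cs\<in>directions j. \<bar>partial_deriv (cs @ [b]) v x\<bar>)"
    by (simp add: lower_order_def partial_deriv_append)
  also have "\<dots> \<le> (\<Sum>j<k. \<Sum>cs\<in>directions (Suc j). \<bar>partial_deriv cs v x\<bar>)"
    unfolding sum_directions_Suc_snoc
    by (intro sum_mono member_le_sum assms) auto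
  also have "\<dots> \<le> lower_order (Suc k) v x"
    unfolding lower_order_def sum.lessThan_Suc_shift by simp
  finally show ?thesis .
qed

lemma bounded_support_partial_deriv:
  assumes "bounded {x. f x \<noteq> 0}" shows "bounded {x. partial_deriv bs f x \<noteq> 0}"
  using bounded_subset[OF bounded_closure[OF assms] partial_deriv_support] .

lemma bounded_continuous_bounded_support:
  fixes f :: "'a::euclidean_space \<Rightarrow> real"
  assumes "continuous_on UNIV f" "bounded {x. f x \<noteq> 0}"
  obtains B where "B > 0" "\<And>x. \<bar>f x\<bar> \<le> B"
proof -
  have "compact (f ` closure {x. f x \<noteq> 0})"
    using assms by (intro compact_continuous_image continuous_on_subset[OF assms(1)]) auto
  then obtain B where B: "B > 0" "\<And>y. y \<in> f ` closure {x. f x \<noteq> 0} \<Longrightarrow> norm y \<le> B"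
    using compact_imp_bounded bounded_pos by metis
  have "\<bar>f x\<bar> \<le> B" for x
    using B closure_subset[of "{x. f x \<noteq> 0}"] by (cases "f x = 0") force+
  then show ?thesis using B that by blast
qed

text \<open>All derivatives of \<open>v\<close> in \<open>D\<^sup>b\<^sup>s(\<phi> v) - \<phi> D\<^sup>b\<^sup>s v\<close> have order below \<open>|bs|\<close>, with coefficients that are bounded derivatives of
  \<open>\<phi>\<close>. The induction peels off the innermost derivative \<open>\<partial>\<^sub>b\<close>: then both \<open>\<partial>\<^sub>b\<phi> v\<close> and \<open>\<phi> \<partial>\<^sub>b v\<close> are again
  products to which the hypothesis applies, which is why \<open>\<phi>\<close> must be arbitrary.\<close>

lemma Leibniz_lower_order:
  assumes "smooth \<phi>" "bounded {x. \<phi> x \<noteq> 0}" "set bs \<subseteq> Basis"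
  shows "\<exists>C\<ge>0. \<forall>v. smooth v \<longrightarrow> (\<forall>x. \<bar>partial_deriv bs (\<lambda>x. \<phi> x * v x) x - \<phi> x * partial_deriv bs v x\<bar>
            \<le> C * lower_order (length bs) v x)"
  using assms
proof (induction bs arbitrary: \<phi> rule: rev_induct)
  case Nil
  then show ?case by (auto intro!: exI[of _ 0])
next
  case (snoc b bs)
  then have b: "b \<in> Basis" and bs: "set bs \<subseteq> Basis" by auto
  note \<phi> = snoc.prems(1,2)
  have \<phi>': "smooth (pd b \<phi>)" "bounded {x. pd b \<phi> x \<noteq> 0}"
    by (intro smooth_pd \<phi> b) (rule bounded_support_partial_deriv[OF \<phi>(2)])
  obtain C1 where C1: "C1 \<ge> 0" "\<And>v x. smooth v \<Longrightarrow> \<bar>partial_deriv bs (\<lambda>x. pd b \<phi> x * v x) x - pd b \<phi> x * partial_deriv bs v x\<bar>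
            \<le> C1 * lower_order (length bs) v x"
    using snoc.IH[OF \<phi>' bs] by blast
  obtain C2 where C2: "C2 \<ge> 0" "\<And>v x. smooth v \<Longrightarrow> \<bar>partial_deriv bs (\<lambda>x. \<phi> x * v x) x - \<phi> x * partial_deriv bs v x\<bar>
            \<le> C2 * lower_order (length bs) v x"
    using snoc.IH[OF \<phi> bs] by blast
  obtain B where B: "B > 0" "\<And>x. \<bar>pd b \<phi> x\<bar> \<le> B"
    using bounded_continuous_bounded_support[OF smooth_continuous[OF \<phi>'(1)] \<phi>'(2)] by blast
  have "\<bar>partial_deriv (bs @ [b]) (\<lambda>x. \<phi> x * v x) x - \<phi> x * partial_deriv (bs @ [b]) v x\<bar>
          \<le> (C1 + C2 + B) * lower_order (length (bs @ [b])) v x" if v: "smooth v" for v x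
  proof -
    let ?L = "lower_order (Suc (length bs)) v x"
    have "pd b (\<lambda>x. \<phi> x * v x) = (\<lambda>x. pd b \<phi> x * v x + \<phi> x * pd b v x)"
      using \<phi>(1) v by (intro ext pd_mult smooth_differentiable) 
    then have "partial_deriv (bs @ [b]) (\<lambda>x. \<phi> x * v x) x
        = partial_deriv bs (\<lambda>x. pd b \<phi> x * v x) x + partial_deriv bs (\<lambda>x. \<phi> x * pd b v x) x"
      unfolding partial_deriv_snoc
      using partial_deriv_add[OF smooth_mult[OF \<phi>'(1) v] smooth_mult[OF \<phi>(1) smooth_pd[OF v b]] bs] by metis
    moreover have "\<bar>partial_deriv bs (\<lambda>x. pd b \<phi> x * v x) x - pd b \<phi> x * partial_deriv bs v x\<bar> \<le> C1 * ?L"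
      by (rule order_trans[OF C1(2)[OF v]]) (intro mult_left_mono C1 lower_order_mono, simp)
    moreover have "\<bar>pd b \<phi> x * partial_deriv bs v x\<bar> \<le> B * ?L"
      unfolding abs_mult using B(1)
      using partial_deriv_le_lower_order[OF directionsI[OF bs] lessI]
      by (intro mult_mono B) auto
    moreover have "\<bar>partial_deriv bs (\<lambda>x. \<phi> x * pd b v x) x - \<phi> x * partial_deriv bs (pd b v) x\<bar> \<le> C2 * ?L"
      by (rule order_trans[OF C2(2)[OF smooth_pd[OF v b]]]) (intro mult_left_mono C2 lower_order_pd_le b)
    ultimately show ?thesis
      unfolding partial_deriv_snoc[of bs b v] by (simp add: distrib_right)
  qed
  then show ?case using C1(1) C2(1) B(1) by (intro exI[of _ "C1 + C2 + B"]) auto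
qed

section \<open>Smooth functions with bounded support\<close>

definition test :: "('a::euclidean_space \<Rightarrow> real) \<Rightarrow> bool" where
  "test f \<longleftrightarrow> smooth f \<and> bounded {x. f x \<noteq> 0}"

lemma testD: "test f \<Longrightarrow> smooth f" "test f \<Longrightarrow> bounded {x. f x \<noteq> 0}"
  by (auto simp: test_def)

lemma test_partial_deriv: "test f \<Longrightarrow> set bs \<subseteq> Basis \<Longrightarrow> test (partial_deriv bs f)"
  by (simp add: test_def smooth_partial_deriv bounded_support_partial_deriv)

lemma test_pd: "test f \<Longrightarrow> b \<in> Basis \<Longrightarrow> test (pd b f)"
  by (rule test_partial_deriv) auto

lemma test_mult1: "test f \<Longrightarrow> smooth g \<Longrightarrow> test (\<lambda>x. f x * g x)"
  by (auto simp: test_def smooth_mult elim!: bounded_subset)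

lemma test_mult2: "smooth f \<Longrightarrow> test g \<Longrightarrow> test (\<lambda>x. f x * g x)"
  by (auto simp: test_def smooth_mult elim!: bounded_subset)

lemma test_add: "test f \<Longrightarrow> test g \<Longrightarrow> test (\<lambda>x. f x + g x)"
  unfolding test_def
proof (elim conjE, intro conjI)
  assume "bounded {x. f x \<noteq> 0}" "bounded {x. g x \<noteq> 0}"
  then have "bounded ({x. f x \<noteq> 0} \<union> {x. g x \<noteq> 0})" by simp
  then show "bounded {x. f x + g x \<noteq> 0}" by (rule bounded_subset) auto
qed (rule smooth_add)

lemma test_diff: "test f \<Longrightarrow> test g \<Longrightarrow> test (\<lambda>x. f x - g x)"
  using test_add[of f "\<lambda>x. -1 * g x"] test_mult2[OF smooth_const[of "-1"], of g] by simp

lemma translate_support: "{x. f (x + h) \<noteq> 0} = (+) (- h) ` {x. f x \<noteq> (0::real)}"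
  for h :: "'a::real_normed_vector"
  by (auto simp: image_iff intro!: exI[of _ "_ + h"])

lemma test_translate: "test f \<Longrightarrow> test (\<lambda>x. f (x + h))"
  unfolding test_def translate_support
  by (intro conjI smooth_translate bounded_translation) auto

lemma test_measurable: "test f \<Longrightarrow> f \<in> borel_measurable borel"
  by (intro borel_measurable_continuous_onI smooth_continuous testD)

lemma continuous_bounded_support_integrable:
  fixes f :: "'a::euclidean_space \<Rightarrow> real"
  assumes "continuous_on UNIV f" "bounded {x. f x \<noteq> 0}"
  shows "integrable lborel f"
proof -
  have "integrable lborel (\<lambda>x. indicator (closure {x. f x \<noteq> 0}) x *\<^sub>R f x)"
    using assms by (intro borel_integrable_compact) (auto elim: continuous_on_subset)
  moreover have "(\<lambda>x. indicator (closure {x. f x \<noteq> 0}) x *\<^sub>R f x) = f"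
    using closure_subset[of "{x. f x \<noteq> 0}"] by (intro ext) (auto simp: indicator_def)
  ultimately show ?thesis by simp
qed

lemma test_integrable: "test f \<Longrightarrow> integrable lborel f"
  by (intro continuous_bounded_support_integrable smooth_continuous) (auto simp: test_def)

lemma test_bounded: 
  assumes "test f" obtains B where "B > 0" "\<And>x. \<bar>f x\<bar> \<le> B"
  using that by (rule bounded_continuous_bounded_support[OF smooth_continuous[OF testD(1)[OF assms]] testD(2)[OF assms]])

lemma test_square_integrable: "test f \<Longrightarrow> square_integrable lborel f"
  using test_integrable[OF test_mult1[of f f]] test_measurable[of f]
  by (auto simp: square_integrable_def power2_eq_square testD)

lemma integral_translate:
  fixes f :: "'a::euclidean_space \<Rightarrow> real"
  assumes "f \<in> borel_measurable borel"
  shows "(\<integral>x. f (x + h) \<partial>lborel) = (\<integral>x. f x \<partial>lborel)"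
proof -
  have "(\<integral>x. f x \<partial>lborel) = (\<integral>x. f x \<partial>distr lborel borel ((+) h))"
    by (simp add: lborel_distr_plus)
  also have "\<dots> = (\<integral>x. f (x + h) \<partial>lborel)"
    using assms by (subst integral_distr) (auto simp: add.commute)
  finally show ?thesis ..
qed

lemma integrable_translate:
  fixes f :: "'a::euclidean_space \<Rightarrow> real"
  assumes "integrable lborel f"
  shows "integrable lborel (\<lambda>x. f (x + h))"
proof -
  have "integrable (distr lborel borel ((+) h)) f"
    using assms by (simp add: lborel_distr_plus)
  then have "integrable lborel (\<lambda>x. f (h + x))"
    using assms by (subst (asm) integrable_distr_eq) auto
  then show ?thesis by (simp add: add.commute)
qed

lemma square_integrable_translate:
  fixes f :: "'a::euclidean_space \<Rightarrow> real"
  assumes "square_integrable lborel f" shows "square_integrable lborel (\<lambda>x. f (x + h))"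
  using assms integrable_translate[of "\<lambda>x. (f x)\<^sup>2" h]
    measurable_compose[OF borel_measurable_add[OF measurable_ident_sets[OF sets_lborel] borel_measurable_const[of h lborel]], of f borel]
  by (simp add: square_integrable_def)

lemma l2norm_translate:
  fixes f :: "'a::euclidean_space \<Rightarrow> real"
  assumes "f \<in> borel_measurable borel"
  shows "l2norm lborel (\<lambda>x. f (x + h)) = l2norm lborel f"
  unfolding l2norm_def using integral_translate[of "\<lambda>x. (f x)\<^sup>2" h] assms by simp

lemma derivative_along:
  assumes "smooth f"
  shows "((\<lambda>t. f (x + t *\<^sub>R h)) has_real_derivative (frechet_derivative f (at (x + t *\<^sub>R h)) h)) (at t)"
proof -
  have 1: "((\<lambda>t. x + t *\<^sub>R h) has_derivative (\<lambda>s. s *\<^sub>R h)) (at t)"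
    by (auto intro!: derivative_eq_intros)
  have 2: "(f has_derivative frechet_derivative f (at (x + t *\<^sub>R h))) (at (x + t *\<^sub>R h))"
    by (rule smooth_has_derivative[OF assms])
  have "frechet_derivative f (at (x + t *\<^sub>R h)) (s *\<^sub>R h) = s * frechet_derivative f (at (x + t *\<^sub>R h)) h" for s
    using linear_scale[OF has_derivative_linear[OF 2]] by simp
  then show ?thesis
    using has_derivative_compose[OF 1 2] unfolding has_field_derivative_def
    by (simp add: mult.commute[of _ "frechet_derivative f (at (x + t *\<^sub>R h)) h"])
qed

lemma frechet_derivative_basis:
  assumes "smooth f"
  shows "frechet_derivative f (at x) h = (\<Sum>b\<in>Basis. (h \<bullet> b) * pd b f x)"
proof -
  have lin: "linear (frechet_derivative f (at x))"
    using smooth_has_derivative[OF assms] has_derivative_linear by blast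
  have "frechet_derivative f (at x) h = frechet_derivative f (at x) (\<Sum>b\<in>Basis. (h \<bullet> b) *\<^sub>R b)"
    by (simp add: euclidean_representation)
  also have "\<dots> = (\<Sum>b\<in>Basis. (h \<bullet> b) * pd b f x)"
    by (simp add: linear_sum[OF lin] linear_scale[OF lin] pd_apply)
  finally show ?thesis .
qed

lemma test_frechet: "test f \<Longrightarrow> test (\<lambda>x. frechet_derivative f (at x) h)"
proof -
  assume f: "test f"
  have "test (\<lambda>x. \<Sum>b\<in>B. (h \<bullet> b) * pd b f x)" if "B \<subseteq> Basis" for B
    using finite_subset[OF that finite_Basis] that
  proof induction
    case empty then show ?case by (simp add: test_def)
  next
    case (insert b B)
    then show ?case using f by (simp add: test_add test_mult2 test_pd)
  qed
  then show ?thesis using frechet_derivative_basis[OF testD(1)[OF f]] by simp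
qed

lemma increment_le:
  assumes f: "smooth f" and B: "\<And>y. \<bar>frechet_derivative f (at y) h\<bar> \<le> B"
  shows "\<bar>f (x + t *\<^sub>R h) - f x\<bar> \<le> B * \<bar>t\<bar>"
proof -
  have "norm (f (x + t *\<^sub>R h) - f (x + 0 *\<^sub>R h)) \<le> B * norm (t - 0)"
    by (rule field_differentiable_bound[of UNIV "\<lambda>t. f (x + t *\<^sub>R h)" "\<lambda>t. frechet_derivative f (at (x + t *\<^sub>R h)) h"])
       (use derivative_along[OF f] B in auto)
  then show ?thesis by simp
qed

text \<open>Difference quotients of a test function converge pointwise to the directional derivative and are
  dominated by a multiple of the indicator of one ball. Together with translation invariance of the
  integral this replaces Fubini's theorem in the next lemmas.\<close>

lemma difference_quotient_dominated:
  fixes f :: "'a::euclidean_space \<Rightarrow> real" and h :: 'a and N :: nat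
  assumes f: "test f"
  defines "q \<equiv> \<lambda>n x. (f (x + (1 / real (Suc n)) *\<^sub>R h) - f x) * real (Suc n)"
  obtains B R where "\<And>n x. \<bar>q n x\<bar> \<le> B * indicator (cball 0 R) x"
    "\<And>x. (\<lambda>n. q n x) \<longlonglongrightarrow> frechet_derivative f (at x) h"
proof -
  obtain B where B: "B > 0" "\<And>y. \<bar>frechet_derivative f (at y) h\<bar> \<le> B"
    using test_bounded[OF test_frechet[OF f]] by blast
  obtain R where R: "R > 0" "\<And>x. f x \<noteq> 0 \<Longrightarrow> norm x \<le> R"
    using testD(2)[OF f] bounded_pos by (metis (mono_tags, lifting) mem_Collect_eq)
  have 1: "\<bar>q n x\<bar> \<le> B * indicator (cball 0 (R + norm h)) x" for n x
  proof (cases "x \<in> cball 0 (R + norm h)")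
    case True
    have "\<bar>f (x + (1 / real (Suc n)) *\<^sub>R h) - f x\<bar> \<le> B * \<bar>1 / real (Suc n)\<bar>"
      by (rule increment_le[OF testD(1)[OF f] B(2)])
    then have "\<bar>q n x\<bar> \<le> B" unfolding q_def abs_mult by (simp add: field_simps)
    then show ?thesis using True by simp
  next
    case False
    then have n: "norm x > R + norm h" by simp
    have "norm ((1 / real (Suc n)) *\<^sub>R h) \<le> norm h"
      using mult_left_mono[of 1 "real (Suc n)" "norm h"] by (simp add: divide_le_eq del: of_nat_Suc)
    then have "norm (x + (1 / real (Suc n)) *\<^sub>R h) > R"
      using n norm_diff_ineq[of x "(1 / real (Suc n)) *\<^sub>R h"] by linarith
    then have "f (x + (1 / real (Suc n)) *\<^sub>R h) = 0" "f x = 0"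
      using R(2)[of "x + (1 / real (Suc n)) *\<^sub>R h"] R(2)[of x] n norm_ge_zero[of h] by linarith+
    then show ?thesis unfolding q_def using False by simp
  qed
  have 2: "(\<lambda>n. q n x) \<longlonglongrightarrow> frechet_derivative f (at x) h" for x
  proof -
    have "((\<lambda>t. (f (x + t *\<^sub>R h) - f x) / t) \<longlongrightarrow> frechet_derivative f (at x) h) (at 0)"
      using derivative_along[OF testD(1)[OF f], of x h 0] by (simp add: DERIV_def)
    moreover have "filterlim (\<lambda>n. 1 / real (Suc n)) (at 0) sequentially"
      unfolding filterlim_at using LIMSEQ_inverse_real_of_nat by (simp add: inverse_eq_divide)
    ultimately have "(\<lambda>n. (f (x + (1 / real (Suc n)) *\<^sub>R h) - f x) / (1 / real (Suc n))) \<longlonglongrightarrow> frechet_derivative f (at x) h"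
      by (rule filterlim_compose)
    then show ?thesis by (simp add: q_def)
  qed
  show ?thesis using that 1 2 by blast
qed

text \<open>The difference quotients of \<open>f\<close> have integral \<open>0\<close> by translation invariance.\<close>

lemma integral_pd_zero:
  assumes f: "test f" shows "(\<integral>x. pd b f x \<partial>lborel) = 0"
proof -
  define q where "q = (\<lambda>n x. (f (x + (1 / real (Suc n)) *\<^sub>R b) - f x) * real (Suc n))"
  obtain B R where q: "\<And>n x. \<bar>q n x\<bar> \<le> B * indicator (cball 0 R) x" "\<And>x. (\<lambda>n. q n x) \<longlonglongrightarrow> pd b f x"
    using difference_quotient_dominated[OF f, of b] unfolding q_def pd_apply by blast
  have [measurable]: "f \<in> borel_measurable borel" by (rule test_measurable[OF f])
  have [measurable]: "pd b f \<in> borel_measurable borel"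
    unfolding pd_apply by (rule test_measurable[OF test_frechet[OF f]])
  have "(\<lambda>n. \<integral>x. q n x \<partial>lborel) \<longlonglongrightarrow> (\<integral>x. pd b f x \<partial>lborel)"
  proof (rule integral_dominated_convergence[where w="\<lambda>x. B * indicator (cball 0 R) x"])
    show "q n \<in> borel_measurable lborel" for n unfolding q_def by measurable
    show "integrable lborel (\<lambda>x. B * indicator (cball 0 R) x)"
      by (intro integrable_mult_right integrable_real_indicator)
        (auto intro: emeasure_bounded_finite simp flip: infinity_ennreal_def)
  qed (use q in auto)
  moreover have "(\<integral>x. q n x \<partial>lborel) = 0" for n
  proof -
    let ?h = "(1 / real (Suc n)) *\<^sub>R b"
    have "(\<integral>x. q n x \<partial>lborel) = ((\<integral>x. f (x + ?h) \<partial>lborel) - (\<integral>x. f x \<partial>lborel)) * real (Suc n)"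
      unfolding q_def integral_mult_left_zero
      by (subst Bochner_Integration.integral_diff[OF integrable_translate[OF test_integrable[OF f]] test_integrable[OF f]]) (rule refl)
    then show ?thesis using integral_translate[of f ?h] by simp
  qed
  ultimately have "(\<lambda>n. 0) \<longlonglongrightarrow> (\<integral>x. pd b f x \<partial>lborel)" by simp
  then show ?thesis using LIMSEQ_unique tendsto_const by blast
qed

lemma integration_by_parts_pd:
  assumes "smooth f" "test g" "b \<in> Basis"
  shows "(\<integral>x. f x * pd b g x \<partial>lborel) = - (\<integral>x. pd b f x * g x \<partial>lborel)"
proof -
  have "pd b (\<lambda>x. f x * g x) = (\<lambda>x. pd b f x * g x + f x * pd b g x)"
    using assms by (intro ext pd_mult smooth_differentiable) (auto dest: testD)
  then have "(\<integral>x. pd b f x * g x + f x * pd b g x \<partial>lborel) = 0"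
    using integral_pd_zero[OF test_mult2[OF assms(1,2)], of b] by simp
  then show ?thesis
    using test_integrable[OF test_mult2[OF smooth_pd[OF assms(1,3)] assms(2)]]
      test_integrable[OF test_mult2[OF assms(1) test_pd[OF assms(2,3)]]]
    by simp
qed

text \<open>Integrating by parts one derivative at a time reverses their order. Keeping \<open>rev bs\<close> instead of
  invoking the symmetry of higher derivatives is harmless, as all norms sum over every \<open>bs\<close>.\<close>

lemma integration_by_parts:
  assumes "smooth f" "test g" "set bs \<subseteq> Basis"
  shows "(\<integral>x. f x * partial_deriv bs g x \<partial>lborel)
    = (-1) ^ length bs * (\<integral>x. partial_deriv (rev bs) f x * g x \<partial>lborel)"
  using assms(1,3)
proof (induction bs arbitrary: f)
  case (Cons b bs)
  have "(\<integral>x. f x * partial_deriv (b # bs) g x \<partial>lborel) = (\<integral>x. f x * pd b (partial_deriv bs g) x \<partial>lborel)"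
    using partial_deriv_append[of "[b]" bs g] by simp
  also have "\<dots> = - (\<integral>x. pd b f x * partial_deriv bs g x \<partial>lborel)"
    using Cons.prems assms(2) by (intro integration_by_parts_pd test_partial_deriv) auto
  also have "\<dots> = - ((-1) ^ length bs * (\<integral>x. partial_deriv (rev bs) (pd b f) x * g x \<partial>lborel))"
    using Cons.prems by (subst Cons.IH) (auto intro: smooth_pd)
  finally show ?case by (simp add: partial_deriv_append)
qed simp

text \<open>Splitting the step \<open>h\<close> into \<open>n\<close> equal ones gives \<open>\<parallel>f(x + h) - f(x)\<parallel> \<le> n \<parallel>f(x + h/n) - f(x)\<parallel>\<close>, and the right-hand
  side tends to the norm of the derivative along \<open>h\<close>.\<close>

lemma l2norm_increment_le:
  fixes f :: "'a::euclidean_space \<Rightarrow> real"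
  assumes f: "test f"
  shows "l2norm lborel (\<lambda>x. f (x + h) - f x) \<le> norm h * (\<Sum>b\<in>Basis. l2norm lborel (pd b f))"
proof -
  define q where "q = (\<lambda>n x. (f (x + (1 / real (Suc n)) *\<^sub>R h) - f x) * real (Suc n))"
  obtain B R where q: "\<And>n x. \<bar>q n x\<bar> \<le> B * indicator (cball 0 R) x"
      "\<And>x. (\<lambda>n. q n x) \<longlonglongrightarrow> frechet_derivative f (at x) h"
    using difference_quotient_dominated[OF f, of h] unfolding q_def by blast
  have [measurable]: "f \<in> borel_measurable borel" by (rule test_measurable[OF f])
  have [measurable]: "(\<lambda>x. frechet_derivative f (at x) h) \<in> borel_measurable borel"
    by (rule test_measurable[OF test_frechet[OF f]])
  have "(\<lambda>n. \<integral>x. (q n x)\<^sup>2 \<partial>lborel) \<longlonglongrightarrow> (\<integral>x. (frechet_derivative f (at x) h)\<^sup>2 \<partial>lborel)"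
  proof (rule integral_dominated_convergence[where w="\<lambda>x. B\<^sup>2 * indicator (cball 0 R) x"])
    show "(\<lambda>x. (q n x)\<^sup>2) \<in> borel_measurable lborel" for n unfolding q_def by measurable
    show "integrable lborel (\<lambda>x. B\<^sup>2 * indicator (cball 0 R) x)"
      by (intro integrable_mult_right integrable_real_indicator)
        (auto intro: emeasure_bounded_finite simp flip: infinity_ennreal_def)
    show "AE x in lborel. norm ((q n x)\<^sup>2) \<le> B\<^sup>2 * indicator (cball 0 R) x" for n
    proof (intro AE_I2)
      fix x
      have "\<bar>q n x\<bar>\<^sup>2 \<le> (B * indicator (cball 0 R) x)\<^sup>2" by (intro power_mono q) auto
      also have "\<dots> = B\<^sup>2 * indicator (cball 0 R) x"
        by (simp add: power_mult_distrib indicator_def)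
      finally show "norm ((q n x)\<^sup>2) \<le> B\<^sup>2 * indicator (cball 0 R) x" by simp
    qed
    show "AE x in lborel. (\<lambda>n. (q n x)\<^sup>2) \<longlonglongrightarrow> (frechet_derivative f (at x) h)\<^sup>2"
      by (intro AE_I2 tendsto_power q)
    show "(\<lambda>x. (frechet_derivative f (at x) h)\<^sup>2) \<in> borel_measurable lborel"
      using test_measurable[OF test_frechet[OF f, of h]] by simp
  qed
  then have lim: "(\<lambda>n. l2norm lborel (q n)) \<longlonglongrightarrow> l2norm lborel (\<lambda>x. frechet_derivative f (at x) h)"
    unfolding l2norm_def by (rule tendsto_real_sqrt)
  have le: "l2norm lborel (\<lambda>x. f (x + h) - f x) \<le> l2norm lborel (q n)" for n
  proof -
    define d where "d = (1 / real (Suc n)) *\<^sub>R h"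
    have sq: "square_integrable lborel (\<lambda>x. f (x + v))" for v
      by (intro test_square_integrable test_translate f)
    have "l2norm lborel (\<lambda>x. f (x + real k *\<^sub>R d) - f x) \<le> real k * l2norm lborel (\<lambda>x. f (x + d) - f x)" for k
    proof (induction k)
      case (Suc k)
      have "l2norm lborel (\<lambda>x. f (x + real (Suc k) *\<^sub>R d) - f x)
        \<le> l2norm lborel (\<lambda>x. f (x + real (Suc k) *\<^sub>R d) - f (x + real k *\<^sub>R d)) + l2norm lborel (\<lambda>x. f (x + real k *\<^sub>R d) - f x)"
        using l2norm_sub_triangle[OF sq sq sq, of "real (Suc k) *\<^sub>R d" 0 "real k *\<^sub>R d"] by simp
      also have "l2norm lborel (\<lambda>x. f (x + real (Suc k) *\<^sub>R d) - f (x + real k *\<^sub>R d)) = l2norm lborel (\<lambda>x. f (x + d) - f x)"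
        using l2norm_translate[of "\<lambda>x. f (x + d) - f x" "real k *\<^sub>R d"]
        by (simp add: algebra_simps)
      finally show ?case using Suc by (simp add: algebra_simps)
    qed simp
    from this[of "Suc n"] have "l2norm lborel (\<lambda>x. f (x + h) - f x) \<le> real (Suc n) * l2norm lborel (\<lambda>x. f (x + d) - f x)"
      by (simp add: d_def del: of_nat_Suc)
    also have "\<dots> = l2norm lborel (q n)"
      unfolding q_def d_def using l2norm_scale[of lborel "real (Suc n)" "\<lambda>x. f (x + (1 / real (Suc n)) *\<^sub>R h) - f x"]
      by (simp add: mult.commute)
    finally show ?thesis .
  qed
  have "l2norm lborel (\<lambda>x. f (x + h) - f x) \<le> l2norm lborel (\<lambda>x. frechet_derivative f (at x) h)"
    by (rule LIMSEQ_le_const[OF lim]) (use le in auto)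
  also have "\<dots> = l2norm lborel (\<lambda>x. \<Sum>b\<in>Basis. (h \<bullet> b) * pd b f x)"
    by (simp add: frechet_derivative_basis[OF testD(1)[OF f]])
  also have "\<dots> \<le> (\<Sum>b\<in>Basis. l2norm lborel (\<lambda>x. (h \<bullet> b) * pd b f x))"
    by (intro l2norm_sum_le square_integrable_scale test_square_integrable test_pd f)
  also have "\<dots> \<le> (\<Sum>b\<in>Basis. norm h * l2norm lborel (pd b f))"
    unfolding l2norm_scale by (intro sum_mono mult_right_mono Basis_le_norm) auto
  finally show ?thesis by (simp add: sum_distrib_left)
qed

text \<open>For a step longer than the diameter of the support, \<open>f\<close> and its translate have disjoint supports, so
  \<open>|f|\<close> is at most the increment; the previous lemma bounds the increment.\<close>

lemma Poincare_test:
  fixes f :: "'a::euclidean_space \<Rightarrow> real"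
  assumes f: "test f" and supp: "\<And>x. f x \<noteq> 0 \<Longrightarrow> norm x \<le> R" and "R > 0"
  shows "l2norm lborel f \<le> 4 * R * (\<Sum>b\<in>Basis. l2norm lborel (pd b f))"
proof -
  obtain b :: 'a where b: "b \<in> Basis" using nonempty_Basis by blast
  define h where "h = (4 * R) *\<^sub>R b"
  have h: "norm h = 4 * R" using b \<open>R > 0\<close> by (simp add: h_def)
  have *: "\<bar>f x\<bar> \<le> \<bar>f (x + h) - f x\<bar>" for x
  proof (cases "f x = 0")
    case False
    then have "norm (x + h) > R"
      using supp[of x] norm_diff_ineq[of h x] h \<open>R > 0\<close> by (simp add: add.commute)
    then have "f (x + h) = 0" using supp[of "x + h"] by fastforce
    then show ?thesis by simp
  qed simp
  have "l2norm lborel f \<le> l2norm lborel (\<lambda>x. f (x + h) - f x)"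
    using * test_measurable[OF f]
    by (intro square_integrable_dominated(2)[OF test_square_integrable[OF test_diff[OF test_translate[OF f] f]]]) auto
  also have "\<dots> \<le> norm h * (\<Sum>b\<in>Basis. l2norm lborel (pd b f))"
    by (rule l2norm_increment_le[OF f])
  finally show ?thesis using h by simp
qed

section \<open>Functions on an open set and their extensions by zero\<close>

lemma test_function_iff:
  "test_function \<Omega> \<phi> \<longleftrightarrow> test \<phi> \<and> closure {x. \<phi> x \<noteq> 0} \<subseteq> \<Omega>"
  by (auto simp: test_function_def test_def smooth_def directions_def)

lemma test_function_test: "test_function \<Omega> \<phi> \<Longrightarrow> test \<phi>"
  by (simp add: test_function_iff)

lemma test_function_outside: "test_function \<Omega> \<phi> \<Longrightarrow> x \<notin> \<Omega> \<Longrightarrow> \<phi> x = 0"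
  using closure_subset[of "{x. \<phi> x \<noteq> 0}"] by (auto simp: test_function_iff)

lemma test_function_partial_deriv:
  "test_function \<Omega> \<phi> \<Longrightarrow> set bs \<subseteq> Basis \<Longrightarrow> test_function \<Omega> (partial_deriv bs \<phi>)"
  unfolding test_function_iff using test_partial_deriv[of \<phi> bs]
    closure_mono[OF partial_deriv_support[of bs \<phi>]] by auto

lemma test_function_diff:
  assumes "test_function \<Omega> f" "test_function \<Omega> g" 
  shows "test_function \<Omega> (\<lambda>x. f x - g x)"
proof -
  have "closure {x. f x - g x \<noteq> 0} \<subseteq> closure ({x. f x \<noteq> 0} \<union> {x. g x \<noteq> 0})"
    by (rule closure_mono) auto
  then show ?thesis using assms test_diff[of f g] by (auto simp: test_function_iff)
qed

lemma AE_lebesgue_on_iff: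
  assumes "\<Omega> \<in> sets lebesgue"
  shows "(AE x in lebesgue_on \<Omega>. P x) \<longleftrightarrow> (AE x in lborel. x \<in> \<Omega> \<longrightarrow> P x)"
  using assms by (simp add: AE_restrict_space_iff AE_completion_iff)

lemma measurable_lebesgue_on_borel:
  "f \<in> borel_measurable borel \<Longrightarrow> f \<in> borel_measurable (lebesgue_on \<Omega>)"
  by (simp add: measurable_completion measurable_restrict_space1)

lemma
  fixes f :: "'a::euclidean_space \<Rightarrow> real"
  assumes \<Omega>: "\<Omega> \<in> sets lebesgue" and f: "f \<in> borel_measurable borel" and zero: "\<And>x. x \<notin> \<Omega> \<Longrightarrow> f x = 0"
  shows integral_lebesgue_on_borel: "(\<integral>x. f x \<partial>lebesgue_on \<Omega>) = (\<integral>x. f x \<partial>lborel)"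
    and integrable_lebesgue_on_borel: "integrable (lebesgue_on \<Omega>) f \<longleftrightarrow> integrable lborel f"
proof -
  have *: "(\<lambda>x. indicator \<Omega> x *\<^sub>R f x) = f" using zero by (intro ext) (auto simp: indicator_def)
  show "(\<integral>x. f x \<partial>lebesgue_on \<Omega>) = (\<integral>x. f x \<partial>lborel)"
    using \<Omega> f by (subst integral_restrict_space) (simp_all add: * integral_completion del: real_scaleR_def)
  show "integrable (lebesgue_on \<Omega>) f \<longleftrightarrow> integrable lborel f"
    using \<Omega> f by (subst integrable_restrict_space) (simp_all add: * integrable_completion del: real_scaleR_def)
qed

lemma
  fixes f :: "'a::euclidean_space \<Rightarrow> real"
  assumes \<Omega>: "\<Omega> \<in> sets lebesgue" and f: "f \<in> borel_measurable borel" and zero: "\<And>x. x \<notin> \<Omega> \<Longrightarrow> f x = 0"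
  shows square_integrable_lebesgue_on_borel:
      "square_integrable (lebesgue_on \<Omega>) f \<longleftrightarrow> square_integrable lborel f"
    and l2norm_lebesgue_on_borel: "l2norm (lebesgue_on \<Omega>) f = l2norm lborel f"
  using integrable_lebesgue_on_borel[of \<Omega> "\<lambda>x. (f x)\<^sup>2"] integral_lebesgue_on_borel[of \<Omega> "\<lambda>x. (f x)\<^sup>2"]
    assms measurable_lebesgue_on_borel[OF f, of \<Omega>]
  by (auto simp: square_integrable_def l2norm_def)

lemma borel_zero_extension:
  fixes f :: "'a::euclidean_space \<Rightarrow> real"
  assumes \<Omega>: "\<Omega> \<in> sets borel" and f: "f \<in> borel_measurable (lebesgue_on \<Omega>)"
  obtains g where "g \<in> borel_measurable borel" "\<And>x. x \<notin> \<Omega> \<Longrightarrow> g x = 0" "AE x in lebesgue_on \<Omega>. f x = g x"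
proof -
  have "(\<lambda>x. indicator \<Omega> x *\<^sub>R f x) \<in> borel_measurable lebesgue"
    using f \<Omega> by (subst (asm) borel_measurable_restrict_space_iff) auto
  then obtain g where g: "g \<in> borel_measurable lborel" "AE x in lborel. indicator \<Omega> x *\<^sub>R f x = g x"
    using completion_ex_borel_measurable_real by blast
  show ?thesis
  proof (rule that[of "\<lambda>x. indicator \<Omega> x * g x"])
    show "(\<lambda>x. indicator \<Omega> x * g x) \<in> borel_measurable borel" using g(1) \<Omega> by simp
    show "AE x in lebesgue_on \<Omega>. f x = indicator \<Omega> x * g x"
      using g(2) \<Omega> by (subst AE_lebesgue_on_iff) (auto simp: indicator_def)
  qed auto
qed

section \<open>Uniqueness of weak derivatives\<close>

lemma locally_integrable_mult_test:
  assumes u: "locally_integrable \<Omega> u" and \<phi>: "test_function \<Omega> \<phi>" and \<Omega>: "\<Omega> \<in> sets lebesgue"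
  shows "integrable (lebesgue_on \<Omega>) (\<lambda>x. u x * \<phi> x)"
proof -
  define K where "K = closure {x. \<phi> x \<noteq> 0}"
  have K: "compact K" "K \<subseteq> \<Omega>" "K \<in> sets lebesgue"
    using \<phi> by (auto simp: K_def test_function_iff test_def)
  obtain B where B: "\<And>x. \<bar>\<phi> x\<bar> \<le> B" using test_bounded[OF test_function_test[OF \<phi>]] by blast
  have "integrable (lebesgue_on K) u" using u K by (auto simp: locally_integrable_def)
  then have "integrable (lebesgue_on K) (\<lambda>x. B * u x)" by simp
  then have "integrable (lebesgue_on K) (\<lambda>x. u x * \<phi> x)"
  proof (rule Bochner_Integration.integrable_bound)
    show "(\<lambda>x. u x * \<phi> x) \<in> borel_measurable (lebesgue_on K)"
      by (intro borel_measurable_times borel_measurable_integrable[OF \<open>integrable (lebesgue_on K) u\<close>]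
          measurable_lebesgue_on_borel test_measurable test_function_test[OF \<phi>])
    have "\<bar>u x * \<phi> x\<bar> \<le> \<bar>B * u x\<bar>" for x
      using mult_left_mono[OF order_trans[OF B abs_ge_self], of "\<bar>u x\<bar>" x]
      by (simp add: abs_mult mult.commute)
    then show "AE x in lebesgue_on K. norm (u x * \<phi> x) \<le> norm (B * u x)" by simp
  qed
  then have "integrable lebesgue (\<lambda>x. indicator K x *\<^sub>R (u x * \<phi> x))"
    using K by (subst (asm) integrable_restrict_space) auto
  also have "(\<lambda>x. indicator K x *\<^sub>R (u x * \<phi> x)) = (\<lambda>x. indicator \<Omega> x *\<^sub>R (u x * \<phi> x))"
    using closure_subset[of "{x. \<phi> x \<noteq> 0}"] K(2) by (intro ext) (auto simp: K_def indicator_def)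
  finally show ?thesis using \<Omega> by (subst integrable_restrict_space) auto
qed

lemma test_function_box_bump:
  assumes "cbox a c \<subseteq> \<Omega>" "n > 0"
  shows "test_function \<Omega> (box_bump n a c)"
proof -
  have sub: "{x. box_bump n a c x \<noteq> 0} \<subseteq> cbox a c"
    using box_bump_outside[OF assms(2)] box_subset_cbox by blast
  then have "closure {x. box_bump n a c x \<noteq> 0} \<subseteq> cbox a c" by (intro closure_minimal) auto
  then show ?thesis using assms sub bounded_subset[OF bounded_cbox sub]
    by (auto simp: test_function_iff test_def smooth_box_bump)
qed

text \<open>Bumps increase to the indicator of the open box, and their pairings with \<open>v\<close> vanish.\<close>

lemma box_integral_zero:
  fixes v :: "'a::euclidean_space \<Rightarrow> real"
  assumes v: "locally_integrable \<Omega> v" and \<Omega>: "open \<Omega>"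
    and zero: "\<And>\<phi>. test_function \<Omega> \<phi> \<Longrightarrow> (\<integral>x. v x * \<phi> x \<partial>lebesgue_on \<Omega>) = 0"
    and sub: "cbox a c \<subseteq> \<Omega>"
  shows "integral (cbox a c) v = 0"
proof -
  have iK: "integrable (lebesgue_on (cbox a c)) v" using v sub by (auto simp: locally_integrable_def)
  have ib: "integrable lebesgue (\<lambda>x. indicator (cbox a c) x *\<^sub>R v x)"
    using iK by (subst (asm) integrable_restrict_space) auto
  have "(\<lambda>n. \<integral>x. v x * box_bump (real (Suc n)) a c x \<partial>lebesgue_on (cbox a c))
     \<longlonglongrightarrow> (\<integral>x. v x * indicator (box a c) x \<partial>lebesgue_on (cbox a c))"
  proof (rule integral_dominated_convergence[where w="\<lambda>x. \<bar>v x\<bar>"])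
    show "integrable (lebesgue_on (cbox a c)) (\<lambda>x. \<bar>v x\<bar>)" using iK by auto
    show "(\<lambda>x. v x * indicator (box a c) x) \<in> borel_measurable (lebesgue_on (cbox a c))"
      by (intro borel_measurable_times borel_measurable_integrable[OF iK] measurable_lebesgue_on_borel) simp
    show "(\<lambda>x. v x * box_bump (real (Suc n)) a c x) \<in> borel_measurable (lebesgue_on (cbox a c))" for n
      by (intro borel_measurable_times borel_measurable_integrable[OF iK] measurable_lebesgue_on_borel
          borel_measurable_continuous_onI smooth_continuous smooth_box_bump)
    show "AE x in lebesgue_on (cbox a c). norm (v x * box_bump (real (Suc n)) a c x) \<le> \<bar>v x\<bar>" for n
      using box_bump_nonneg[of "real (Suc n)" a c] box_bump_le_1[of "real (Suc n)" a c]
      by (auto simp: abs_mult intro!: mult_left_le simp del: of_nat_Suc)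
    show "AE x in lebesgue_on (cbox a c). (\<lambda>n. v x * box_bump (real (Suc n)) a c x) \<longlonglongrightarrow> v x * indicator (box a c) x"
    proof (intro AE_I2 tendsto_mult tendsto_const)
      fix x
      show "(\<lambda>n. box_bump (real (Suc n)) a c x) \<longlonglongrightarrow> indicator (box a c) x"
      proof (cases "x \<in> box a c")
        case True then show ?thesis using box_bump_tendsto[OF True] by simp
      next
        case False then show ?thesis by (simp add: box_bump_outside del: of_nat_Suc)
      qed
    qed
  qed
  moreover have "(\<integral>x. v x * box_bump (real (Suc n)) a c x \<partial>lebesgue_on (cbox a c)) = 0" for n
  proof -
    let ?b = "box_bump (real (Suc n)) a c"
    have out: "?b x = 0" if "x \<notin> cbox a c" for x
      using that box_subset_cbox[of a c] by (intro box_bump_outside) auto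
    have "(\<integral>x. v x * ?b x \<partial>lebesgue_on (cbox a c)) = (\<integral>x. indicator (cbox a c) x *\<^sub>R (v x * ?b x) \<partial>lebesgue)"
      by (rule integral_restrict_space) auto
    also have "(\<lambda>x. indicator (cbox a c) x *\<^sub>R (v x * ?b x)) = (\<lambda>x. indicator \<Omega> x *\<^sub>R (v x * ?b x))"
      using out sub by (intro ext) (auto simp: indicator_def)
    also have "(\<integral>x. indicator \<Omega> x *\<^sub>R (v x * ?b x) \<partial>lebesgue) = (\<integral>x. v x * ?b x \<partial>lebesgue_on \<Omega>)"
      using \<Omega> by (intro integral_restrict_space[symmetric]) auto
    also have "\<dots> = 0" by (intro zero test_function_box_bump sub) auto
    finally show ?thesis .
  qed
  ultimately have "(\<integral>x. v x * indicator (box a c) x \<partial>lebesgue_on (cbox a c)) = 0"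
    by (simp only: LIMSEQ_const_iff)
  moreover have "(\<integral>x. v x * indicator (box a c) x \<partial>lebesgue_on (cbox a c)) = (\<integral>x. v x \<partial>lebesgue_on (box a c))"
  proof -
    have "(\<integral>x. v x * indicator (box a c) x \<partial>lebesgue_on (cbox a c)) = (\<integral>x. indicator (cbox a c) x *\<^sub>R (v x * indicator (box a c) x) \<partial>lebesgue)"
      by (rule integral_restrict_space) auto
    also have "(\<lambda>x. indicator (cbox a c) x *\<^sub>R (v x * indicator (box a c) x)) = (\<lambda>x. indicator (box a c) x *\<^sub>R v x)"
      using box_subset_cbox[of a c] by (intro ext) (auto simp: indicator_def)
    also have "(\<integral>x. indicator (box a c) x *\<^sub>R v x \<partial>lebesgue) = (\<integral>x. v x \<partial>lebesgue_on (box a c))"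
      by (rule integral_restrict_space[symmetric]) auto
    finally show ?thesis .
  qed
  moreover have "integrable (lebesgue_on (box a c)) v"
  proof -
    have "integrable lebesgue (\<lambda>x. indicator (box a c) x *\<^sub>R (indicator (cbox a c) x *\<^sub>R v x))"
      using ib by (rule integrable_mult_indicator[rotated]) auto
    also have "(\<lambda>x. indicator (box a c) x *\<^sub>R (indicator (cbox a c) x *\<^sub>R v x)) = (\<lambda>x. indicator (box a c) x *\<^sub>R v x)"
      using box_subset_cbox[of a c] by (intro ext) (auto simp: indicator_def)
    finally show ?thesis by (subst integrable_restrict_space) auto
  qed
  then have "(\<integral>x. v x \<partial>lebesgue_on (box a c)) = integral (box a c) v"
    by (intro lebesgue_integral_eq_integral) auto
  ultimately show ?thesis by (simp add: integral_open_interval)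
qed

text \<open>The fundamental lemma of the calculus of variations. The averages of \<open>v\<close> over all small cubes vanish,
  and by Lebesgue differentiation they converge to \<open>v\<close> almost everywhere.\<close>

lemma fundamental_lemma:
  fixes v :: "'a::euclidean_space \<Rightarrow> real"
  assumes v: "locally_integrable \<Omega> v" and \<Omega>: "open \<Omega>"
    and zero: "\<And>\<phi>. test_function \<Omega> \<phi> \<Longrightarrow> (\<integral>x. v x * \<phi> x \<partial>lebesgue_on \<Omega>) = 0"
  shows "AE x in lebesgue_on \<Omega>. v x = 0"
proof -
  have box: "AE x in lebesgue. x \<in> cbox a c \<longrightarrow> v x = 0" if sub: "cbox a c \<subseteq> \<Omega>" for a c :: 'a
  proof -
    define g where "g = (\<lambda>x. if x \<in> cbox a c then v x else 0)"
    have iK: "integrable (lebesgue_on (cbox a c)) v" using v sub by (auto simp: locally_integrable_def)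
    then have "integrable lebesgue g" unfolding g_def by (subst Lebesgue_Measure.integrable_restrict_UNIV) auto
    then have "g integrable_on UNIV" by (rule integrable_on_lebesgue)
    then have "g integrable_on cbox p q" for p q by (rule integrable_on_subcbox) auto
    then obtain N where N: "negligible N" "\<And>x e. \<lbrakk>x \<notin> N; 0 < e\<rbrakk> \<Longrightarrow>
               \<exists>d>0. \<forall>h. 0 < h \<and> h < d \<longrightarrow>
                         norm (integral (cbox x (x + h *\<^sub>R One)) g /\<^sub>R h ^ DIM('a) - g x) < e"
      using integrable_ccontinuous_explicit by blast
    have gz: "g x = 0" if x: "x \<notin> N" "x \<in> box a c" for x
    proof (rule ccontr)
      assume "g x \<noteq> 0"
      then obtain d where d: "d > 0" "\<And>h. 0 < h \<Longrightarrow> h < d \<Longrightarrow>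
          norm (integral (cbox x (x + h *\<^sub>R One)) g /\<^sub>R h ^ DIM('a) - g x) < norm (g x)"
        using N(2)[OF x(1), of "norm (g x)"] by auto
      obtain e where e: "e > 0" "ball x e \<subseteq> box a c"
        using x(2) open_box[of a c] open_contains_ball by blast
      \<comment> \<open>A cube with this side lies within distance \<open>e\<close> of its corner \<open>x\<close>, hence inside the box.\<close>
      define h where "h = min (d / 2) (e / (2 * DIM('a)))"
      have h: "h > 0" "h < d" "h * DIM('a) < e"
      proof -
        show "h > 0" "h < d" using d(1) e(1) by (auto simp: h_def)
        have "h * DIM('a) \<le> (e / (2 * DIM('a))) * DIM('a)" by (intro mult_right_mono) (auto simp: h_def)
        also have "\<dots> < e" using e(1) by simp
        finally show "h * DIM('a) < e" .
      qed
      have cb: "cbox x (x + h *\<^sub>R One) \<subseteq> box a c"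
      proof
        fix y assume y: "y \<in> cbox x (x + h *\<^sub>R One)"
        have "norm (y - x) \<le> (\<Sum>b\<in>Basis. \<bar>(y - x) \<bullet> b\<bar>)" by (rule norm_le_l1)
        also have "\<dots> \<le> (\<Sum>b\<in>(Basis::'a set). h)"
          using y by (intro sum_mono) (auto simp: mem_box inner_diff_left inner_add_left algebra_simps)
        also have "\<dots> < e" using h(3) by (simp add: mult.commute)
        finally show "y \<in> box a c" using e(2) by (auto simp: dist_norm norm_minus_commute)
      qed
      have "integral (cbox x (x + h *\<^sub>R One)) g = integral (cbox x (x + h *\<^sub>R One)) v"
        using cb box_subset_cbox[of a c] by (intro Henstock_Kurzweil_Integration.integral_cong) (auto simp: g_def)
      also have "\<dots> = 0"
        using cb box_subset_cbox[of a c] sub by (intro box_integral_zero[OF v \<Omega> zero]) auto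
      finally show False using d(2)[OF h(1,2)] by simp
    qed
    have "negligible (N \<union> (cbox a c - box a c))"
      using N(1) negligible_frontier_interval by (intro negligible_Un)
    then have "N \<union> (cbox a c - box a c) \<in> null_sets lebesgue" by (simp add: negligible_iff_null_sets)
    then have "AE x in lebesgue. x \<notin> N \<union> (cbox a c - box a c)" by (rule AE_not_in)
    then show ?thesis
    proof eventually_elim
      case (elim x)
      show ?case
      proof
        assume x: "x \<in> cbox a c"
        with elim have "g x = 0" by (intro gz) auto
        with x show "v x = 0" by (simp add: g_def)
      qed
    qed
  qed
  obtain \<D> where \<D>: "countable \<D>" "\<D> \<subseteq> Pow \<Omega>" "\<And>X. X \<in> \<D> \<Longrightarrow> \<exists>a b. X = cbox a b" "\<Union>\<D> = \<Omega>"
    using open_countable_Union_open_cbox[OF \<Omega>] by metis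
  have "AE x in lebesgue. \<forall>X\<in>\<D>. x \<in> X \<longrightarrow> v x = 0"
    using \<D>(2,3) box by (intro AE_ball_countable'[OF _ \<D>(1)]) blast
  then have "AE x in lebesgue. x \<in> \<Omega> \<longrightarrow> v x = 0"
    by eventually_elim (use \<D>(4) in auto)
  then show ?thesis using \<Omega> by (simp add: AE_restrict_space_iff)
qed

lemma locally_integrable_diff:
  "locally_integrable \<Omega> u \<Longrightarrow> locally_integrable \<Omega> v \<Longrightarrow> locally_integrable \<Omega> (\<lambda>x. u x - v x)"
  unfolding locally_integrable_def by auto

lemma has_weak_deriv_diff:
  assumes u: "has_weak_deriv \<Omega> bs u u'" and v: "has_weak_deriv \<Omega> bs v v'" and bs: "set bs \<subseteq> Basis" and \<Omega>: "open \<Omega>"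
  shows "has_weak_deriv \<Omega> bs (\<lambda>x. u x - v x) (\<lambda>x. u' x - v' x)"
  unfolding has_weak_deriv_def
proof (intro conjI allI impI)
  fix \<phi> assume \<phi>: "test_function \<Omega> \<phi>"
  have \<Omega>': "\<Omega> \<in> sets lebesgue" using \<Omega> by auto
  note i = locally_integrable_mult_test[OF _ \<phi> \<Omega>']
    locally_integrable_mult_test[OF _ test_function_partial_deriv[OF \<phi> bs] \<Omega>']
  show "(\<integral>x. (u x - v x) * partial_deriv bs \<phi> x \<partial>lebesgue_on \<Omega>)
      = (- 1) ^ length bs * (\<integral>x. (u' x - v' x) * \<phi> x \<partial>lebesgue_on \<Omega>)"
    using u v \<phi> i unfolding has_weak_deriv_def by (simp add: left_diff_distrib right_diff_distrib)
qed (use u v in \<open>auto simp: has_weak_deriv_def intro: locally_integrable_diff\<close>)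

lemma has_weak_deriv_unique:
  assumes u: "has_weak_deriv \<Omega> bs u v" "has_weak_deriv \<Omega> bs u w" and bs: "set bs \<subseteq> Basis" and \<Omega>: "open \<Omega>"
  shows "AE x in lebesgue_on \<Omega>. v x = w x"
proof -
  have "has_weak_deriv \<Omega> bs (\<lambda>x. u x - u x) (\<lambda>x. v x - w x)"
    by (rule has_weak_deriv_diff[OF u bs \<Omega>])
  then have "AE x in lebesgue_on \<Omega>. v x - w x = 0"
    using \<Omega> by (intro fundamental_lemma) (auto simp: has_weak_deriv_def)
  then show ?thesis by auto
qed

lemma locally_integrable_continuous:
  fixes f :: "'a::euclidean_space \<Rightarrow> real"
  assumes "continuous_on UNIV f"
  shows "locally_integrable \<Omega> f"
  unfolding locally_integrable_def
proof (intro allI impI)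
  fix K :: "'a set" assume K: "compact K \<and> K \<subseteq> \<Omega>"
  then have "integrable lborel (\<lambda>x. indicator K x *\<^sub>R f x)"
    by (intro borel_integrable_compact continuous_on_subset[OF assms]) auto
  moreover have "(\<lambda>x. indicator K x *\<^sub>R f x) \<in> borel_measurable lborel"
    using K assms by (intro borel_measurable_scaleR borel_measurable_indicator) (auto intro: borel_measurable_continuous_onI borel_compact)
  ultimately have "integrable lebesgue (\<lambda>x. indicator K x *\<^sub>R f x)"
    by (simp add: integrable_completion)
  then show "integrable (lebesgue_on K) f"
    using K by (subst integrable_restrict_space) (auto simp: borel_compact)
qed

lemma has_weak_deriv_smooth:
  assumes f: "smooth f" and bs: "set bs \<subseteq> Basis" and \<Omega>: "open \<Omega>"
  shows "has_weak_deriv \<Omega> bs f (partial_deriv (rev bs) f)"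
  unfolding has_weak_deriv_def
proof (intro conjI allI impI)
  show "locally_integrable \<Omega> f" "locally_integrable \<Omega> (partial_deriv (rev bs) f)"
    by (intro locally_integrable_continuous smooth_continuous smooth_partial_deriv f; use bs in simp)+
  fix \<phi> assume \<phi>: "test_function \<Omega> \<phi>"
  have 1: "smooth (partial_deriv (rev bs) f)" by (rule smooth_partial_deriv[OF f]) (use bs in simp)
  have 2: "test_function \<Omega> (partial_deriv bs \<phi>)" by (rule test_function_partial_deriv[OF \<phi> bs])
  have "(\<integral>x. f x * partial_deriv bs \<phi> x \<partial>lebesgue_on \<Omega>) = (\<integral>x. f x * partial_deriv bs \<phi> x \<partial>lborel)"
    using \<Omega> by (intro integral_lebesgue_on_borel test_measurable test_mult2 f test_function_test[OF 2])
      (auto simp: test_function_outside[OF 2])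
  also have "\<dots> = (- 1) ^ length bs * (\<integral>x. partial_deriv (rev bs) f x * \<phi> x \<partial>lborel)"
    by (rule integration_by_parts[OF f test_function_test[OF \<phi>] bs])
  also have "(\<integral>x. partial_deriv (rev bs) f x * \<phi> x \<partial>lborel) = (\<integral>x. partial_deriv (rev bs) f x * \<phi> x \<partial>lebesgue_on \<Omega>)"
    using \<Omega> by (intro integral_lebesgue_on_borel[symmetric] test_measurable test_mult2 1 test_function_test[OF \<phi>])
      (auto simp: test_function_outside[OF \<phi>])
  finally show "(\<integral>x. f x * partial_deriv bs \<phi> x \<partial>lebesgue_on \<Omega>)
      = (- 1) ^ length bs * (\<integral>x. partial_deriv (rev bs) f x * \<phi> x \<partial>lebesgue_on \<Omega>)" .
qed

section \<open>Borel representatives of weak derivatives\<close>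

text \<open>By completeness of Lebesgue measure. It makes chosen weak derivatives and almost everywhere limits
  measurable.\<close>

lemma measurable_AE_lebesgue_on:
  fixes f g :: "'a::euclidean_space \<Rightarrow> real"
  assumes f: "f \<in> borel_measurable (lebesgue_on S)" and S: "S \<in> sets lebesgue"
    and eq: "AE x in lebesgue_on S. f x = g x"
  shows "g \<in> borel_measurable (lebesgue_on S)"
proof -
  have "(\<lambda>x. indicator S x *\<^sub>R f x) \<in> borel_measurable lebesgue"
    using f S by (subst (asm) borel_measurable_restrict_space_iff) auto
  moreover have "AE x in lebesgue. indicator S x *\<^sub>R f x = indicator S x *\<^sub>R g x"
    using eq S by (auto simp: AE_restrict_space_iff indicator_def elim: eventually_mono)
  ultimately have "(\<lambda>x. indicator S x *\<^sub>R g x) \<in> borel_measurable lebesgue"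
    by (rule borel_measurable_AE)
  then show ?thesis using S by (subst borel_measurable_restrict_space_iff) auto
qed

definition multi_indices :: "nat \<Rightarrow> 'a::euclidean_space list set" where
  "multi_indices k = {bs. set bs \<subseteq> Basis \<and> length bs \<le> k}"

lemma multi_indices_UN: "multi_indices k = (\<Union>j\<le>k. directions j)"
  by (auto simp: multi_indices_def directions_def)

lemma finite_multi_indices [simp]: "finite (multi_indices k)"
  by (simp add: multi_indices_UN)

lemma sum_multi_indices: "(\<Sum>j\<le>k. \<Sum>bs\<in>directions j. F bs) = (\<Sum>bs\<in>multi_indices k. F bs)"
  unfolding multi_indices_UN
  by (rule sum.UNION_disjoint[symmetric]) (auto simp: finite_directions dest: directionsD)

lemma directions_subset_multi_indices: "directions k \<subseteq> multi_indices k"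
  by (auto simp: multi_indices_def directions_def)

lemma rev_multi_indices [simp]: "rev bs \<in> multi_indices k \<longleftrightarrow> bs \<in> multi_indices k"
  by (auto simp: multi_indices_def)

lemma Nil_multi_indices [simp]: "[] \<in> multi_indices k"
  by (simp add: multi_indices_def)

text \<open>A Borel representative of the weak derivative, extended by zero to the whole space. Being Borel and
  globally defined, it can be translated, and Fubini's theorem applies to its increments with respect
  to Lebesgue--Borel measure.\<close>

definition wderiv :: "'a::euclidean_space set \<Rightarrow> 'a list \<Rightarrow> ('a \<Rightarrow> real) \<Rightarrow> 'a \<Rightarrow> real" where
  "wderiv \<Omega> bs u = (SOME g. g \<in> borel_measurable borel \<and> (\<forall>x. x \<notin> \<Omega> \<longrightarrow> g x = 0) \<and>
     (AE x in lebesgue_on \<Omega>. weak_deriv \<Omega> bs u x = g x))"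

lemma sobolev_iff: "u \<in> sobolev \<Omega> k \<longleftrightarrow>
    u \<in> L2 \<Omega> \<and> (\<forall>bs\<in>multi_indices k. \<exists>v\<in>L2 \<Omega>. has_weak_deriv \<Omega> bs u v)"
  by (auto simp: sobolev_def multi_indices_UN)

lemma multi_indicesD: "bs \<in> multi_indices k \<Longrightarrow> set bs \<subseteq> Basis"
  by (simp add: multi_indices_def)

context
  fixes \<Omega> :: "'a::euclidean_space set"
  assumes \<Omega>: "open \<Omega>"
begin

lemma \<Omega>_sets: "\<Omega> \<in> sets lebesgue" "\<Omega> \<in> sets borel"
  using \<Omega> by auto

lemma weak_deriv_in_L2:
  assumes u: "u \<in> sobolev \<Omega> k" and bs: "bs \<in> multi_indices k"
  shows "has_weak_deriv \<Omega> bs u (weak_deriv \<Omega> bs u)" "weak_deriv \<Omega> bs u \<in> L2 \<Omega>"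
proof -
  obtain v where v: "v \<in> L2 \<Omega>" "has_weak_deriv \<Omega> bs u v" using u bs by (auto simp: sobolev_iff)
  show *: "has_weak_deriv \<Omega> bs u (weak_deriv \<Omega> bs u)"
    unfolding weak_deriv_def using v(2) by (rule someI[of "has_weak_deriv \<Omega> bs u"])
  have ae: "AE x in lebesgue_on \<Omega>. v x = weak_deriv \<Omega> bs u x"
    by (rule has_weak_deriv_unique[OF v(2) * multi_indicesD[OF bs] \<Omega>])
  have meas: "weak_deriv \<Omega> bs u \<in> borel_measurable (lebesgue_on \<Omega>)"
    using v(1) by (intro measurable_AE_lebesgue_on[OF _ \<Omega>_sets(1) ae]) (simp add: L2_def)
  show "weak_deriv \<Omega> bs u \<in> L2 \<Omega>"
    unfolding L2_iff
    by (rule square_integrable_dominated(1)[OF v(1)[unfolded L2_iff] meas]) (use ae in auto)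
qed

lemma wderiv:
  assumes u: "u \<in> sobolev \<Omega> k" and bs: "bs \<in> multi_indices k"
  shows "wderiv \<Omega> bs u \<in> borel_measurable borel" "\<And>x. x \<notin> \<Omega> \<Longrightarrow> wderiv \<Omega> bs u x = 0"
    "AE x in lebesgue_on \<Omega>. weak_deriv \<Omega> bs u x = wderiv \<Omega> bs u x"
    "square_integrable lborel (wderiv \<Omega> bs u)"
    "L2_norm \<Omega> (weak_deriv \<Omega> bs u) = l2norm lborel (wderiv \<Omega> bs u)"
proof -
  have L2: "square_integrable (lebesgue_on \<Omega>) (weak_deriv \<Omega> bs u)" 
    using weak_deriv_in_L2(2)[OF u bs] by (simp add: L2_iff)
  have "\<exists>g. g \<in> borel_measurable borel \<and> (\<forall>x. x \<notin> \<Omega> \<longrightarrow> g x = 0) \<and> (AE x in lebesgue_on \<Omega>. weak_deriv \<Omega> bs u x = g x)"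
    using borel_zero_extension[OF \<Omega>_sets(2) square_integrableD(1)[OF L2]] by metis
  from someI_ex[OF this] have w: "wderiv \<Omega> bs u \<in> borel_measurable borel" "\<forall>x. x \<notin> \<Omega> \<longrightarrow> wderiv \<Omega> bs u x = 0"
    "AE x in lebesgue_on \<Omega>. weak_deriv \<Omega> bs u x = wderiv \<Omega> bs u x"
    unfolding wderiv_def[symmetric] by auto
  then show "wderiv \<Omega> bs u \<in> borel_measurable borel" "\<And>x. x \<notin> \<Omega> \<Longrightarrow> wderiv \<Omega> bs u x = 0"
    "AE x in lebesgue_on \<Omega>. weak_deriv \<Omega> bs u x = wderiv \<Omega> bs u x" by auto
  have "square_integrable (lebesgue_on \<Omega>) (wderiv \<Omega> bs u)"
    using w(3) by (intro square_integrable_dominated(1)[OF L2 measurable_lebesgue_on_borel[OF w(1)]]) auto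
  then show "square_integrable lborel (wderiv \<Omega> bs u)"
    using square_integrable_lebesgue_on_borel[OF \<Omega>_sets(1) w(1)] w(2) by simp
  have "l2norm (lebesgue_on \<Omega>) (weak_deriv \<Omega> bs u) = l2norm (lebesgue_on \<Omega>) (wderiv \<Omega> bs u)"
    by (rule l2norm_cong_AE[OF square_integrableD(1)[OF L2] measurable_lebesgue_on_borel[OF w(1)] w(3)])
  then show "L2_norm \<Omega> (weak_deriv \<Omega> bs u) = l2norm lborel (wderiv \<Omega> bs u)"
    using l2norm_lebesgue_on_borel[OF \<Omega>_sets(1) w(1)] w(2) by (simp add: L2_norm_eq)
qed

text \<open>Weak derivatives are unique, so any weak derivative determines the representative up to a null set.\<close>

lemma wderiv_eqI:
  assumes u: "u \<in> sobolev \<Omega> k" and bs: "bs \<in> multi_indices k"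
    and g: "\<And>x. x \<notin> \<Omega> \<Longrightarrow> g x = 0" and h: "has_weak_deriv \<Omega> bs u h" and hg: "AE x in lebesgue_on \<Omega>. h x = g x"
  shows "AE x in lborel. wderiv \<Omega> bs u x = g x"
proof -
  have "AE x in lebesgue_on \<Omega>. weak_deriv \<Omega> bs u x = h x"
    by (rule has_weak_deriv_unique[OF weak_deriv_in_L2(1)[OF u bs] h multi_indicesD[OF bs] \<Omega>])
  then have "AE x in lebesgue_on \<Omega>. wderiv \<Omega> bs u x = g x"
    using wderiv(3)[OF u bs] hg by eventually_elim simp
  then have "AE x in lborel. x \<in> \<Omega> \<longrightarrow> wderiv \<Omega> bs u x = g x"
    by (simp add: AE_lebesgue_on_iff \<Omega>_sets)
  then show ?thesis by eventually_elim (use g wderiv(2)[OF u bs] in metis)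
qed

lemma sobolev_diff:
  assumes u: "u \<in> sobolev \<Omega> k" and v: "v \<in> sobolev \<Omega> k"
  shows "(\<lambda>x. u x - v x) \<in> sobolev \<Omega> k"
proof -
  have "has_weak_deriv \<Omega> bs (\<lambda>x. u x - v x) (\<lambda>x. weak_deriv \<Omega> bs u x - weak_deriv \<Omega> bs v x)"
    "(\<lambda>x. weak_deriv \<Omega> bs u x - weak_deriv \<Omega> bs v x) \<in> L2 \<Omega>"
    if bs: "bs \<in> multi_indices k" for bs
    using weak_deriv_in_L2[OF u bs] weak_deriv_in_L2[OF v bs] has_weak_deriv_diff[OF _ _ multi_indicesD[OF bs] \<Omega>]
      square_integrable_diff
    by (auto simp: L2_iff)
  moreover have "(\<lambda>x. u x - v x) \<in> L2 \<Omega>"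
    using u v square_integrable_diff by (auto simp: sobolev_iff L2_iff)
  ultimately show ?thesis unfolding sobolev_iff by blast
qed

lemma wderiv_diff:
  assumes u: "u \<in> sobolev \<Omega> k" and v: "v \<in> sobolev \<Omega> k" and bs: "bs \<in> multi_indices k"
  shows "AE x in lborel. wderiv \<Omega> bs (\<lambda>x. u x - v x) x = wderiv \<Omega> bs u x - wderiv \<Omega> bs v x"
proof (rule wderiv_eqI[OF sobolev_diff[OF u v] bs])
  show "has_weak_deriv \<Omega> bs (\<lambda>x. u x - v x) (\<lambda>x. weak_deriv \<Omega> bs u x - weak_deriv \<Omega> bs v x)"
    by (rule has_weak_deriv_diff[OF weak_deriv_in_L2(1)[OF u bs] weak_deriv_in_L2(1)[OF v bs] multi_indicesD[OF bs] \<Omega>])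
  show "AE x in lebesgue_on \<Omega>. weak_deriv \<Omega> bs u x - weak_deriv \<Omega> bs v x = wderiv \<Omega> bs u x - wderiv \<Omega> bs v x"
    using wderiv(3)[OF u bs] wderiv(3)[OF v bs] by eventually_elim simp
qed (simp add: wderiv(2)[OF u bs] wderiv(2)[OF v bs])

lemma test_function_L2: "test_function \<Omega> \<psi> \<Longrightarrow> \<psi> \<in> L2 \<Omega>"
  unfolding L2_iff
  using square_integrable_lebesgue_on_borel[OF \<Omega>_sets(1), of \<psi>] test_measurable test_square_integrable
    test_function_test test_function_outside by metis

lemma test_function_sobolev:
  assumes \<psi>: "test_function \<Omega> \<psi>" shows "\<psi> \<in> sobolev \<Omega> k"
  unfolding sobolev_iff
proof (intro conjI ballI)
  fix bs :: "'a list" assume "bs \<in> multi_indices k"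
  then have bs: "set bs \<subseteq> Basis" by (rule multi_indicesD)
  then show "\<exists>v\<in>L2 \<Omega>. has_weak_deriv \<Omega> bs \<psi> v"
    using has_weak_deriv_smooth[OF testD(1)[OF test_function_test[OF \<psi>]] bs \<Omega>]
      test_function_L2[OF test_function_partial_deriv[OF \<psi>, of "rev bs"]] by auto
qed (rule test_function_L2[OF \<psi>])

lemma wderiv_test:
  assumes \<psi>: "test_function \<Omega> \<psi>" and bs: "bs \<in> multi_indices k"
  shows "AE x in lborel. wderiv \<Omega> bs \<psi> x = partial_deriv (rev bs) \<psi> x"
  using multi_indicesD[OF bs]
  by (intro wderiv_eqI[OF test_function_sobolev[OF \<psi>] bs _
        has_weak_deriv_smooth[OF testD(1)[OF test_function_test[OF \<psi>]] _ \<Omega>]]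
      test_function_outside[OF test_function_partial_deriv[OF \<psi>]]) auto

lemma wderiv_Nil:
  assumes u: "u \<in> sobolev \<Omega> k"
  shows "AE x in lebesgue_on \<Omega>. wderiv \<Omega> [] u x = u x"
proof -
  have "has_weak_deriv \<Omega> [] u (weak_deriv \<Omega> [] u)" by (rule weak_deriv_in_L2[OF u]) simp
  then have "has_weak_deriv \<Omega> [] u u" by (simp add: has_weak_deriv_def)
  from has_weak_deriv_unique[OF weak_deriv_in_L2(1)[OF u, of "[]"] this _ \<Omega>]
  have "AE x in lebesgue_on \<Omega>. weak_deriv \<Omega> [] u x = u x" by simp
  moreover have "AE x in lebesgue_on \<Omega>. weak_deriv \<Omega> [] u x = wderiv \<Omega> [] u x"
    by (rule wderiv(3)[OF u]) simp
  ultimately show ?thesis by eventually_elim simp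
qed

section \<open>Sobolev norms\<close>

lemma sobolev_norm_eq:
  assumes "u \<in> sobolev \<Omega> k"
  shows "sobolev_norm \<Omega> k u = L2_set (\<lambda>bs. l2norm lborel (wderiv \<Omega> bs u)) (multi_indices k)"
  unfolding sobolev_norm_def sum_multi_indices L2_set_def
  using wderiv(5)[OF assms] by simp

lemma bilin_eq:
  assumes u: "u \<in> sobolev \<Omega> k" and v: "v \<in> sobolev \<Omega> k"
  shows "bilin \<Omega> k u v = (\<Sum>bs\<in>directions k. \<integral>x. wderiv \<Omega> bs u x * wderiv \<Omega> bs v x \<partial>lborel)"
  unfolding bilin_def L2_inner_def
proof (intro sum.cong refl)
  fix bs :: "'a list" assume "bs \<in> directions k"
  then have bs: "bs \<in> multi_indices k" using directions_subset_multi_indices by auto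
  have "(\<integral>x. weak_deriv \<Omega> bs u x * weak_deriv \<Omega> bs v x \<partial>lebesgue_on \<Omega>)
      = (\<integral>x. wderiv \<Omega> bs u x * wderiv \<Omega> bs v x \<partial>lebesgue_on \<Omega>)"
  proof (rule integral_cong_AE)
    show "AE x in lebesgue_on \<Omega>. weak_deriv \<Omega> bs u x * weak_deriv \<Omega> bs v x = wderiv \<Omega> bs u x * wderiv \<Omega> bs v x"
      using wderiv(3)[OF u bs] wderiv(3)[OF v bs] by eventually_elim simp
    show "(\<lambda>x. weak_deriv \<Omega> bs u x * weak_deriv \<Omega> bs v x) \<in> borel_measurable (lebesgue_on \<Omega>)"
      using weak_deriv_in_L2(2)[OF u bs] weak_deriv_in_L2(2)[OF v bs] by (auto simp: L2_def)
    show "(\<lambda>x. wderiv \<Omega> bs u x * wderiv \<Omega> bs v x) \<in> borel_measurable (lebesgue_on \<Omega>)"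
      by (intro borel_measurable_times measurable_lebesgue_on_borel wderiv(1)[OF u bs] wderiv(1)[OF v bs])
  qed
  also have "\<dots> = (\<integral>x. wderiv \<Omega> bs u x * wderiv \<Omega> bs v x \<partial>lborel)"
    using wderiv(2)[OF u bs] by (intro integral_lebesgue_on_borel \<Omega>_sets borel_measurable_times wderiv(1)[OF u bs] wderiv(1)[OF v bs]) auto
  finally show "(\<integral>x. weak_deriv \<Omega> bs u x * weak_deriv \<Omega> bs v x \<partial>lebesgue_on \<Omega>)
      = (\<integral>x. wderiv \<Omega> bs u x * wderiv \<Omega> bs v x \<partial>lborel)" .
qed

lemma V_norm_eq:
  assumes "u \<in> sobolev \<Omega> k"
  shows "V_norm \<Omega> k u = L2_set (\<lambda>bs. l2norm lborel (wderiv \<Omega> bs u)) (directions k)"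
  unfolding V_norm_def bilin_eq[OF assms assms] L2_set_def l2norm_sq by (simp add: power2_eq_square)

lemma l2norm_wderiv_diff:
  assumes u: "u \<in> sobolev \<Omega> k" and v: "v \<in> sobolev \<Omega> k" and bs: "bs \<in> multi_indices k"
  shows "l2norm lborel (wderiv \<Omega> bs (\<lambda>x. u x - v x)) = l2norm lborel (\<lambda>x. wderiv \<Omega> bs u x - wderiv \<Omega> bs v x)"
  using wderiv(1)[OF sobolev_diff[OF u v] bs] wderiv(1)[OF u bs] wderiv(1)[OF v bs]
  by (intro l2norm_cong_AE wderiv_diff[OF u v bs]) auto

lemma l2norm_wderiv_test_diff:
  assumes u: "u \<in> sobolev \<Omega> k" and \<psi>: "test_function \<Omega> \<psi>" and bs: "bs \<in> multi_indices k"
  shows "l2norm lborel (wderiv \<Omega> bs (\<lambda>x. u x - \<psi> x))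
    = l2norm lborel (\<lambda>x. wderiv \<Omega> bs u x - partial_deriv (rev bs) \<psi> x)"
  unfolding l2norm_wderiv_diff[OF u test_function_sobolev[OF \<psi>] bs]
proof (rule l2norm_cong_AE)
  have "partial_deriv (rev bs) \<psi> \<in> borel_measurable borel"
    using \<psi> multi_indicesD[OF bs] by (intro test_measurable test_partial_deriv test_function_test) auto
  then show "(\<lambda>x. wderiv \<Omega> bs u x - partial_deriv (rev bs) \<psi> x) \<in> borel_measurable lborel"
    using wderiv(1)[OF u bs] by simp
  show "(\<lambda>x. wderiv \<Omega> bs u x - wderiv \<Omega> bs \<psi> x) \<in> borel_measurable lborel"
    using wderiv(1)[OF u bs] wderiv(1)[OF test_function_sobolev[OF \<psi>] bs] by simp
  show "AE x in lborel. wderiv \<Omega> bs u x - wderiv \<Omega> bs \<psi> x = wderiv \<Omega> bs u x - partial_deriv (rev bs) \<psi> x"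
    using wderiv_test[OF \<psi> bs] by eventually_elim simp
qed

lemma l2norm_wderiv_le:
  assumes u: "u \<in> sobolev \<Omega> k" 
  shows "bs \<in> multi_indices k \<Longrightarrow> l2norm lborel (wderiv \<Omega> bs u) \<le> sobolev_norm \<Omega> k u"
    and "bs \<in> directions k \<Longrightarrow> l2norm lborel (wderiv \<Omega> bs u) \<le> V_norm \<Omega> k u"
  unfolding sobolev_norm_eq[OF u] V_norm_eq[OF u] by (intro member_le_L2_set; simp)+

lemma wderiv_L2_set_triangle:
  assumes u: "u \<in> sobolev \<Omega> k" and v: "v \<in> sobolev \<Omega> k" and w: "w \<in> sobolev \<Omega> k" and I: "I \<subseteq> multi_indices k"
  shows "L2_set (\<lambda>bs. l2norm lborel (wderiv \<Omega> bs (\<lambda>x. u x - w x))) I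
    \<le> L2_set (\<lambda>bs. l2norm lborel (wderiv \<Omega> bs (\<lambda>x. u x - v x))) I + L2_set (\<lambda>bs. l2norm lborel (wderiv \<Omega> bs (\<lambda>x. v x - w x))) I"
proof -
  have "L2_set (\<lambda>bs. l2norm lborel (wderiv \<Omega> bs (\<lambda>x. u x - w x))) I
    \<le> L2_set (\<lambda>bs. l2norm lborel (wderiv \<Omega> bs (\<lambda>x. u x - v x)) + l2norm lborel (wderiv \<Omega> bs (\<lambda>x. v x - w x))) I"
  proof (rule L2_set_mono)
    fix bs assume "bs \<in> I"
    then have bs: "bs \<in> multi_indices k" using I by auto
    show "l2norm lborel (wderiv \<Omega> bs (\<lambda>x. u x - w x))
      \<le> l2norm lborel (wderiv \<Omega> bs (\<lambda>x. u x - v x)) + l2norm lborel (wderiv \<Omega> bs (\<lambda>x. v x - w x))"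
      unfolding l2norm_wderiv_diff[OF u w bs] l2norm_wderiv_diff[OF u v bs] l2norm_wderiv_diff[OF v w bs]
      by (intro l2norm_sub_triangle wderiv(4)[OF _ bs] u v w)
  qed simp
  also have "\<dots> \<le> L2_set (\<lambda>bs. l2norm lborel (wderiv \<Omega> bs (\<lambda>x. u x - v x))) I + L2_set (\<lambda>bs. l2norm lborel (wderiv \<Omega> bs (\<lambda>x. v x - w x))) I"
    by (rule L2_set_triangle_ineq)
  finally show ?thesis .
qed

lemma V_norm_nonneg [simp]: "0 \<le> V_norm \<Omega> k u"
  unfolding V_norm_def bilin_def L2_inner_def by (intro real_sqrt_ge_zero sum_nonneg integral_nonneg_AE) auto

lemma wderiv_commute:
  assumes u: "u \<in> sobolev \<Omega> k" and v: "v \<in> sobolev \<Omega> k" and bs: "bs \<in> multi_indices k"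
  shows "l2norm lborel (wderiv \<Omega> bs (\<lambda>x. u x - v x)) = l2norm lborel (wderiv \<Omega> bs (\<lambda>x. v x - u x))"
  unfolding l2norm_wderiv_diff[OF u v bs] l2norm_wderiv_diff[OF v u bs] by (rule l2norm_commute)

lemma V_norm_commute:
  assumes u: "u \<in> sobolev \<Omega> k" and v: "v \<in> sobolev \<Omega> k"
  shows "V_norm \<Omega> k (\<lambda>x. u x - v x) = V_norm \<Omega> k (\<lambda>x. v x - u x)"
  unfolding V_norm_eq[OF sobolev_diff[OF u v]] V_norm_eq[OF sobolev_diff[OF v u]] L2_set_def
  using wderiv_commute[OF u v] directions_subset_multi_indices[of k] by (intro arg_cong[of _ _ sqrt] sum.cong refl) auto

lemma V_norm_triangle:
  assumes u: "u \<in> sobolev \<Omega> k" and v: "v \<in> sobolev \<Omega> k" and w: "w \<in> sobolev \<Omega> k"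
  shows "V_norm \<Omega> k (\<lambda>x. u x - w x) \<le> V_norm \<Omega> k (\<lambda>x. u x - v x) + V_norm \<Omega> k (\<lambda>x. v x - w x)"
  using wderiv_L2_set_triangle[OF u v w directions_subset_multi_indices]
  by (simp add: V_norm_eq sobolev_diff u v w)

section \<open>The spaces of functions vanishing at the boundary\<close>

lemma tendsto_L2_set_0:
  assumes "finite I" "\<And>i. i \<in> I \<Longrightarrow> (\<lambda>n. f n i) \<longlonglongrightarrow> (0::real)"
  shows "(\<lambda>n. L2_set (f n) I) \<longlonglongrightarrow> 0"
proof -
  have "(\<lambda>n. sqrt (\<Sum>i\<in>I. (f n i)\<^sup>2)) \<longlonglongrightarrow> sqrt (\<Sum>i\<in>I. 0\<^sup>2)"
    by (intro tendsto_intros assms)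
  then show ?thesis by (simp add: L2_set_def)
qed

lemma sobolev0_sobolev: "u \<in> sobolev0 \<Omega> k \<Longrightarrow> u \<in> sobolev \<Omega> k"
  by (simp add: sobolev0_def)

text \<open>Test functions extend smoothly by zero, so their convergence can be expressed on the whole space,
  where they can also be translated.\<close>

lemma sobolev0_iff:
  assumes u: "u \<in> sobolev \<Omega> k"
  shows "u \<in> sobolev0 \<Omega> k \<longleftrightarrow> (\<exists>\<psi>. (\<forall>n. test_function \<Omega> (\<psi> n)) \<and>
    (\<forall>bs\<in>multi_indices k. (\<lambda>n. l2norm lborel (\<lambda>x. wderiv \<Omega> bs u x - partial_deriv (rev bs) (\<psi> n) x)) \<longlonglongrightarrow> 0))"
proof -
  have "(\<lambda>n. sobolev_norm \<Omega> k (\<lambda>x. u x - \<psi> n x)) \<longlonglongrightarrow> 0 \<longleftrightarrow>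
    (\<forall>bs\<in>multi_indices k. (\<lambda>n. l2norm lborel (\<lambda>x. wderiv \<Omega> bs u x - partial_deriv (rev bs) (\<psi> n) x)) \<longlonglongrightarrow> 0)"
    if \<psi>: "\<And>n. test_function \<Omega> (\<psi> n)" for \<psi>
  proof -
    have d: "(\<lambda>x. u x - \<psi> n x) \<in> sobolev \<Omega> k" for n by (rule sobolev_diff[OF u test_function_sobolev[OF \<psi>]])
    show ?thesis
    proof (intro iffI ballI)
      fix bs :: "'a list" assume bs: "bs \<in> multi_indices k" and l: "(\<lambda>n. sobolev_norm \<Omega> k (\<lambda>x. u x - \<psi> n x)) \<longlonglongrightarrow> 0"
      show "(\<lambda>n. l2norm lborel (\<lambda>x. wderiv \<Omega> bs u x - partial_deriv (rev bs) (\<psi> n) x)) \<longlonglongrightarrow> 0"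
        unfolding l2norm_wderiv_test_diff[OF u \<psi> bs, symmetric]
        by (rule tendsto_sandwich[OF _ _ tendsto_const l]) (use l2norm_wderiv_le(1)[OF d bs] in auto)
    next
      assume l: "\<forall>bs\<in>multi_indices k. (\<lambda>n. l2norm lborel (\<lambda>x. wderiv \<Omega> bs u x - partial_deriv (rev bs) (\<psi> n) x)) \<longlonglongrightarrow> 0"
      show "(\<lambda>n. sobolev_norm \<Omega> k (\<lambda>x. u x - \<psi> n x)) \<longlonglongrightarrow> 0"
        unfolding sobolev_norm_eq[OF d]
        by (rule tendsto_L2_set_0) (use l l2norm_wderiv_test_diff[OF u \<psi>] in auto)
    qed
  qed
  then show ?thesis using u by (auto simp: sobolev0_def)
qed

lemma sobolev0_approx:
  assumes u: "u \<in> sobolev0 \<Omega> k"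
  obtains \<psi> where "\<And>n. test_function \<Omega> (\<psi> n)"
    "\<And>bs. bs \<in> multi_indices k \<Longrightarrow> (\<lambda>n. l2norm lborel (\<lambda>x. wderiv \<Omega> bs u x - partial_deriv (rev bs) (\<psi> n) x)) \<longlonglongrightarrow> 0"
  using u sobolev0_iff[OF sobolev0_sobolev[OF u]] by auto

lemma test_function_sobolev0:
  assumes \<psi>: "test_function \<Omega> \<psi>" shows "\<psi> \<in> sobolev0 \<Omega> k"
proof -
  have "l2norm lborel (\<lambda>x. wderiv \<Omega> bs \<psi> x - partial_deriv (rev bs) \<psi> x) = 0" if bs: "bs \<in> multi_indices k" for bs
  proof -
    have "AE x in lborel. (wderiv \<Omega> bs \<psi> x - partial_deriv (rev bs) \<psi> x)\<^sup>2 = 0"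
      using wderiv_test[OF \<psi> bs] by eventually_elim simp
    then show ?thesis unfolding l2norm_def by (simp add: integral_eq_zero_AE)
  qed
  then show ?thesis
    unfolding sobolev0_iff[OF test_function_sobolev[OF \<psi>]] using \<psi> by (intro exI[of _ "\<lambda>_. \<psi>"]) auto
qed

lemma sobolev0_diff:
  assumes u: "u \<in> sobolev0 \<Omega> k" and v: "v \<in> sobolev0 \<Omega> k"
  shows "(\<lambda>x. u x - v x) \<in> sobolev0 \<Omega> k"
proof -
  note us = sobolev0_sobolev[OF u] and vs = sobolev0_sobolev[OF v]
  obtain p where p: "\<And>n. test_function \<Omega> (p n)"
    "\<And>bs. bs \<in> multi_indices k \<Longrightarrow> (\<lambda>n. l2norm lborel (\<lambda>x. wderiv \<Omega> bs u x - partial_deriv (rev bs) (p n) x)) \<longlonglongrightarrow> 0"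
    using sobolev0_approx[OF u] by blast
  obtain q where q: "\<And>n. test_function \<Omega> (q n)"
    "\<And>bs. bs \<in> multi_indices k \<Longrightarrow> (\<lambda>n. l2norm lborel (\<lambda>x. wderiv \<Omega> bs v x - partial_deriv (rev bs) (q n) x)) \<longlonglongrightarrow> 0"
    using sobolev0_approx[OF v] by blast
  show ?thesis
    unfolding sobolev0_iff[OF sobolev_diff[OF us vs]]
  proof (intro exI[of _ "\<lambda>n x. p n x - q n x"] conjI allI ballI)
    show "test_function \<Omega> (\<lambda>x. p n x - q n x)" for n by (intro test_function_diff p q)
    fix bs :: "'a list" assume bs: "bs \<in> multi_indices k"
    have rbs: "set (rev bs) \<subseteq> Basis" using multi_indicesD[OF bs] by simp
    have sqp: "square_integrable lborel (partial_deriv (rev bs) (p n))" "square_integrable lborel (partial_deriv (rev bs) (q n))" for n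
      by (intro test_square_integrable test_partial_deriv test_function_test[OF p(1)] test_function_test[OF q(1)] rbs)+
    have le: "l2norm lborel (\<lambda>x. wderiv \<Omega> bs (\<lambda>x. u x - v x) x - partial_deriv (rev bs) (\<lambda>x. p n x - q n x) x)
      \<le> l2norm lborel (\<lambda>x. wderiv \<Omega> bs u x - partial_deriv (rev bs) (p n) x)
        + l2norm lborel (\<lambda>x. wderiv \<Omega> bs v x - partial_deriv (rev bs) (q n) x)" for n
    proof -
      have pd: "partial_deriv (rev bs) (\<lambda>x. p n x - q n x) = (\<lambda>x. partial_deriv (rev bs) (p n) x - partial_deriv (rev bs) (q n) x)"
        using p(1) q(1) rbs by (intro partial_deriv_diff testD test_function_test)
      have "l2norm lborel (\<lambda>x. wderiv \<Omega> bs (\<lambda>x. u x - v x) x - partial_deriv (rev bs) (\<lambda>x. p n x - q n x) x)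
        = l2norm lborel (\<lambda>x. (wderiv \<Omega> bs u x - partial_deriv (rev bs) (p n) x) - (wderiv \<Omega> bs v x - partial_deriv (rev bs) (q n) x))"
        unfolding pd
      proof (rule l2norm_cong_AE)
        show "AE x in lborel. wderiv \<Omega> bs (\<lambda>x. u x - v x) x - (partial_deriv (rev bs) (p n) x - partial_deriv (rev bs) (q n) x) =
               wderiv \<Omega> bs u x - partial_deriv (rev bs) (p n) x - (wderiv \<Omega> bs v x - partial_deriv (rev bs) (q n) x)"
          using wderiv_diff[OF us vs bs] by eventually_elim simp
      qed (use wderiv(4)[OF us bs] wderiv(4)[OF vs bs] wderiv(4)[OF sobolev_diff[OF us vs] bs] sqp[of n] in
          \<open>auto intro!: borel_measurable_diff dest: square_integrableD(1)\<close>)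
      also have "\<dots> \<le> l2norm lborel (\<lambda>x. wderiv \<Omega> bs u x - partial_deriv (rev bs) (p n) x)
        + l2norm lborel (\<lambda>x. wderiv \<Omega> bs v x - partial_deriv (rev bs) (q n) x)"
        by (intro l2norm_diff_le square_integrable_diff wderiv(4)[OF _ bs] us vs sqp)
      finally show ?thesis .
    qed
    show "(\<lambda>n. l2norm lborel (\<lambda>x. wderiv \<Omega> bs (\<lambda>x. u x - v x) x - partial_deriv (rev bs) (\<lambda>x. p n x - q n x) x)) \<longlonglongrightarrow> 0"
      by (rule tendsto_sandwich[OF _ _ tendsto_const tendsto_add_zero[OF p(2)[OF bs] q(2)[OF bs]]]) (use le in auto)
  qed
qed

lemma zero_sobolev0: "(\<lambda>x. 0) \<in> sobolev0 \<Omega> k"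
  by (rule test_function_sobolev0) (simp add: test_function_iff test_def)

text \<open>Poincare's inequality raises the order of differentiation by one at the cost of a constant factor
  \<open>P \<ge> 1\<close>; applying it \<open>m - |bs|\<close> times leads to the derivatives of order \<open>m\<close>.\<close>

lemma Poincare_multi_indices:
  assumes bdd: "bounded \<Omega>"
  shows "\<exists>C>0. \<forall>\<psi>. test_function \<Omega> \<psi> \<longrightarrow> (\<forall>bs\<in>multi_indices m.
     l2norm lborel (partial_deriv bs \<psi>) \<le> C * L2_set (\<lambda>bs. l2norm lborel (partial_deriv bs \<psi>)) (directions m))"
proof -
  obtain R where R: "R \<ge> 1" "\<And>x. x \<in> \<Omega> \<Longrightarrow> norm x \<le> R"
    using bdd unfolding bounded_iff by (metis max.cobounded1 max.coboundedI2)
  \<comment> \<open>As \<open>R \<ge> 1\<close>, powers of \<open>P\<close> increase, so \<open>P ^ m\<close> serves for all orders.\<close>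
  define P where "P = 4 * R"
  define N where "N = real (card (directions m :: 'a list set))"
  have P: "P \<ge> 1" using R by (simp add: P_def)
  have "l2norm lborel (partial_deriv bs \<psi>) \<le> (P ^ m * (N + 1)) * L2_set (\<lambda>bs. l2norm lborel (partial_deriv bs \<psi>)) (directions m)"
    if \<psi>: "test_function \<Omega> \<psi>" and bs: "bs \<in> multi_indices m" for \<psi> bs
  proof -
    define a where "a = (\<lambda>j. \<Sum>cs\<in>directions j. l2norm lborel (partial_deriv cs \<psi>))"
    define V where "V = L2_set (\<lambda>bs. l2norm lborel (partial_deriv bs \<psi>)) (directions m)"
    have a0: "0 \<le> a j" for j by (simp add: a_def sum_nonneg)
    have step: "a j \<le> P * a (Suc j)" for j
    proof -
      have "l2norm lborel (partial_deriv cs \<psi>) \<le> P * (\<Sum>b\<in>Basis. l2norm lborel (partial_deriv (b # cs) \<psi>))" if "cs \<in> directions j" for cs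
      proof -
        have t: "test_function \<Omega> (partial_deriv cs \<psi>)" by (rule test_function_partial_deriv[OF \<psi> directionsD(1)[OF that]])
        have "l2norm lborel (partial_deriv cs \<psi>) \<le> 4 * R * (\<Sum>b\<in>Basis. l2norm lborel (pd b (partial_deriv cs \<psi>)))"
        proof (rule Poincare_test[OF test_function_test[OF t]])
          show "norm x \<le> R" if "partial_deriv cs \<psi> x \<noteq> 0" for x
            using that test_function_outside[OF t] R(2) by blast
        qed (use R(1) in simp)
        then show ?thesis by (simp add: P_def partial_deriv_append[symmetric])
      qed
      then show ?thesis unfolding a_def sum_directions_Suc sum_distrib_left[of P] by (rule sum_mono)
    qed
    have "a j \<le> P ^ i * a (j + i)" for i j
    proof (induction i)
      case (Suc i)
      have "P ^ i * a (j + i) \<le> P ^ i * (P * a (Suc (j + i)))"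
        using P by (intro mult_left_mono step) auto
      with Suc show ?case by (simp add: mult.assoc mult.left_commute)
    qed simp
    then have "a (length bs) \<le> P ^ (m - length bs) * a m"
      using bs by (metis (no_types, lifting) le_add_diff_inverse mem_Collect_eq multi_indices_def)
    also have "\<dots> \<le> P ^ m * a m"
      using P by (intro mult_right_mono power_increasing a0) auto
    also have "a m \<le> N * V"
    proof -
      have "a m \<le> (\<Sum>cs\<in>(directions m :: 'a list set). V)"
        unfolding a_def V_def by (intro sum_mono member_le_L2_set) auto
      then show ?thesis by (simp add: N_def)
    qed
    finally have "a (length bs) \<le> P ^ m * (N * V)" using P by simp
    moreover have "l2norm lborel (partial_deriv bs \<psi>) \<le> a (length bs)"
      unfolding a_def using multi_indicesD[OF bs] by (intro member_le_sum) (auto intro: directionsI)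
    moreover have "P ^ m * (N * V) \<le> P ^ m * ((N + 1) * V)"
      using P by (intro mult_left_mono mult_right_mono) (auto simp: V_def)
    ultimately show ?thesis unfolding V_def[symmetric] by (simp add: mult.assoc)
  qed
  moreover have "P ^ m * (N + 1) > 0" using P by (intro mult_pos_pos zero_less_power) (auto simp: N_def add_nonneg_pos)
  ultimately show ?thesis by blast
qed

lemma tendsto_wderiv_norm:
  assumes u: "u \<in> sobolev \<Omega> k" and \<psi>: "\<And>n. test_function \<Omega> (\<psi> n)" and bs: "bs \<in> multi_indices k"
    and lim: "(\<lambda>n. l2norm lborel (\<lambda>x. wderiv \<Omega> bs u x - partial_deriv (rev bs) (\<psi> n) x)) \<longlonglongrightarrow> 0"
  shows "(\<lambda>n. l2norm lborel (partial_deriv (rev bs) (\<psi> n))) \<longlonglongrightarrow> l2norm lborel (wderiv \<Omega> bs u)"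
  using multi_indicesD[OF bs]
  by (intro tendsto_l2norm wderiv(4)[OF u bs] lim test_square_integrable test_partial_deriv test_function_test[OF \<psi>]) auto

lemma L2_set_rev_directions: "L2_set (\<lambda>bs. F (rev bs)) (directions m) = L2_set F (directions m)"
  unfolding L2_set_def using sum_rev_directions[of "\<lambda>bs. (F bs)\<^sup>2"] by simp

lemma tendsto_V_norm:
  assumes u: "u \<in> sobolev \<Omega> k" and \<psi>: "\<And>n. test_function \<Omega> (\<psi> n)"
    and lim: "\<And>bs. bs \<in> multi_indices k \<Longrightarrow> (\<lambda>n. l2norm lborel (\<lambda>x. wderiv \<Omega> bs u x - partial_deriv (rev bs) (\<psi> n) x)) \<longlonglongrightarrow> 0"
  shows "(\<lambda>n. L2_set (\<lambda>bs. l2norm lborel (partial_deriv bs (\<psi> n))) (directions k)) \<longlonglongrightarrow> V_norm \<Omega> k u"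
  unfolding V_norm_eq[OF u] L2_set_rev_directions[of "\<lambda>bs. l2norm lborel (partial_deriv bs (\<psi> _))", symmetric]
  unfolding L2_set_def
  using directions_subset_multi_indices[of k]
  by (intro tendsto_intros tendsto_wderiv_norm[OF u \<psi>] lim) auto

text \<open>Passage to the limit along approximating test functions. Thus \<open>\<parallel>v\<parallel>\<^sub>V\<close> controls the full Sobolev norm.\<close>

lemma Poincare:
  assumes bdd: "bounded \<Omega>"
  shows "\<exists>C>0. \<forall>u\<in>sobolev0 \<Omega> m. \<forall>bs\<in>multi_indices m. l2norm lborel (wderiv \<Omega> bs u) \<le> C * V_norm \<Omega> m u"
proof -
  obtain C where C: "C > 0" "\<And>\<psi> bs. test_function \<Omega> \<psi> \<Longrightarrow> bs \<in> multi_indices m \<Longrightarrow>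
     l2norm lborel (partial_deriv bs \<psi>) \<le> C * L2_set (\<lambda>bs. l2norm lborel (partial_deriv bs \<psi>)) (directions m)"
    using Poincare_multi_indices[OF bdd, of m] by blast
  have "l2norm lborel (wderiv \<Omega> bs u) \<le> C * V_norm \<Omega> m u" if u: "u \<in> sobolev0 \<Omega> m" and bs: "bs \<in> multi_indices m" for u bs
  proof -
    obtain p where p: "\<And>n. test_function \<Omega> (p n)"
      "\<And>bs. bs \<in> multi_indices m \<Longrightarrow> (\<lambda>n. l2norm lborel (\<lambda>x. wderiv \<Omega> bs u x - partial_deriv (rev bs) (p n) x)) \<longlonglongrightarrow> 0"
      using sobolev0_approx[OF u] by blast
    note us = sobolev0_sobolev[OF u]
    show ?thesis
    proof (rule tendsto_le[OF sequentially_bot])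
      show "(\<lambda>n. l2norm lborel (partial_deriv (rev bs) (p n))) \<longlonglongrightarrow> l2norm lborel (wderiv \<Omega> bs u)"
        by (rule tendsto_wderiv_norm[OF us p(1) bs p(2)[OF bs]])
      show "(\<lambda>n. C * L2_set (\<lambda>bs. l2norm lborel (partial_deriv bs (p n))) (directions m)) \<longlonglongrightarrow> C * V_norm \<Omega> m u"
        by (intro tendsto_intros tendsto_V_norm us p)
      show "\<forall>\<^sub>F n in sequentially. l2norm lborel (partial_deriv (rev bs) (p n))
          \<le> C * L2_set (\<lambda>bs. l2norm lborel (partial_deriv bs (p n))) (directions m)"
        using bs by (intro always_eventually allI C p(1)) auto
    qed
  qed
  then show ?thesis using C(1) by blast
qed

end

section \<open>Localised translations of test functions\<close>

lemma smooth_Lipschitz: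
  fixes \<phi> :: "'a::euclidean_space \<Rightarrow> real"
  assumes \<phi>: "test \<phi>"
  obtains L where "L \<ge> 0" "\<And>x h. \<bar>\<phi> (x + h) - \<phi> x\<bar> \<le> L * norm h"
proof -
  have "\<exists>B. \<forall>x. \<bar>pd b \<phi> x\<bar> \<le> B" if "b \<in> Basis" for b
    using test_bounded[OF test_pd[OF \<phi> that]] by metis
  then obtain B where B: "\<And>b x. b \<in> Basis \<Longrightarrow> \<bar>pd b \<phi> x\<bar> \<le> B b" by metis
  have "\<bar>frechet_derivative \<phi> (at y) h\<bar> \<le> (\<Sum>b\<in>Basis. B b) * norm h" for y h
  proof -
    have "\<bar>frechet_derivative \<phi> (at y) h\<bar> \<le> (\<Sum>b\<in>Basis. \<bar>(h \<bullet> b) * pd b \<phi> y\<bar>)"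
      unfolding frechet_derivative_basis[OF testD(1)[OF \<phi>]] by (rule sum_abs)
    also have "\<dots> \<le> (\<Sum>b\<in>Basis. norm h * B b)"
      unfolding abs_mult by (intro sum_mono mult_mono Basis_le_norm B) auto
    finally show ?thesis by (simp add: sum_distrib_left mult.commute)
  qed
  from increment_le[OF testD(1)[OF \<phi>] this, of _ 1]
  have "\<bar>\<phi> (x + h) - \<phi> x\<bar> \<le> (\<Sum>b\<in>Basis. B b) * norm h" for x h by simp
  moreover have "0 \<le> (\<Sum>b\<in>Basis. B b)" by (intro sum_nonneg order_trans[OF abs_ge_zero B])
  ultimately show ?thesis using that by blast
qed

lemma l2norm_lower_order_increment_le:
  fixes \<psi> :: "'a::euclidean_space \<Rightarrow> real"
  assumes \<psi>: "test \<psi>"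
  shows "square_integrable lborel (lower_order m (\<lambda>x. \<psi> (x + h) - \<psi> x))"
    and "l2norm lborel (lower_order m (\<lambda>x. \<psi> (x + h) - \<psi> x))
      \<le> norm h * (\<Sum>bs\<in>multi_indices m. l2norm lborel (partial_deriv bs \<psi>))"
proof -
  define v where "v = (\<lambda>x. \<psi> (x + h) - \<psi> x)"
  have v: "test v" unfolding v_def by (intro test_diff test_translate \<psi>)
  have sq: "square_integrable lborel (\<lambda>x. \<bar>partial_deriv cs v x\<bar>)" if "cs \<in> directions j" for cs j
    by (intro square_integrable_abs test_square_integrable test_partial_deriv v directionsD(1)[OF that])
  show "square_integrable lborel (lower_order m (\<lambda>x. \<psi> (x + h) - \<psi> x))"
    unfolding v_def[symmetric] lower_order_def[abs_def]
    by (intro square_integrable_sum sq)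
  have "l2norm lborel (lower_order m v) \<le> (\<Sum>j<m. \<Sum>cs\<in>directions j. l2norm lborel (\<lambda>x. \<bar>partial_deriv cs v x\<bar>))"
    unfolding lower_order_def[abs_def]
    by (intro order_trans[OF l2norm_sum_le] sum_mono l2norm_sum_le square_integrable_sum sq)
  also have "\<dots> \<le> (\<Sum>j<m. \<Sum>cs\<in>directions j. norm h * (\<Sum>b\<in>Basis. l2norm lborel (partial_deriv (b # cs) \<psi>)))"
  proof (intro sum_mono)
    fix j and cs :: "'a list" assume "cs \<in> directions j"
    then have cs: "set cs \<subseteq> Basis" by (rule directionsD)
    have "partial_deriv cs v = (\<lambda>x. partial_deriv cs \<psi> (x + h) - partial_deriv cs \<psi> x)"
      unfolding v_def using partial_deriv_diff[OF smooth_translate[OF testD(1)[OF \<psi>]] testD(1)[OF \<psi>] cs]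
        partial_deriv_translate[OF testD(1)[OF \<psi>] cs] by simp
    then show "l2norm lborel (\<lambda>x. \<bar>partial_deriv cs v x\<bar>) \<le> norm h * (\<Sum>b\<in>Basis. l2norm lborel (partial_deriv (b # cs) \<psi>))"
      using l2norm_increment_le[OF test_partial_deriv[OF \<psi> cs], of h] by (simp add: l2norm_abs partial_deriv_append[symmetric])
  qed
  also have "\<dots> = norm h * (\<Sum>j<m. \<Sum>cs\<in>directions (Suc j). l2norm lborel (partial_deriv cs \<psi>))"
    by (simp add: sum_directions_Suc sum_distrib_left)
  also have "\<dots> \<le> norm h * (\<Sum>j\<le>m. \<Sum>cs\<in>directions j. l2norm lborel (partial_deriv cs \<psi>))"
    unfolding lessThan_Suc_atMost[symmetric] sum.lessThan_Suc_shift by (intro mult_left_mono) (auto intro: sum_nonneg)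
  finally show "l2norm lborel (lower_order m (\<lambda>x. \<psi> (x + h) - \<psi> x))
      \<le> norm h * (\<Sum>bs\<in>multi_indices m. l2norm lborel (partial_deriv bs \<psi>))"
    by (simp add: v_def sum_multi_indices)
qed

text \<open>Expand \<open>(P\<^sub>h - P)\<^sup>2 = (P\<^sub>h\<^sup>2 - P\<^sup>2) - 2 P (P\<^sub>h - P)\<close> and move the translation in the first term from \<open>P\<close> to \<open>\<phi>\<close>. As
  \<open>\<phi>\<close> is Lipschitz, that term is \<open>O(|h|)\<close>, whatever the modulus of continuity of \<open>P\<close>.\<close>

lemma weighted_increment_identity:
  fixes \<phi> P :: "'a::euclidean_space \<Rightarrow> real"
  assumes \<phi>: "test \<phi>" and P: "test P"
  shows "(\<integral>x. \<phi> x * (P (x + h) - P x)\<^sup>2 \<partial>lborel)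
    = (\<integral>x. (\<phi> (x - h) - \<phi> x) * (P x)\<^sup>2 \<partial>lborel) - 2 * (\<integral>x. P x * (\<phi> x * (P (x + h) - P x)) \<partial>lborel)"
proof -
  have Ph: "test (\<lambda>x. P (x + h))" by (rule test_translate[OF P])
  have \<phi>h: "test (\<lambda>x. \<phi> (x - h))" using test_translate[OF \<phi>, of "- h"] by simp
  note T = testD(1)
  have i1: "integrable lborel (\<lambda>x. \<phi> x * (P (x + h))\<^sup>2)" "integrable lborel (\<lambda>x. \<phi> x * (P x)\<^sup>2)"
    "integrable lborel (\<lambda>x. \<phi> (x - h) * (P x)\<^sup>2)" "integrable lborel (\<lambda>x. P x * (\<phi> x * (P (x + h) - P x)))"
    unfolding power2_eq_square
    by (intro test_integrable test_mult2 test_mult1 test_diff T[OF \<phi>] T[OF P] Ph P \<phi>h T[OF \<phi>h] T[OF Ph])+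
  have "(\<integral>x. \<phi> (x - h) * (P x)\<^sup>2 \<partial>lborel) = (\<integral>x. \<phi> x * (P (x + h))\<^sup>2 \<partial>lborel)"
    using integral_translate[of "\<lambda>x. \<phi> (x - h) * (P x)\<^sup>2" h] test_measurable[OF \<phi>h] test_measurable[OF P] by simp
  then have e1: "(\<integral>x. (\<phi> (x - h) - \<phi> x) * (P x)\<^sup>2 \<partial>lborel) = (\<integral>x. \<phi> x * (P (x + h))\<^sup>2 - \<phi> x * (P x)\<^sup>2 \<partial>lborel)"
    using i1 by (simp add: left_diff_distrib)
  have "(\<integral>x. \<phi> x * (P (x + h) - P x)\<^sup>2 \<partial>lborel)
    = (\<integral>x. (\<phi> x * (P (x + h))\<^sup>2 - \<phi> x * (P x)\<^sup>2) - 2 * (P x * (\<phi> x * (P (x + h) - P x))) \<partial>lborel)"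
    by (intro Bochner_Integration.integral_cong refl) (simp add: power2_eq_square algebra_simps)
  also have "\<dots> = (\<integral>x. \<phi> x * (P (x + h))\<^sup>2 - \<phi> x * (P x)\<^sup>2 \<partial>lborel) - 2 * (\<integral>x. P x * (\<phi> x * (P (x + h) - P x)) \<partial>lborel)"
    using i1 by (subst Bochner_Integration.integral_diff) auto
  finally show ?thesis using e1 by simp
qed

text \<open>Here \<open>w = \<phi> (\<psi>\<^sub>h - \<psi>)\<close> is the variation that moves \<open>\<psi>\<close> towards its translate. Up to commutators, which the Leibniz
  rule and the bound on increments make \<open>O(|h|)\<close>, \<open>D\<^sup>m w\<close> equals \<open>\<phi> (D\<^sup>m \<psi>\<^sub>h - D\<^sup>m \<psi>)\<close>, so the identity above turns
  the weighted square of the increment of \<open>D\<^sup>m \<psi>\<close> into \<open>O(|h|)\<close> minus twice the energy form at \<open>(\<psi>, w)\<close>.\<close>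

lemma translation_energy:
  fixes \<phi> :: "'a::euclidean_space \<Rightarrow> real" and m :: nat
  assumes \<phi>: "test \<phi>" and m: "m \<ge> 1"
  shows "\<exists>K\<ge>0. \<forall>\<psi> h. test \<psi> \<longrightarrow> norm h \<le> 1 \<longrightarrow>
    (let w = (\<lambda>x. \<phi> x * (\<psi> (x + h) - \<psi> x)); S = (\<Sum>bs\<in>multi_indices m. l2norm lborel (partial_deriv bs \<psi>)) in
      l2norm lborel w \<le> K * norm h * S \<and>
      (\<forall>bs\<in>directions m. l2norm lborel (partial_deriv bs w) \<le> K * S) \<and>
      (\<Sum>bs\<in>directions m. \<integral>x. \<phi> x * (partial_deriv bs \<psi> (x + h) - partial_deriv bs \<psi> x)\<^sup>2 \<partial>lborel)
        \<le> K * norm h * S\<^sup>2 - 2 * (\<Sum>bs\<in>directions m. \<integral>x. partial_deriv bs \<psi> x * partial_deriv bs w x \<partial>lborel))"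
proof -
  obtain B where B: "B > 0" "\<And>x. \<bar>\<phi> x\<bar> \<le> B" using test_bounded[OF \<phi>] by blast
  obtain L where L: "L \<ge> 0" "\<And>x h. \<bar>\<phi> (x + h) - \<phi> x\<bar> \<le> L * norm h" using smooth_Lipschitz[OF \<phi>] by blast
  have "\<forall>bs\<in>directions m. \<exists>C\<ge>0. \<forall>v. smooth v \<longrightarrow> (\<forall>x. \<bar>partial_deriv bs (\<lambda>x. \<phi> x * v x) x - \<phi> x * partial_deriv bs v x\<bar>
            \<le> C * lower_order m v x)"
  proof
    fix bs :: "'a list" assume bs: "bs \<in> directions m"
    show "\<exists>C\<ge>0. \<forall>v. smooth v \<longrightarrow> (\<forall>x. \<bar>partial_deriv bs (\<lambda>x. \<phi> x * v x) x - \<phi> x * partial_deriv bs v x\<bar>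
            \<le> C * lower_order m v x)"
      using Leibniz_lower_order[OF testD(1)[OF \<phi>] testD(2)[OF \<phi>] directionsD(1)[OF bs]]
      unfolding directionsD(2)[OF bs] .
  qed
  from bchoice[OF this] obtain c where c: "\<And>bs. bs \<in> directions m \<Longrightarrow> 0 \<le> c bs"
    "\<And>bs v x. bs \<in> directions m \<Longrightarrow> smooth v \<Longrightarrow> \<bar>partial_deriv bs (\<lambda>x. \<phi> x * v x) x - \<phi> x * partial_deriv bs v x\<bar> \<le> c bs * lower_order m v x"
    by blast
  define C where "C = (\<Sum>bs\<in>directions m. c bs)"
  have C0: "C \<ge> 0" unfolding C_def using c(1) by (intro sum_nonneg)
  have cC: "c bs \<le> C" if "bs \<in> directions m" for bs
    unfolding C_def using that c(1) by (intro member_le_sum) auto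
  define N where "N = real (card (directions m :: 'a list set))"
  \<comment> \<open>One constant for all three bounds, so that the statement needs a single existential quantifier.\<close>
  define K where "K = N * (L + 2 * C) + 2 * B + C"
  have N0: "N \<ge> 0" by (simp add: N_def)
  have K0: "K \<ge> 0" using N0 L(1) C0 B(1) by (simp add: K_def)
  have KB: "B \<le> K" "2 * B + C \<le> K" using N0 L(1) C0 B(1) by (simp_all add: K_def)
  show ?thesis
  proof (intro exI[of _ K] conjI allI impI K0)
    fix \<psi> :: "'a \<Rightarrow> real" and h :: 'a assume \<psi>: "test \<psi>" and h: "norm h \<le> 1"
    define v where "v = (\<lambda>x. \<psi> (x + h) - \<psi> x)"
    define w where "w = (\<lambda>x. \<phi> x * v x)"
    define S where "S = (\<Sum>bs\<in>multi_indices m. l2norm lborel (partial_deriv bs \<psi>))"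
    define LO where "LO = lower_order m v"
    have v: "test v" unfolding v_def by (intro test_diff test_translate \<psi>)
    have w: "test w" unfolding w_def by (intro test_mult1 \<phi> testD(1)[OF v])
    have LO: "square_integrable lborel LO" "l2norm lborel LO \<le> norm h * S"
      using l2norm_lower_order_increment_le[OF \<psi>] by (simp_all add: LO_def v_def S_def)
    have LO0: "0 \<le> LO x" for x unfolding LO_def by (rule lower_order_nonneg)
    have S0: "0 \<le> S" unfolding S_def by (intro sum_nonneg) auto
    have SP: "l2norm lborel (partial_deriv bs \<psi>) \<le> S" if "bs \<in> directions m" for bs
      unfolding S_def using that directions_subset_multi_indices by (intro member_le_sum) auto
    have "l2norm lborel w \<le> l2norm lborel (\<lambda>x. B * LO x)"
    proof (rule square_integrable_dominated(2)[OF square_integrable_scale[OF LO(1)]])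
      show "AE x in lborel. \<bar>w x\<bar> \<le> \<bar>B * LO x\<bar>"
      proof (intro AE_I2)
        fix x
        have "\<bar>partial_deriv [] v x\<bar> \<le> LO x"
          unfolding LO_def using m by (intro partial_deriv_le_lower_order[of _ 0]) auto
        then show "\<bar>w x\<bar> \<le> \<bar>B * LO x\<bar>"
          unfolding w_def abs_mult using B LO0[of x] by (intro mult_mono) (auto intro: order_trans[OF B(2)])
      qed
    qed (use test_measurable[OF w] in simp)
    also have "\<dots> = B * l2norm lborel LO" using B(1) by (simp add: l2norm_scale)
    also have "\<dots> \<le> B * (norm h * S)" using B(1) by (intro mult_left_mono LO) auto
    also have "\<dots> \<le> K * (norm h * S)" using KB S0 by (intro mult_right_mono) auto
    finally have a: "l2norm lborel w \<le> K * norm h * S" by (simp add: mult.assoc)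
    have pt: "test (partial_deriv bs \<psi>)" "test (partial_deriv bs w)" if "bs \<in> directions m" for bs
      by (intro test_partial_deriv \<psi> w directionsD(1)[OF that])+
    \<comment> \<open>The derivative of \<open>w\<close> splits into its leading part \<open>inc\<close> and the commutator \<open>r\<close>.\<close>
    define inc where "inc = (\<lambda>bs x. \<phi> x * (partial_deriv bs \<psi> (x + h) - partial_deriv bs \<psi> x))"
    define r where "r = (\<lambda>bs x. partial_deriv bs w x - inc bs x)"
    have inc: "test (inc bs)" if "bs \<in> directions m" for bs
      unfolding inc_def by (intro test_mult1 \<phi> testD(1) test_diff test_translate pt(1)[OF that])
    have r: "test (r bs)" if "bs \<in> directions m" for bs
      unfolding r_def by (intro test_diff pt[OF that] inc[OF that])
    have rn: "l2norm lborel (r bs) \<le> C * (norm h * S)" if bs: "bs \<in> directions m" for bs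
    proof -
      have pv: "partial_deriv bs v = (\<lambda>x. partial_deriv bs \<psi> (x + h) - partial_deriv bs \<psi> x)"
        unfolding v_def using partial_deriv_diff[OF smooth_translate[OF testD(1)[OF \<psi>]] testD(1)[OF \<psi>] directionsD(1)[OF bs]]
          partial_deriv_translate[OF testD(1)[OF \<psi>] directionsD(1)[OF bs]] by simp
      have le: "\<bar>r bs x\<bar> \<le> \<bar>C * LO x\<bar>" for x
      proof -
        have "\<bar>r bs x\<bar> \<le> c bs * LO x"
          using c(2)[OF bs testD(1)[OF v], of x] by (simp add: r_def inc_def w_def pv LO_def)
        also have "\<dots> \<le> C * LO x" by (intro mult_right_mono cC bs LO0)
        finally show ?thesis by simp
      qed
      have "l2norm lborel (r bs) \<le> l2norm lborel (\<lambda>x. C * LO x)"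
        using test_measurable[OF r[OF bs]] le by (intro square_integrable_dominated(2)[OF square_integrable_scale[OF LO(1)]]) auto
      also have "\<dots> = C * l2norm lborel LO" using C0 by (simp add: l2norm_scale)
      also have "\<dots> \<le> C * (norm h * S)" by (intro mult_left_mono LO C0)
      finally show ?thesis .
    qed
    have b: "l2norm lborel (partial_deriv bs w) \<le> K * S" if bs: "bs \<in> directions m" for bs
    proof -
      have "l2norm lborel (inc bs) \<le> l2norm lborel (\<lambda>x. B * (partial_deriv bs \<psi> (x + h) - partial_deriv bs \<psi> x))"
        using test_measurable[OF inc[OF bs]] B
        by (intro square_integrable_dominated(2)[OF square_integrable_scale[OF test_square_integrable[OF test_diff[OF test_translate[OF pt(1)[OF bs]] pt(1)[OF bs]]]]])
           (auto simp: inc_def abs_mult intro!: mult_right_mono order_trans[OF B(2)])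
      also have "\<dots> = B * l2norm lborel (\<lambda>x. partial_deriv bs \<psi> (x + h) - partial_deriv bs \<psi> x)"
        using B(1) by (simp add: l2norm_scale)
      also have "\<dots> \<le> B * (l2norm lborel (\<lambda>x. partial_deriv bs \<psi> (x + h)) + l2norm lborel (partial_deriv bs \<psi>))"
        using B(1) by (intro mult_left_mono l2norm_diff_le test_square_integrable test_translate pt(1)[OF bs]) auto
      also have "\<dots> \<le> B * (S + S)"
        using B(1) l2norm_translate[OF test_measurable[OF pt(1)[OF bs]], of h] SP[OF bs] by (intro mult_left_mono add_mono) auto
      finally have i: "l2norm lborel (inc bs) \<le> 2 * B * S" by simp
      have "l2norm lborel (partial_deriv bs w) = l2norm lborel (\<lambda>x. r bs x + inc bs x)" by (simp add: r_def)
      also have "\<dots> \<le> l2norm lborel (r bs) + l2norm lborel (inc bs)"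
        by (intro l2norm_triangle test_square_integrable r inc bs)
      also have "\<dots> \<le> C * (1 * S) + 2 * B * S"
        by (intro add_mono i order_trans[OF rn[OF bs]] mult_left_mono mult_right_mono h S0 C0)
      also have "\<dots> \<le> K * S" using mult_right_mono[OF KB(2) S0] by (simp add: algebra_simps)
      finally show ?thesis .
    qed
    have cc: "(\<integral>x. \<phi> x * (partial_deriv bs \<psi> (x + h) - partial_deriv bs \<psi> x)\<^sup>2 \<partial>lborel)
        \<le> (L + 2 * C) * norm h * S\<^sup>2 - 2 * (\<integral>x. partial_deriv bs \<psi> x * partial_deriv bs w x \<partial>lborel)" if bs: "bs \<in> directions m" for bs
    proof -
      let ?P = "partial_deriv bs \<psi>"
      note P = pt(1)[OF bs]
      note sqP = test_square_integrable[OF P]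
      have \<phi>h: "test (\<lambda>x. \<phi> (x - h))" using test_translate[OF \<phi>, of "- h"] by simp
      have "(\<integral>x. (\<phi> (x - h) - \<phi> x) * (?P x)\<^sup>2 \<partial>lborel) \<le> (\<integral>x. (L * norm h) * (?P x)\<^sup>2 \<partial>lborel)"
      proof (rule integral_mono)
        show "integrable lborel (\<lambda>x. (\<phi> (x - h) - \<phi> x) * (?P x)\<^sup>2)" unfolding power2_eq_square
          by (intro test_integrable test_mult1 test_diff \<phi> \<phi>h testD(1) P)
        show "integrable lborel (\<lambda>x. L * norm h * (?P x)\<^sup>2)"
          using square_integrableD(2)[OF sqP] by auto
        show "(\<phi> (x - h) - \<phi> x) * (?P x)\<^sup>2 \<le> (L * norm h) * (?P x)\<^sup>2" for x
          using L(2)[of x "- h"] by (intro mult_right_mono) auto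
      qed
      also have "\<dots> = L * norm h * (l2norm lborel ?P)\<^sup>2" by (simp add: l2norm_sq)
      also have "\<dots> \<le> L * norm h * S\<^sup>2" using L(1) by (intro mult_left_mono power_mono SP bs) auto
      finally have 1: "(\<integral>x. (\<phi> (x - h) - \<phi> x) * (?P x)\<^sup>2 \<partial>lborel) \<le> L * norm h * S\<^sup>2" .
      have "(\<integral>x. ?P x * partial_deriv bs w x \<partial>lborel) = (\<integral>x. ?P x * inc bs x + ?P x * r bs x \<partial>lborel)"
        by (simp add: r_def algebra_simps)
      also have "\<dots> = (\<integral>x. ?P x * inc bs x \<partial>lborel) + (\<integral>x. ?P x * r bs x \<partial>lborel)"
        by (intro Bochner_Integration.integral_add integrable_mult_square_integrable test_square_integrable P r inc bs)
      finally have 2: "(\<integral>x. ?P x * inc bs x \<partial>lborel) = (\<integral>x. ?P x * partial_deriv bs w x \<partial>lborel) - (\<integral>x. ?P x * r bs x \<partial>lborel)" by simp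
      have "\<bar>\<integral>x. ?P x * r bs x \<partial>lborel\<bar> \<le> l2norm lborel ?P * l2norm lborel (r bs)"
        by (intro Cauchy_Schwarz_l2norm test_square_integrable P r bs)
      also have "\<dots> \<le> S * (C * (norm h * S))"
        by (intro mult_mono SP rn bs S0) auto
      finally have 3: "(\<integral>x. ?P x * r bs x \<partial>lborel) \<le> C * norm h * S\<^sup>2" by (simp add: power2_eq_square algebra_simps)
      show ?thesis
        unfolding weighted_increment_identity[OF \<phi> P] using 1 2 3 unfolding inc_def by (simp add: algebra_simps)
    qed
    have "(\<Sum>bs\<in>directions m. \<integral>x. \<phi> x * (partial_deriv bs \<psi> (x + h) - partial_deriv bs \<psi> x)\<^sup>2 \<partial>lborel)
      \<le> (\<Sum>bs\<in>(directions m :: 'a list set). (L + 2 * C) * norm h * S\<^sup>2 - 2 * (\<integral>x. partial_deriv bs \<psi> x * partial_deriv bs w x \<partial>lborel))"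
      by (intro sum_mono cc)
    also have "\<dots> = N * (L + 2 * C) * (norm h * S\<^sup>2) - 2 * (\<Sum>bs\<in>directions m. \<integral>x. partial_deriv bs \<psi> x * partial_deriv bs w x \<partial>lborel)"
      by (simp add: sum_subtractf sum_distrib_left N_def algebra_simps)
    also have "N * (L + 2 * C) * (norm h * S\<^sup>2) \<le> K * (norm h * S\<^sup>2)"
      using B(1) C0 by (intro mult_right_mono) (auto simp: K_def)
    finally have d: "(\<Sum>bs\<in>directions m. \<integral>x. \<phi> x * (partial_deriv bs \<psi> (x + h) - partial_deriv bs \<psi> x)\<^sup>2 \<partial>lborel)
        \<le> K * norm h * S\<^sup>2 - 2 * (\<Sum>bs\<in>directions m. \<integral>x. partial_deriv bs \<psi> x * partial_deriv bs w x \<partial>lborel)"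
      by (simp add: mult.assoc)
    show "let w = (\<lambda>x. \<phi> x * (\<psi> (x + h) - \<psi> x)); S = (\<Sum>bs\<in>multi_indices m. l2norm lborel (partial_deriv bs \<psi>)) in
      l2norm lborel w \<le> K * norm h * S \<and>
      (\<forall>bs\<in>directions m. l2norm lborel (partial_deriv bs w) \<le> K * S) \<and>
      (\<Sum>bs\<in>directions m. \<integral>x. \<phi> x * (partial_deriv bs \<psi> (x + h) - partial_deriv bs \<psi> x)\<^sup>2 \<partial>lborel)
        \<le> K * norm h * S\<^sup>2 - 2 * (\<Sum>bs\<in>directions m. \<integral>x. partial_deriv bs \<psi> x * partial_deriv bs w x \<partial>lborel)"
      using a b d unfolding Let_def w_def v_def S_def by blast
  qed
qed

section \<open>The local translation estimate for solutions\<close>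

text \<open>The function \<open>u \<in> H\<^sup>m\<^sub>0\<close> solves \<open>(-1)\<^sup>m \<Delta>\<^sup>m u = G\<close> weakly, with data of size at most \<open>\<kappa>\<close>. Carrying the bound along
  makes the estimates below uniform over sets of functions, as the measurability argument in time
  requires.\<close>

definition weak_eq :: "'a::euclidean_space set \<Rightarrow> nat \<Rightarrow> real \<Rightarrow> ('a \<Rightarrow> real) \<Rightarrow> ('a \<Rightarrow> real) \<Rightarrow> bool" where
  "weak_eq \<Omega> m \<kappa> G u \<longleftrightarrow> u \<in> sobolev0 \<Omega> m \<and> G \<in> L2 \<Omega> \<and>
     (\<forall>w. test_function \<Omega> w \<longrightarrow> bilin \<Omega> m u w = L2_inner \<Omega> G w) \<and>
     V_norm \<Omega> m u + L2_norm \<Omega> G \<le> \<kappa>"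

context
  fixes \<Omega> :: "'a::euclidean_space set" and m :: nat
  assumes \<Omega>: "open \<Omega>" and bdd: "bounded \<Omega>" and m: "m \<ge> 1"
begin

text \<open>If cutting off the increment of a test function always yields a test function of \<open>\<Omega>\<close>, then \<open>w\<close> is
  admissible in the weak equation, and the energy form at \<open>(u, w)\<close> equals \<open>(G, w) = O(|h|)\<close>. Inserting this
  into the previous lemma, for test functions \<open>p n\<close> tending to \<open>u\<close>, bounds the increment of \<open>D\<^sup>m u\<close> by
  \<open>O(|h|\<^sup>1\<^sup>/\<^sup>2)\<close>. The error from replacing \<open>u\<close> by \<open>p n\<close> vanishes for fixed \<open>h\<close>.\<close>

lemma local_translation_estimate:
  assumes \<phi>: "test \<phi>" "\<And>x. 0 \<le> \<phi> x" "\<And>x. x \<in> B \<Longrightarrow> 1 \<le> \<phi> x" and B: "B \<in> sets borel"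
  shows "\<exists>K\<ge>0. \<forall>h \<kappa> G u. norm h \<le> 1 \<longrightarrow>
    (\<forall>\<psi>. test_function \<Omega> \<psi> \<longrightarrow> test_function \<Omega> (\<lambda>x. \<phi> x * (\<psi> (x + h) - \<psi> x))) \<longrightarrow> weak_eq \<Omega> m \<kappa> G u \<longrightarrow>
    (\<forall>bs\<in>directions m. (l2norm lborel (\<lambda>x. indicator B x * (wderiv \<Omega> bs u (x + h) - wderiv \<Omega> bs u x)))\<^sup>2
       \<le> K * norm h * \<kappa>\<^sup>2)"
proof -
  obtain K where K: "K \<ge> 0" and energy: "\<And>\<psi> h. test \<psi> \<Longrightarrow> norm h \<le> 1 \<Longrightarrow>
    (let w = (\<lambda>x. \<phi> x * (\<psi> (x + h) - \<psi> x)); S = (\<Sum>bs\<in>multi_indices m. l2norm lborel (partial_deriv bs \<psi>)) in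
      l2norm lborel w \<le> K * norm h * S \<and>
      (\<forall>bs\<in>directions m. l2norm lborel (partial_deriv bs w) \<le> K * S) \<and>
      (\<Sum>bs\<in>directions m. \<integral>x. \<phi> x * (partial_deriv bs \<psi> (x + h) - partial_deriv bs \<psi> x)\<^sup>2 \<partial>lborel)
        \<le> K * norm h * S\<^sup>2 - 2 * (\<Sum>bs\<in>directions m. \<integral>x. partial_deriv bs \<psi> x * partial_deriv bs w x \<partial>lborel))"
    using translation_energy[OF \<phi>(1) m] by blast
  obtain C where C: "C > 0" "\<And>u bs. u \<in> sobolev0 \<Omega> m \<Longrightarrow> bs \<in> multi_indices m \<Longrightarrow> l2norm lborel (wderiv \<Omega> bs u) \<le> C * V_norm \<Omega> m u"
    using Poincare[OF \<Omega> bdd, of m] by blast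
  define N where "N = real (card (multi_indices m :: 'a list set))"
  define C1 where "C1 = N * C"
  have C1: "C1 \<ge> 0" using C(1) by (simp add: C1_def N_def)
  show ?thesis
  proof (intro exI[of _ "K * (C1\<^sup>2 + C1)"] conjI allI impI ballI)
    show "0 \<le> K * (C1\<^sup>2 + C1)" using K C1 by simp
    fix h :: 'a and \<kappa> G u and bs :: "'a list"
    assume h: "norm h \<le> 1" and adm: "\<forall>\<psi>. test_function \<Omega> \<psi> \<longrightarrow> test_function \<Omega> (\<lambda>x. \<phi> x * (\<psi> (x + h) - \<psi> x))"
      and "weak_eq \<Omega> m \<kappa> G u" and bs: "bs \<in> directions m"
    then have u: "u \<in> sobolev0 \<Omega> m" and G: "G \<in> L2 \<Omega>" and eq: "\<And>w. test_function \<Omega> w \<Longrightarrow> bilin \<Omega> m u w = L2_inner \<Omega> G w"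
      and \<kappa>: "V_norm \<Omega> m u + L2_norm \<Omega> G \<le> \<kappa>" by (auto simp: weak_eq_def)
    note us = sobolev0_sobolev[OF \<Omega> u]
    define V where "V = V_norm \<Omega> m u"
    define g where "g = L2_norm \<Omega> G"
    have V0: "V \<ge> 0" and g0: "g \<ge> 0" by (simp_all add: V_def g_def V_norm_nonneg[OF \<Omega>] L2_norm_eq)
    obtain p where p: "\<And>n. test_function \<Omega> (p n)"
      "\<And>bs. bs \<in> multi_indices m \<Longrightarrow> (\<lambda>n. l2norm lborel (\<lambda>x. wderiv \<Omega> bs u x - partial_deriv (rev bs) (p n) x)) \<longlonglongrightarrow> 0"
      using sobolev0_approx[OF \<Omega> u] by blast
    have mi: "cs \<in> multi_indices m" if "cs \<in> directions m" for cs :: "'a list" using that directions_subset_multi_indices by auto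
    define S where "S = (\<lambda>n. \<Sum>bs\<in>multi_indices m. l2norm lborel (partial_deriv bs (p n)))"
    define e where "e = (\<lambda>n bs. l2norm lborel (\<lambda>x. wderiv \<Omega> bs u x - partial_deriv (rev bs) (p n) x))"
    define w where "w = (\<lambda>n x. \<phi> x * (p n (x + h) - p n x))"
    have w: "test_function \<Omega> (w n)" for n unfolding w_def using adm p(1) by blast
    have S0: "S n \<ge> 0" for n unfolding S_def by (intro sum_nonneg) auto
    have sum_rev: "(\<Sum>bs\<in>multi_indices m. F (rev bs)) = (\<Sum>bs\<in>multi_indices m. F bs)" for F :: "'a list \<Rightarrow> real"
      unfolding sum_multi_indices[symmetric] sum_rev_directions ..
    define Sinf where "Sinf = (\<Sum>bs\<in>multi_indices m. l2norm lborel (wderiv \<Omega> bs u))"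
    have limS: "S \<longlonglongrightarrow> Sinf"
      unfolding S_def Sinf_def sum_rev[of "\<lambda>bs. l2norm lborel (partial_deriv bs (p _))", symmetric]
      by (intro tendsto_sum tendsto_wderiv_norm[OF \<Omega> us p(1)] p(2))
    have Sinf: "Sinf \<le> C1 * V" "0 \<le> Sinf"
    proof -
      have "Sinf \<le> (\<Sum>bs\<in>(multi_indices m :: 'a list set). C * V)"
        unfolding Sinf_def V_def by (intro sum_mono C(2) u)
      then show "Sinf \<le> C1 * V" by (simp add: C1_def N_def mult.assoc)
      show "0 \<le> Sinf" unfolding Sinf_def by (intro sum_nonneg) auto
    qed
    have en: "l2norm lborel (w n) \<le> K * norm h * S n"
      "\<And>bs. bs \<in> directions m \<Longrightarrow> l2norm lborel (partial_deriv bs (w n)) \<le> K * S n"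
      "(\<Sum>bs\<in>directions m. \<integral>x. \<phi> x * (partial_deriv bs (p n) (x + h) - partial_deriv bs (p n) x)\<^sup>2 \<partial>lborel)
        \<le> K * norm h * (S n)\<^sup>2 - 2 * (\<Sum>bs\<in>directions m. \<integral>x. partial_deriv bs (p n) x * partial_deriv bs (w n) x \<partial>lborel)" for n
      using energy[OF test_function_test[OF p(1)[of n]] h] unfolding Let_def w_def S_def by blast+
    have sqw: "square_integrable lborel (partial_deriv (rev cs) (w n))" "square_integrable lborel (partial_deriv (rev cs) (p n))"
        if "cs \<in> directions m" for cs n
      using directionsD(1)[OF that] by (intro test_square_integrable test_partial_deriv test_function_test[OF w] test_function_test[OF p(1)]; simp)+
    \<comment> \<open>Testing the equation for \<open>u\<close> with \<open>w n\<close>; \<open>e n\<close> accounts for \<open>p n\<close> in place of \<open>u\<close>.\<close>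
    have low: "- (\<Sum>bs\<in>directions m. \<integral>x. partial_deriv bs (p n) x * partial_deriv bs (w n) x \<partial>lborel)
        \<le> g * (K * norm h * S n) + K * S n * (\<Sum>bs\<in>directions m. e n bs)" for n
    proof -
      have "bilin \<Omega> m u (w n) = (\<Sum>bs\<in>directions m. \<integral>x. wderiv \<Omega> bs u x * partial_deriv (rev bs) (w n) x \<partial>lborel)"
        unfolding bilin_eq[OF \<Omega> us test_function_sobolev[OF \<Omega> w]]
      proof (intro sum.cong refl integral_cong_AE)
        fix bs :: "'a list" assume b: "bs \<in> directions m"
        note meas = wderiv(1)[OF \<Omega> us mi[OF b]] wderiv(1)[OF \<Omega> test_function_sobolev[OF \<Omega> w] mi[OF b]] square_integrableD(1)[OF sqw(1)[OF b]]
        show "(\<lambda>x. wderiv \<Omega> bs u x * wderiv \<Omega> bs (w n) x) \<in> borel_measurable lborel"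
          "(\<lambda>x. wderiv \<Omega> bs u x * partial_deriv (rev bs) (w n) x) \<in> borel_measurable lborel"
          using meas by auto
        show "AE x in lborel. wderiv \<Omega> bs u x * wderiv \<Omega> bs (w n) x = wderiv \<Omega> bs u x * partial_deriv (rev bs) (w n) x"
          using wderiv_test[OF \<Omega> w[of n] mi[OF b]] by eventually_elim simp
      qed
      also have "\<dots> = (\<Sum>bs\<in>directions m. (\<integral>x. partial_deriv (rev bs) (p n) x * partial_deriv (rev bs) (w n) x \<partial>lborel)
         + (\<integral>x. (wderiv \<Omega> bs u x - partial_deriv (rev bs) (p n) x) * partial_deriv (rev bs) (w n) x \<partial>lborel))"
      proof (rule sum.cong[OF refl])
        fix bs :: "'a list" assume b: "bs \<in> directions m"
        have "(\<integral>x. wderiv \<Omega> bs u x * partial_deriv (rev bs) (w n) x \<partial>lborel) =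
          (\<integral>x. partial_deriv (rev bs) (p n) x * partial_deriv (rev bs) (w n) x + (wderiv \<Omega> bs u x - partial_deriv (rev bs) (p n) x) * partial_deriv (rev bs) (w n) x \<partial>lborel)"
          by (simp add: algebra_simps)
        then show "(\<integral>x. wderiv \<Omega> bs u x * partial_deriv (rev bs) (w n) x \<partial>lborel) = (\<integral>x. partial_deriv (rev bs) (p n) x * partial_deriv (rev bs) (w n) x \<partial>lborel)
         + (\<integral>x. (wderiv \<Omega> bs u x - partial_deriv (rev bs) (p n) x) * partial_deriv (rev bs) (w n) x \<partial>lborel)"
          using Bochner_Integration.integral_add[OF integrable_mult_square_integrable[OF sqw(2)[OF b] sqw(1)[OF b]]
              integrable_mult_square_integrable[OF square_integrable_diff[OF wderiv(4)[OF \<Omega> us mi[OF b]] sqw(2)[OF b]] sqw(1)[OF b]]]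
          by metis
      qed
      also have "\<dots> = (\<Sum>bs\<in>directions m. \<integral>x. partial_deriv bs (p n) x * partial_deriv bs (w n) x \<partial>lborel)
         + (\<Sum>bs\<in>directions m. \<integral>x. (wderiv \<Omega> bs u x - partial_deriv (rev bs) (p n) x) * partial_deriv (rev bs) (w n) x \<partial>lborel)"
        unfolding sum.distrib using sum_rev_directions[of "\<lambda>bs. \<integral>x. partial_deriv bs (p n) x * partial_deriv bs (w n) x \<partial>lborel" m] by simp
      finally have id: "- (\<Sum>bs\<in>directions m. \<integral>x. partial_deriv bs (p n) x * partial_deriv bs (w n) x \<partial>lborel)
        = (\<Sum>bs\<in>directions m. \<integral>x. (wderiv \<Omega> bs u x - partial_deriv (rev bs) (p n) x) * partial_deriv (rev bs) (w n) x \<partial>lborel)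
          - L2_inner \<Omega> G (w n)" using eq[OF w[of n]] by simp
      have "(\<Sum>bs\<in>directions m. \<integral>x. (wderiv \<Omega> bs u x - partial_deriv (rev bs) (p n) x) * partial_deriv (rev bs) (w n) x \<partial>lborel)
        \<le> (\<Sum>bs\<in>directions m. e n bs * (K * S n))"
      proof (rule sum_mono)
        fix bs :: "'a list" assume b: "bs \<in> directions m"
        have "\<bar>\<integral>x. (wderiv \<Omega> bs u x - partial_deriv (rev bs) (p n) x) * partial_deriv (rev bs) (w n) x \<partial>lborel\<bar>
           \<le> e n bs * l2norm lborel (partial_deriv (rev bs) (w n))"
          unfolding e_def by (intro Cauchy_Schwarz_l2norm square_integrable_diff wderiv(4)[OF \<Omega> us mi[OF b]] sqw[OF b])
        also have "\<dots> \<le> e n bs * (K * S n)"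
          using b by (intro mult_left_mono en(2)) (auto simp: e_def)
        finally show "(\<integral>x. (wderiv \<Omega> bs u x - partial_deriv (rev bs) (p n) x) * partial_deriv (rev bs) (w n) x \<partial>lborel) \<le> e n bs * (K * S n)"
          by simp
      qed
      moreover have "- L2_inner \<Omega> G (w n) \<le> g * (K * norm h * S n)"
      proof -
        have wL: "square_integrable (lebesgue_on \<Omega>) (w n)" using test_function_L2[OF \<Omega> w] by (simp add: L2_iff)
        have "- L2_inner \<Omega> G (w n) \<le> \<bar>\<integral>x. G x * w n x \<partial>lebesgue_on \<Omega>\<bar>" by (simp add: L2_inner_def)
        also have "\<dots> \<le> g * l2norm (lebesgue_on \<Omega>) (w n)"
          unfolding g_def L2_norm_eq using G by (intro Cauchy_Schwarz_l2norm wL) (simp add: L2_iff)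
        also have "l2norm (lebesgue_on \<Omega>) (w n) = l2norm lborel (w n)"
          using \<Omega> test_function_outside[OF w] by (intro l2norm_lebesgue_on_borel test_measurable test_function_test[OF w]) auto
        also have "g * \<dots> \<le> g * (K * norm h * S n)" by (intro mult_left_mono en g0)
        finally show ?thesis .
      qed
      ultimately show ?thesis unfolding id by (simp add: sum_distrib_left mult.commute)
    qed
    let ?U = "wderiv \<Omega> bs u"
    let ?P = "\<lambda>n. partial_deriv (rev bs) (p n)"
    have rbs: "rev bs \<in> directions m" using bs by simp
    \<comment> \<open>Energy estimate for \<open>p n\<close>, with the form at \<open>(p n, w n)\<close> replaced by its bound.\<close>
    have upper: "(l2norm lborel (\<lambda>x. indicator B x * (?P n (x + h) - ?P n x)))\<^sup>2
       \<le> K * norm h * (S n)\<^sup>2 + 2 * (g * (K * norm h * S n) + K * S n * (\<Sum>bs\<in>directions m. e n bs))" for n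
    proof -
      have tP: "test (partial_deriv cs (p n))" if "cs \<in> directions m" for cs
        by (intro test_partial_deriv test_function_test[OF p(1)] directionsD(1)[OF that])
      have iP: "integrable lborel (\<lambda>x. \<phi> x * (partial_deriv cs (p n) (x + h) - partial_deriv cs (p n) x)\<^sup>2)" if "cs \<in> directions m" for cs
        unfolding power2_eq_square
        by (intro test_integrable test_mult1 \<phi> testD(1) test_diff test_translate tP that)
      have "(l2norm lborel (\<lambda>x. indicator B x * (?P n (x + h) - ?P n x)))\<^sup>2
        = (\<integral>x. (indicator B x * (?P n (x + h) - ?P n x))\<^sup>2 \<partial>lborel)" by (rule l2norm_sq)
      also have "\<dots> \<le> (\<integral>x. \<phi> x * (?P n (x + h) - ?P n x)\<^sup>2 \<partial>lborel)"
      proof (rule integral_mono_AE')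
        show "AE x in lborel. (indicator B x * (?P n (x + h) - ?P n x))\<^sup>2 \<le> \<phi> x * (?P n (x + h) - ?P n x)\<^sup>2"
          using mult_right_mono[OF \<phi>(3)] \<phi>(2) by (intro AE_I2) (auto simp: indicator_def)
        show "AE x in lborel. 0 \<le> \<phi> x * (?P n (x + h) - ?P n x)\<^sup>2" using \<phi>(2) by simp
      qed (rule iP[OF rbs])
      also have "\<dots> \<le> (\<Sum>bs\<in>directions m. \<integral>x. \<phi> x * (partial_deriv bs (p n) (x + h) - partial_deriv bs (p n) x)\<^sup>2 \<partial>lborel)"
        using \<phi>(2) by (intro member_le_sum[of _ _ "\<lambda>bs. \<integral>x. \<phi> x * (partial_deriv bs (p n) (x + h) - partial_deriv bs (p n) x)\<^sup>2 \<partial>lborel"] rbs) auto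
      finally have "(l2norm lborel (\<lambda>x. indicator B x * (?P n (x + h) - ?P n x)))\<^sup>2 \<le> \<dots>" .
      moreover have "a \<le> c + 2 * d" if "a \<le> b" "b \<le> c - 2 * t" "- t \<le> d" for a b c d t :: real
        using that by linarith
      ultimately show ?thesis using en(3)[of n] low[of n] by blast
    qed
    \<comment> \<open>With \<open>h\<close> fixed, let \<open>n\<close> tend to infinity on both sides; the terms with \<open>e n\<close> disappear.\<close>
    have lhs: "(\<lambda>n. l2norm lborel (\<lambda>x. indicator B x * (?P n (x + h) - ?P n x)))
       \<longlonglongrightarrow> l2norm lborel (\<lambda>x. indicator B x * (?U (x + h) - ?U x))"
    proof (rule tendsto_l2norm)
      note sqU = wderiv(4)[OF \<Omega> us mi[OF bs]]
      have ind: "square_integrable lborel (\<lambda>x. indicator B x * f x)" "l2norm lborel (\<lambda>x. indicator B x * f x) \<le> l2norm lborel f"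
        if "square_integrable lborel f" for f
        using square_integrableD(1)[OF that] B
        by (intro square_integrable_dominated[OF that]; auto simp: indicator_def)+
      show "square_integrable lborel (\<lambda>x. indicator B x * (?U (x + h) - ?U x))"
        by (intro ind square_integrable_diff square_integrable_translate sqU)
      show "square_integrable lborel (\<lambda>x. indicator B x * (?P n (x + h) - ?P n x))" for n
        by (intro ind square_integrable_diff square_integrable_translate sqw(2) bs)
      have le: "l2norm lborel (\<lambda>x. indicator B x * (?U (x + h) - ?U x) - indicator B x * (?P n (x + h) - ?P n x)) \<le> e n bs + e n bs" for n
      proof -
        define d where "d = (\<lambda>x. ?U x - ?P n x)"
        have d: "square_integrable lborel d" unfolding d_def by (intro square_integrable_diff sqU sqw(2) bs)
        have "(\<lambda>x. indicator B x * (?U (x + h) - ?U x) - indicator B x * (?P n (x + h) - ?P n x)) = (\<lambda>x. indicator B x * (d (x + h) - d x))"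
          by (simp add: d_def algebra_simps)
        then have "l2norm lborel (\<lambda>x. indicator B x * (?U (x + h) - ?U x) - indicator B x * (?P n (x + h) - ?P n x)) \<le> l2norm lborel (\<lambda>x. d (x + h) - d x)"
          using ind(2)[OF square_integrable_diff[OF square_integrable_translate[OF d] d]] by simp
        also have "\<dots> \<le> l2norm lborel (\<lambda>x. d (x + h)) + l2norm lborel d"
          by (intro l2norm_diff_le square_integrable_translate d)
        also have "\<dots> = e n bs + e n bs"
          using l2norm_translate[of d h] square_integrableD(1)[OF d] by (simp add: e_def d_def[symmetric])
        finally show ?thesis .
      qed
      have "(\<lambda>n. e n bs + e n bs) \<longlonglongrightarrow> 0"
        unfolding e_def by (intro tendsto_add_zero p(2) mi bs)
      then show "(\<lambda>n. l2norm lborel (\<lambda>x. indicator B x * (?U (x + h) - ?U x) - indicator B x * (?P n (x + h) - ?P n x))) \<longlonglongrightarrow> 0"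
        by (rule tendsto_sandwich[OF _ _ tendsto_const, rotated 2]) (use le in auto)
    qed
    have rhs: "(\<lambda>n. K * norm h * (S n)\<^sup>2 + 2 * (g * (K * norm h * S n) + K * S n * (\<Sum>bs\<in>directions m. e n bs)))
      \<longlonglongrightarrow> K * norm h * Sinf\<^sup>2 + 2 * (g * (K * norm h * Sinf) + K * Sinf * (\<Sum>bs\<in>(directions m :: 'a list set). 0))"
      unfolding e_def by (intro tendsto_intros limS p(2) mi)
    have "(l2norm lborel (\<lambda>x. indicator B x * (?U (x + h) - ?U x)))\<^sup>2 \<le> K * norm h * Sinf\<^sup>2 + 2 * (g * (K * norm h * Sinf) + K * Sinf * (\<Sum>bs\<in>(directions m :: 'a list set). 0))"
      by (rule tendsto_le[OF sequentially_bot rhs tendsto_power[OF lhs]]) (use upper in auto)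
    also have "\<dots> = K * norm h * (Sinf\<^sup>2 + 2 * (g * Sinf))" by (simp add: algebra_simps)
    also have "\<dots> \<le> K * norm h * ((C1\<^sup>2 + C1) * \<kappa>\<^sup>2)"
    proof (intro mult_left_mono)
      have "Sinf\<^sup>2 \<le> (C1 * V)\<^sup>2" using Sinf by (intro power_mono)
      moreover have "g * Sinf \<le> g * (C1 * V)" using Sinf g0 by (intro mult_left_mono)
      moreover have "(V + g)\<^sup>2 \<le> \<kappa>\<^sup>2" using \<kappa> V0 g0 by (intro power_mono) (auto simp: V_def g_def)
      then have "V\<^sup>2 + g\<^sup>2 + 2 * (g * V) \<le> \<kappa>\<^sup>2" by (simp add: power2_sum mult_ac)
      then have "V\<^sup>2 \<le> \<kappa>\<^sup>2" "2 * (g * V) \<le> \<kappa>\<^sup>2"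
        using mult_nonneg_nonneg[OF g0 V0] zero_le_power2[of g] zero_le_power2[of V] by linarith+
      then have "C1\<^sup>2 * V\<^sup>2 \<le> C1\<^sup>2 * \<kappa>\<^sup>2" "C1 * (2 * (g * V)) \<le> C1 * \<kappa>\<^sup>2" using C1 by (intro mult_left_mono; simp)+
      moreover have "2 * (g * (C1 * V)) = C1 * (2 * (g * V))" by simp
      ultimately show "Sinf\<^sup>2 + 2 * (g * Sinf) \<le> (C1\<^sup>2 + C1) * \<kappa>\<^sup>2"
        unfolding power_mult_distrib distrib_right by linarith
    qed (use K in auto)
    finally show "(l2norm lborel (\<lambda>x. indicator B x * (?U (x + h) - ?U x)))\<^sup>2 \<le> K * (C1\<^sup>2 + C1) * norm h * \<kappa>\<^sup>2"
      by (simp add: algebra_simps)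
  qed
qed

end

section \<open>The global translation estimate\<close>

text \<open>Above the graph of an \<open>L\<close>-Lipschitz function all directions close enough to the vertical lead back
  into the domain; \<open>\<delta> = 1/(L + 2)\<close> satisfies \<open>L \<delta> \<le> 1 - \<delta>\<close>, which is what this takes. At interior points every short
  step is admissible, and near exterior points there is nothing to prove. The signs are chosen for
  the translate \<open>\<psi>(x + h)\<close>, whose support moves by \<open>-h\<close>.\<close>

lemma Lipschitz_cone:
  fixes \<Omega> :: "(real^2) set"
  assumes \<Omega>: "open \<Omega>" and lip: "lipschitz_boundary \<Omega>"
  shows "\<exists>r>0. \<exists>c0. \<exists>\<delta>>0. \<forall>y\<in>\<Omega>. dist y x0 < r \<longrightarrow> (\<forall>c s. norm (c - c0) \<le> \<delta> \<longrightarrow> 0 < s \<longrightarrow> s \<le> r \<longrightarrow> y - s *\<^sub>R c \<in> \<Omega>)"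
proof -
  consider "x0 \<in> \<Omega>" | "x0 \<notin> closure \<Omega>" | "x0 \<in> frontier \<Omega>"
    using \<Omega> by (auto simp: frontier_def interior_open)
  then show ?thesis
  proof cases
    case 1
    then obtain e where e: "e > 0" "ball x0 e \<subseteq> \<Omega>" using \<Omega> open_contains_ball by blast
    show ?thesis
    proof (rule exI[of _ "e / 2"], rule conjI, use e in simp, rule exI[of _ 0], rule exI[of _ 1], intro conjI ballI allI impI)
      fix y c :: "real^2" and s assume "dist y x0 < e / 2" "norm (c - 0) \<le> 1" "0 < s" "s \<le> e / 2"
      then have "norm (s *\<^sub>R c) \<le> e / 2" using mult_mono[of s "e / 2" "norm c" 1] by simp
      then have "dist (y - s *\<^sub>R c) x0 < e"
        using \<open>dist y x0 < e / 2\<close> norm_triangle_ineq4[of "y - x0" "s *\<^sub>R c"] by (simp add: dist_norm algebra_simps)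
      then show "y - s *\<^sub>R c \<in> \<Omega>" using e(2) by (auto simp: dist_commute)
    qed simp
  next
    case 2
    then obtain e where e: "e > 0" "ball x0 e \<inter> \<Omega> = {}"
    proof -
      have "open (- closure \<Omega>)" "x0 \<in> - closure \<Omega>" using 2 by auto
      then obtain e where "e > 0" "ball x0 e \<subseteq> - closure \<Omega>" using open_contains_ball by metis
      then show ?thesis using that[of e] closure_subset[of \<Omega>] by auto
    qed
    show ?thesis
    proof (rule exI[of _ e], rule conjI, rule e(1), rule exI[of _ 0], rule exI[of _ 1], intro conjI ballI allI impI)
      fix y c :: "real^2" and s :: real assume "y \<in> \<Omega>" "dist y x0 < e"
      then show "y - s *\<^sub>R c \<in> \<Omega>" using e(2) by (auto simp: dist_commute)
    qed simp
  next
    case 3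
    then obtain e1 e2 g L R where e: "norm e1 = 1" "norm e2 = 1" "e1 \<bullet> e2 = 0" and g: "L-lipschitz_on UNIV (g :: real \<Rightarrow> real)" and R: "R > 0"
      and graph: "\<And>y. y \<in> ball x0 R \<Longrightarrow> y \<in> \<Omega> \<longleftrightarrow> g (y \<bullet> e1) < y \<bullet> e2"
      using bspec[OF lip[unfolded lipschitz_boundary_def] 3] by (elim exE conjE) (rule that, assumption+, blast)
    have L: "L \<ge> 0" using g by (rule lipschitz_on_nonneg)
    define \<delta> where "\<delta> = 1 / (L + 2)"
    have \<delta>: "\<delta> > 0" "\<delta> \<le> 1/2" "L * \<delta> + \<delta> \<le> 1" using L by (auto simp: \<delta>_def field_simps)
    show ?thesis
    proof (rule exI[of _ "R / 3"], rule conjI, use R in simp, rule exI[of _ "- e2"], rule exI[of _ \<delta>], intro conjI ballI allI impI)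
      fix y c :: "real^2" and s assume y: "y \<in> \<Omega>" "dist y x0 < R / 3" and c: "norm (c - - e2) \<le> \<delta>" and s: "0 < s" "s \<le> R / 3"
      define d where "d = c + e2"
      have d: "norm d \<le> \<delta>" "c = d - e2" using c by (simp_all add: d_def)
      have nc: "norm c \<le> 2" using norm_triangle_ineq4[of d e2] d e \<delta> by simp
      have "norm (s *\<^sub>R c) \<le> (R / 3) * 2" using mult_mono[OF s(2) nc] s R by simp
      then have z: "y - s *\<^sub>R c \<in> ball x0 R"
        using y(2) norm_triangle_ineq4[of "y - x0" "s *\<^sub>R c"] by (simp add: dist_norm norm_minus_commute algebra_simps)
      have yb: "y \<in> ball x0 R" using y(2) R by (simp add: dist_commute)
      have d1: "\<bar>d \<bullet> e1\<bar> \<le> \<delta>" "\<bar>d \<bullet> e2\<bar> \<le> \<delta>"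
        using Cauchy_Schwarz_ineq2[of d e1] Cauchy_Schwarz_ineq2[of d e2] d(1) e by auto
      have z1: "(y - s *\<^sub>R c) \<bullet> e1 = y \<bullet> e1 - s * (d \<bullet> e1)"
        using e(3) by (simp add: d(2) inner_diff_left inner_commute[of e2 e1])
      have "e2 \<bullet> e2 = 1" using e(2) by (simp add: norm_eq_sqrt_inner)
      then have z2: "(y - s *\<^sub>R c) \<bullet> e2 = y \<bullet> e2 + s - s * (d \<bullet> e2)"
        by (simp add: d(2) inner_diff_left algebra_simps)
      have "\<bar>g ((y - s *\<^sub>R c) \<bullet> e1) - g (y \<bullet> e1)\<bar> \<le> L * \<bar>s * (d \<bullet> e1)\<bar>"
        using lipschitz_onD[OF g, of "(y - s *\<^sub>R c) \<bullet> e1" "y \<bullet> e1"] by (simp add: z1 dist_real_def)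
      also have "\<dots> \<le> L * (s * \<delta>)" using s L d1 by (intro mult_left_mono) (auto simp: abs_mult)
      finally have "g ((y - s *\<^sub>R c) \<bullet> e1) \<le> g (y \<bullet> e1) + L * (s * \<delta>)" by linarith
      also have "\<dots> < y \<bullet> e2 + L * (s * \<delta>)" using graph[OF yb] y(1) by simp
      also have "L * (s * \<delta>) \<le> s - s * \<delta>" using mult_left_mono[OF \<delta>(3), of s] s by (simp add: algebra_simps)
      also have "y \<bullet> e2 + (s - s * \<delta>) \<le> (y - s *\<^sub>R c) \<bullet> e2"
        unfolding z2 using mult_left_mono[of "d \<bullet> e2" \<delta> s] d1(2) s by simp
      finally show "y - s *\<^sub>R c \<in> \<Omega>" using graph[OF z] by simp
    qed (rule \<delta>(1))
  qed
qed

lemma test_function_localised_translate: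
  fixes \<Omega> :: "'a::euclidean_space set"
  assumes \<psi>: "test_function \<Omega> \<psi>" and \<phi>: "test \<phi>" "\<And>x. x \<notin> cball x0 R \<Longrightarrow> \<phi> x = 0"
    and shift: "\<And>y. y \<in> \<Omega> \<Longrightarrow> dist y x0 \<le> R + norm h \<Longrightarrow> y - h \<in> \<Omega>"
  shows "test_function \<Omega> (\<lambda>x. \<phi> x * (\<psi> (x + h) - \<psi> x))"
proof -
  let ?S = "closure {x. \<psi> x \<noteq> 0}"
  define A where "A = cball x0 R \<inter> {x. x + h \<in> ?S}"
  have S: "?S \<subseteq> \<Omega>" using \<psi> by (simp add: test_function_iff)
  have cl: "closed A" unfolding A_def
    using continuous_closed_vimage[of ?S "\<lambda>x. x + h"] by (intro closed_Int) (auto simp: vimage_def intro!: continuous_intros)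
  have A: "A \<subseteq> \<Omega>"
  proof
    fix x assume "x \<in> A"
    then have x: "x + h \<in> \<Omega>" "dist x0 x \<le> R" using S by (auto simp: A_def)
    have "dist (x + h) x0 \<le> R + norm h"
      using x(2) norm_triangle_ineq[of "x - x0" h] by (simp add: dist_norm norm_minus_commute algebra_simps)
    from shift[OF x(1) this] show "x \<in> \<Omega>" by simp
  qed
  have "{x. \<phi> x * (\<psi> (x + h) - \<psi> x) \<noteq> 0} \<subseteq> A \<union> ?S"
  proof
    fix x assume "x \<in> {x. \<phi> x * (\<psi> (x + h) - \<psi> x) \<noteq> 0}"
    then have x: "x \<in> cball x0 R" "\<psi> (x + h) \<noteq> 0 \<or> \<psi> x \<noteq> 0" using \<phi>(2)[of x] by auto
    then show "x \<in> A \<union> ?S" using closure_subset[of "{x. \<psi> x \<noteq> 0}"] by (auto simp: A_def)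
  qed
  then have "closure {x. \<phi> x * (\<psi> (x + h) - \<psi> x) \<noteq> 0} \<subseteq> A \<union> ?S"
    using cl by (intro closure_minimal closed_Un) auto
  then show ?thesis
    using A S \<psi> by (auto simp: test_function_iff intro!: test_mult1 \<phi> testD(1) test_diff test_translate)
qed

lemma l2norm_indicator_translate_le:
  fixes U :: "'a::euclidean_space \<Rightarrow> real"
  assumes U: "square_integrable lborel U" and sub: "\<And>x. x + a \<in> A \<Longrightarrow> x \<in> B" and A: "A \<in> sets borel" and B: "B \<in> sets borel"
  shows "l2norm lborel (\<lambda>x. indicator A x * (U (x - a + d) - U (x - a))) \<le> l2norm lborel (\<lambda>x. indicator B x * (U (x + d) - U x))"
proof -
  have [measurable]: "U \<in> borel_measurable borel" "A \<in> sets borel" "B \<in> sets borel" using U A B by (auto simp: square_integrable_def)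
  have "(\<lambda>x. indicator A x * (U (x - a + d) - U (x - a))) \<in> borel_measurable borel" by measurable
  from l2norm_translate[OF this, of a]
  have "l2norm lborel (\<lambda>x. indicator A x * (U (x - a + d) - U (x - a))) = l2norm lborel (\<lambda>x. indicator A (x + a) * (U (x + d) - U x))"
    by simp
  also have "\<dots> \<le> l2norm lborel (\<lambda>x. indicator B x * (U (x + d) - U x))"
  proof (rule square_integrable_dominated(2))
    have sq: "square_integrable lborel (\<lambda>x. U (x + d) - U x)" by (intro square_integrable_diff square_integrable_translate U)
    show "square_integrable lborel (\<lambda>x. indicator B x * (U (x + d) - U x))"
      by (rule square_integrable_dominated(1)[OF sq]) (auto simp: indicator_def)
    show "(\<lambda>x. indicator A (x + a) * (U (x + d) - U x)) \<in> borel_measurable lborel" by measurable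
    show "AE x in lborel. \<bar>indicator A (x + a) * (U (x + d) - U x)\<bar> \<le> \<bar>indicator B x * (U (x + d) - U x)\<bar>"
      using sub by (intro AE_I2) (auto simp: indicator_def)
  qed
  finally show ?thesis .
qed

context
  fixes \<Omega> :: "(real^2) set" and m :: nat
  assumes \<Omega>: "open \<Omega>" and bdd: "bounded \<Omega>" and m: "m \<ge> 1" and lip: "lipschitz_boundary \<Omega>"
begin

lemma weak_eq_square_integrable:
  assumes "weak_eq \<Omega> m \<kappa> G u" "bs \<in> directions m"
  shows "square_integrable lborel (wderiv \<Omega> bs u)" "l2norm lborel (wderiv \<Omega> bs u) \<le> V_norm \<Omega> m u"
    "V_norm \<Omega> m u \<le> \<kappa>"
proof -
  have u: "u \<in> sobolev \<Omega> m" using assms(1) sobolev0_sobolev[OF \<Omega>] by (auto simp: weak_eq_def)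
  show "square_integrable lborel (wderiv \<Omega> bs u)"
    using wderiv(4)[OF \<Omega> u] assms(2) directions_subset_multi_indices by blast
  show "l2norm lborel (wderiv \<Omega> bs u) \<le> V_norm \<Omega> m u" by (rule l2norm_wderiv_le(2)[OF \<Omega> u assms(2)])
  have "0 \<le> L2_norm \<Omega> G" by (simp add: L2_norm_eq)
  then show "V_norm \<Omega> m u \<le> \<kappa>" using assms(1) unfolding weak_eq_def by linarith
qed

text \<open>The cone of admissible directions around \<open>c0\<close> is open, so every small \<open>h\<close> is a difference \<open>s c - s c0\<close> of two
  admissible steps with \<open>s = |h|/\<delta>\<close>. The increment along \<open>h\<close> splits accordingly at the intermediate point
  \<open>x - s c0\<close>; shifting back by \<open>s c0\<close> costs a slightly larger ball.\<close>

lemma local_estimate_all_directions: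
  shows "\<exists>\<rho>>0. \<exists>C\<ge>0. \<forall>h \<kappa> G u. norm h \<le> \<rho> \<longrightarrow> weak_eq \<Omega> m \<kappa> G u \<longrightarrow> (\<forall>bs\<in>directions m.
    (l2norm lborel (\<lambda>x. indicator (cball x0 \<rho>) x * (wderiv \<Omega> bs u (x + h) - wderiv \<Omega> bs u x)))\<^sup>2 \<le> C * norm h * \<kappa>\<^sup>2)"
proof -
  obtain r c0 \<delta> where r: "r > 0" and \<delta>: "\<delta> > 0"
    and cone: "\<And>y c s. y \<in> \<Omega> \<Longrightarrow> dist y x0 < r \<Longrightarrow> norm (c - c0) \<le> \<delta> \<Longrightarrow> 0 < s \<Longrightarrow> s \<le> r \<Longrightarrow> y - s *\<^sub>R c \<in> \<Omega>"
    using Lipschitz_cone[OF \<Omega> lip, of x0] by blast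
  obtain \<rho>1 \<phi> where \<rho>1: "\<rho>1 > 0" and \<phi>: "smooth \<phi>" "\<And>x. 0 \<le> \<phi> x" "\<And>x. x \<in> cball x0 \<rho>1 \<Longrightarrow> 1 \<le> \<phi> x"
    "\<And>x. x \<notin> cball x0 (r / 2) \<Longrightarrow> \<phi> x = 0"
    using smooth_cutoff[of "r / 2" x0] r by auto
  have t\<phi>: "test \<phi>"
  proof -
    have "{x. \<phi> x \<noteq> 0} \<subseteq> cball x0 (r / 2)" using \<phi>(4) by blast
    then show ?thesis using \<phi>(1) bounded_subset[OF bounded_cball] by (auto simp: test_def)
  qed
  obtain K where K: "K \<ge> 0" and loc: "\<And>h \<kappa> G u bs. norm h \<le> 1 \<Longrightarrow>
      (\<And>\<psi>. test_function \<Omega> \<psi> \<Longrightarrow> test_function \<Omega> (\<lambda>x. \<phi> x * (\<psi> (x + h) - \<psi> x))) \<Longrightarrow> weak_eq \<Omega> m \<kappa> G u \<Longrightarrow> bs \<in> directions m \<Longrightarrow>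
      (l2norm lborel (\<lambda>x. indicator (cball x0 \<rho>1) x * (wderiv \<Omega> bs u (x + h) - wderiv \<Omega> bs u x)))\<^sup>2 \<le> K * norm h * \<kappa>\<^sup>2"
    using local_translation_estimate[OF \<Omega> bdd m t\<phi> \<phi>(2,3), of "cball x0 \<rho>1"] by auto
  define M where "M = norm c0 + \<delta>"
  have M: "M > 0" using \<delta> by (simp add: M_def add_nonneg_pos)
  \<comment> \<open>Small enough for both steps to be shorter than \<open>1\<close> and \<open>r/2\<close>, for \<open>s \<le> r\<close>, and for the shifted ball to fit.\<close>
  define \<rho> where "\<rho> = min (min \<rho>1 (min (r / 4) 1) / (1 + M / \<delta>)) (r * \<delta>)"
  have den: "1 + M / \<delta> > 0" using M \<delta> by (simp add: add_pos_pos)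
  have \<rho>: "\<rho> > 0" "\<rho> + (\<rho> / \<delta>) * M \<le> \<rho>1" "\<rho> + (\<rho> / \<delta>) * M \<le> r / 4" "\<rho> + (\<rho> / \<delta>) * M \<le> 1" "\<rho> / \<delta> \<le> r"
  proof -
    show "\<rho> > 0" unfolding \<rho>_def using den \<rho>1 r \<delta> by simp
    have "\<rho> \<le> min \<rho>1 (min (r / 4) 1) / (1 + M / \<delta>)" by (simp add: \<rho>_def)
    then have "\<rho> * (1 + M / \<delta>) \<le> min \<rho>1 (min (r / 4) 1)" using den by (simp add: pos_le_divide_eq)
    moreover have "\<rho> * (1 + M / \<delta>) = \<rho> + (\<rho> / \<delta>) * M" by (simp add: algebra_simps)
    ultimately show "\<rho> + (\<rho> / \<delta>) * M \<le> \<rho>1" "\<rho> + (\<rho> / \<delta>) * M \<le> r / 4" "\<rho> + (\<rho> / \<delta>) * M \<le> 1" by auto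
    show "\<rho> / \<delta> \<le> r" using \<delta> by (simp add: \<rho>_def pos_divide_le_eq)
  qed
  show ?thesis
  proof (rule exI[of _ \<rho>], rule conjI, rule \<rho>(1), rule exI[of _ "4 * K * M / \<delta>"], intro conjI allI impI ballI)
    show "0 \<le> 4 * K * M / \<delta>" using K M \<delta> by simp
    fix h :: "real^2" and \<kappa> G u and bs :: "(real^2) list" assume h: "norm h \<le> \<rho>" and u: "weak_eq \<Omega> m \<kappa> G u" and bs: "bs \<in> directions m"
    let ?U = "wderiv \<Omega> bs u"
    note U = weak_eq_square_integrable(1)[OF u bs]
    have [measurable]: "?U \<in> borel_measurable borel" using U by (simp add: square_integrable_def)
    show "(l2norm lborel (\<lambda>x. indicator (cball x0 \<rho>) x * (?U (x + h) - ?U x)))\<^sup>2 \<le> 4 * K * M / \<delta> * norm h * \<kappa>\<^sup>2"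
    proof (cases "h = 0")
      case False
      \<comment> \<open>With this \<open>s\<close>, the direction \<open>c\<close> with \<open>s c - s c0 = h\<close> lies at distance exactly \<open>\<delta>\<close> from \<open>c0\<close>.\<close>
      define s where "s = norm h / \<delta>"
      define c where "c = c0 + (1 / s) *\<^sub>R h"
      have s: "0 < s" "s \<le> \<rho> / \<delta>" using False h \<delta> by (auto simp: s_def divide_right_mono)
      have sM: "s * M \<le> (\<rho> / \<delta>) * M" using s M by (intro mult_right_mono) auto
      have sr: "s \<le> r" using s(2) \<rho>(5) by linarith
      have nc: "norm (c - c0) \<le> \<delta>" using s \<delta> False by (simp add: c_def s_def)
      have est: "(l2norm lborel (\<lambda>x. indicator (cball x0 \<rho>1) x * (?U (x + s *\<^sub>R d) - ?U x)))\<^sup>2 \<le> K * (s * M) * \<kappa>\<^sup>2"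
        if d: "norm (d - c0) \<le> \<delta>" for d
      proof -
        have "norm d \<le> M" using d norm_triangle_ineq2[of d c0] by (simp add: M_def)
        then have nd: "norm (s *\<^sub>R d) \<le> s * M" using s by simp
        have nd1: "norm (s *\<^sub>R d) < r / 2" "norm (s *\<^sub>R d) \<le> 1" using nd sM \<rho>(1,3,4) r by linarith+
        have "(l2norm lborel (\<lambda>x. indicator (cball x0 \<rho>1) x * (?U (x + s *\<^sub>R d) - ?U x)))\<^sup>2 \<le> K * norm (s *\<^sub>R d) * \<kappa>\<^sup>2"
        proof (rule loc[OF nd1(2) _ u bs])
          fix \<psi> assume "test_function \<Omega> \<psi>"
          then show "test_function \<Omega> (\<lambda>x. \<phi> x * (\<psi> (x + s *\<^sub>R d) - \<psi> x))"
          proof (rule test_function_localised_translate[OF _ t\<phi> \<phi>(4)])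
            fix y assume "y \<in> \<Omega>" "dist y x0 \<le> r / 2 + norm (s *\<^sub>R d)"
            then show "y - s *\<^sub>R d \<in> \<Omega>" using nd1(1) by (intro cone[OF _ _ d s(1) sr]) auto
          qed
        qed
        also have "\<dots> \<le> K * (s * M) * \<kappa>\<^sup>2" using nd K by (intro mult_right_mono mult_left_mono) auto
        finally show ?thesis .
      qed
      define a where "a = s *\<^sub>R c0"
      have sub: "x \<in> cball x0 \<rho>1" if "x + a \<in> cball x0 \<rho>" for x
      proof -
        have "norm a \<le> s * M" using s \<delta> by (simp add: a_def M_def)
        then have "norm a + \<rho> \<le> \<rho>1" using sM \<rho>(2) by linarith
        then show ?thesis using that norm_triangle_ineq[of "x0 - (x + a)" a] by (simp add: dist_norm algebra_simps)
      qed
      have sc: "s *\<^sub>R c = a + h" using s by (simp add: c_def a_def scaleR_add_right)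
      let ?B = "cball x0 \<rho>"
      define f1 where "f1 = (\<lambda>x. indicator ?B x * (?U (x - a + s *\<^sub>R c) - ?U (x - a)))"
      define f2 where "f2 = (\<lambda>x. indicator ?B x * (?U (x - a + s *\<^sub>R c0) - ?U (x - a)))"
      define X where "X = K * (s * M) * \<kappa>\<^sup>2"
      have X0: "X \<ge> 0" using K s M by (simp add: X_def)
      have n1: "(l2norm lborel f1)\<^sup>2 \<le> X"
      proof -
        have "l2norm lborel f1 \<le> l2norm lborel (\<lambda>x. indicator (cball x0 \<rho>1) x * (?U (x + s *\<^sub>R c) - ?U x))"
          unfolding f1_def by (intro l2norm_indicator_translate_le U sub) auto
        then show ?thesis using est[OF nc] power_mono[OF _ l2norm_nonneg, of lborel f1 _ 2] unfolding X_def by (meson order_trans)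
      qed
      have n2: "(l2norm lborel f2)\<^sup>2 \<le> X"
      proof -
        have "l2norm lborel f2 \<le> l2norm lborel (\<lambda>x. indicator (cball x0 \<rho>1) x * (?U (x + s *\<^sub>R c0) - ?U x))"
          unfolding f2_def by (intro l2norm_indicator_translate_le U sub) auto
        then show ?thesis using est[of c0] \<delta> power_mono[OF _ l2norm_nonneg, of lborel f2 _ 2] unfolding X_def by (simp, meson order_trans)
      qed
      have sq: "square_integrable lborel f1" "square_integrable lborel f2"
      proof -
        have "square_integrable lborel (\<lambda>x. indicator ?B x * (?U (x + p) - ?U (x + q)))" for p q
          using U by (intro square_integrable_dominated(1)[OF square_integrable_diff[OF square_integrable_translate[OF U, of p] square_integrable_translate[OF U, of q]]])
            (auto simp: indicator_def)
        from this[of "- a + s *\<^sub>R c" "- a"] this[of "- a + s *\<^sub>R c0" "- a"]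
        show "square_integrable lborel f1" "square_integrable lborel f2" by (simp_all add: f1_def f2_def algebra_simps)
      qed
      have "(\<lambda>x. indicator ?B x * (?U (x + h) - ?U x)) = (\<lambda>x. f1 x - f2 x)"
        by (simp add: f1_def f2_def sc a_def[symmetric] algebra_simps)
      then have "(l2norm lborel (\<lambda>x. indicator ?B x * (?U (x + h) - ?U x)))\<^sup>2 \<le> (l2norm lborel f1 + l2norm lborel f2)\<^sup>2"
        using l2norm_diff_le[OF sq] by (intro power_mono) auto
      also have "\<dots> \<le> 2 * (l2norm lborel f1)\<^sup>2 + 2 * (l2norm lborel f2)\<^sup>2"
        using sum_squares_bound[of "l2norm lborel f1" "l2norm lborel f2"] by (simp add: power2_sum)
      also have "\<dots> \<le> 4 * X" using n1 n2 by simp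
      also have "\<dots> = 4 * K * M / \<delta> * norm h * \<kappa>\<^sup>2" by (simp add: X_def s_def)
      finally show ?thesis .
    qed simp
  qed
qed

text \<open>Finitely many of the local balls cover the closure of \<open>\<Omega>\<close>, and an increment with short \<open>h\<close> vanishes away from
  them.\<close>

lemma translation_estimate_small:
  shows "\<exists>h0>0. \<exists>C\<ge>0. \<forall>h \<kappa> G u. norm h \<le> h0 \<longrightarrow> weak_eq \<Omega> m \<kappa> G u \<longrightarrow> (\<forall>bs\<in>directions m.
    (l2norm lborel (\<lambda>x. wderiv \<Omega> bs u (x + h) - wderiv \<Omega> bs u x))\<^sup>2 \<le> C * norm h * \<kappa>\<^sup>2)"
proof -
  have "\<forall>x0. \<exists>\<rho> C. \<rho> > 0 \<and> C \<ge> 0 \<and> (\<forall>h \<kappa> G u bs. norm h \<le> \<rho> \<longrightarrow> weak_eq \<Omega> m \<kappa> G u \<longrightarrow> bs\<in>directions m \<longrightarrow>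
    (l2norm lborel (\<lambda>x. indicator (cball x0 \<rho>) x * (wderiv \<Omega> bs u (x + h) - wderiv \<Omega> bs u x)))\<^sup>2 \<le> C * norm h * \<kappa>\<^sup>2)"
    using local_estimate_all_directions by meson
  from choice[OF this] obtain \<rho> where "\<forall>x0. \<exists>C. \<rho> x0 > 0 \<and> C \<ge> 0 \<and> (\<forall>h \<kappa> G u bs. norm h \<le> \<rho> x0 \<longrightarrow> weak_eq \<Omega> m \<kappa> G u \<longrightarrow> bs\<in>directions m \<longrightarrow>
    (l2norm lborel (\<lambda>x. indicator (cball x0 (\<rho> x0)) x * (wderiv \<Omega> bs u (x + h) - wderiv \<Omega> bs u x)))\<^sup>2 \<le> C * norm h * \<kappa>\<^sup>2)" ..
  from choice[OF this] obtain C where \<rho>: "\<And>x0. \<rho> x0 > 0" and C: "\<And>x0. C x0 \<ge> 0"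
    and est: "\<And>x0 h \<kappa> G u bs. norm h \<le> \<rho> x0 \<Longrightarrow> weak_eq \<Omega> m \<kappa> G u \<Longrightarrow> bs\<in>directions m \<Longrightarrow>
      (l2norm lborel (\<lambda>x. indicator (cball x0 (\<rho> x0)) x * (wderiv \<Omega> bs u (x + h) - wderiv \<Omega> bs u x)))\<^sup>2 \<le> C x0 * norm h * \<kappa>\<^sup>2"
    by blast
  have comp: "compact (closure \<Omega>)" using bdd by simp
  have cover: "closure \<Omega> \<subseteq> (\<Union>x0\<in>closure \<Omega>. ball x0 (\<rho> x0 / 2))" using \<rho> by auto
  obtain F where F: "F \<subseteq> closure \<Omega>" "finite F" "closure \<Omega> \<subseteq> (\<Union>x0\<in>F. ball x0 (\<rho> x0 / 2))"
    by (rule compactE_image[OF comp open_ball cover])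
  define h0 where "h0 = Min (insert 1 ((\<lambda>x0. \<rho> x0 / 2) ` F))"
  have h0: "h0 > 0" using F(2) \<rho> by (auto simp: h0_def)
  have h0F: "h0 \<le> \<rho> x0 / 2" if "x0 \<in> F" for x0
    unfolding h0_def using F(2) that by (intro Min_le) auto
  show ?thesis
  proof (rule exI[of _ h0], rule conjI, rule h0, rule exI[of _ "\<Sum>x0\<in>F. C x0"], intro conjI allI impI ballI)
    show "0 \<le> (\<Sum>x0\<in>F. C x0)" using C by (intro sum_nonneg)
    fix h :: "real^2" and \<kappa> G u and bs :: "(real^2) list" assume h: "norm h \<le> h0" and u: "weak_eq \<Omega> m \<kappa> G u" and bs: "bs \<in> directions m"
    let ?U = "wderiv \<Omega> bs u"
    note U = weak_eq_square_integrable(1)[OF u bs]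
    have us: "u \<in> sobolev \<Omega> m" using u sobolev0_sobolev[OF \<Omega>] by (auto simp: weak_eq_def)
    have bs': "bs \<in> multi_indices m" using bs directions_subset_multi_indices by auto
    have Uz: "?U x = 0" if "x \<notin> \<Omega>" for x using wderiv(2)[OF \<Omega> us bs' that] .
    define D where "D = (\<lambda>x. ?U (x + h) - ?U x)"
    have D: "square_integrable lborel D" unfolding D_def by (intro square_integrable_diff square_integrable_translate U)
    have iD: "square_integrable lborel (\<lambda>x. indicator (cball x0 (\<rho> x0)) x * D x)" for x0
      using square_integrableD(1)[OF D] by (intro square_integrable_dominated(1)[OF D]) (auto simp: indicator_def)
    have pw: "(D x)\<^sup>2 \<le> (\<Sum>x0\<in>F. (indicator (cball x0 (\<rho> x0)) x * D x)\<^sup>2)" for x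
    proof (cases "D x = 0")
      case False
      then have "x \<in> \<Omega> \<or> x + h \<in> \<Omega>" using Uz[of x] Uz[of "x + h"] by (cases "x \<in> \<Omega>") (auto simp: D_def)
      then obtain x0 where x0: "x0 \<in> F" "x \<in> cball x0 (\<rho> x0)"
      proof
        assume "x \<in> \<Omega>"
        then obtain x0 where "x0 \<in> F" "x \<in> ball x0 (\<rho> x0 / 2)" using F(3) closure_subset[of \<Omega>] by blast
        then show ?thesis using that[of x0] \<rho>[of x0] by auto
      next
        assume "x + h \<in> \<Omega>"
        then obtain x0 where x0: "x0 \<in> F" "x + h \<in> ball x0 (\<rho> x0 / 2)" using F(3) closure_subset[of \<Omega>] by blast
        then have "dist x0 x \<le> \<rho> x0"
          using h h0F[OF x0(1)] norm_triangle_ineq[of "x0 - (x + h)" h] by (simp add: dist_norm algebra_simps)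
        then show ?thesis using that[of x0] x0(1) by auto
      qed
      have "(D x)\<^sup>2 = (indicator (cball x0 (\<rho> x0)) x * D x)\<^sup>2" using x0(2) by simp
      also have "\<dots> \<le> (\<Sum>x0\<in>F. (indicator (cball x0 (\<rho> x0)) x * D x)\<^sup>2)"
        using x0(1) F(2) by (intro member_le_sum[of x0 F "\<lambda>x0. (indicator (cball x0 (\<rho> x0)) x * D x)\<^sup>2"]) auto
      finally show ?thesis .
    qed (auto intro: sum_nonneg)
    have "(l2norm lborel D)\<^sup>2 = (\<integral>x. (D x)\<^sup>2 \<partial>lborel)" by (rule l2norm_sq)
    also have "\<dots> \<le> (\<integral>x. (\<Sum>x0\<in>F. (indicator (cball x0 (\<rho> x0)) x * D x)\<^sup>2) \<partial>lborel)"
      using square_integrableD(2)[OF D] square_integrableD(2)[OF iD] pw by (intro integral_mono Bochner_Integration.integrable_sum) auto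
    also have "\<dots> = (\<Sum>x0\<in>F. (l2norm lborel (\<lambda>x. indicator (cball x0 (\<rho> x0)) x * D x))\<^sup>2)"
      unfolding l2norm_sq using square_integrableD(2)[OF iD] by (intro Bochner_Integration.integral_sum)
    also have "\<dots> \<le> (\<Sum>x0\<in>F. C x0 * norm h * \<kappa>\<^sup>2)"
    proof (rule sum_mono)
      fix x0 assume "x0 \<in> F"
      then have "norm h \<le> \<rho> x0" using h h0F[of x0] \<rho>[of x0] by linarith
      then show "(l2norm lborel (\<lambda>x. indicator (cball x0 (\<rho> x0)) x * D x))\<^sup>2 \<le> C x0 * norm h * \<kappa>\<^sup>2"
        unfolding D_def by (rule est[OF _ u bs])
    qed
    finally show "(l2norm lborel (\<lambda>x. ?U (x + h) - ?U x))\<^sup>2 \<le> (\<Sum>x0\<in>F. C x0) * norm h * \<kappa>\<^sup>2"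
      by (simp add: D_def sum_distrib_right)
  qed
qed

text \<open>Long steps are covered by the trivial bound \<open>2 \<parallel>D\<^sup>m u\<parallel>\<close> for the increment.\<close>

lemma translation_estimate:
  shows "\<exists>C\<ge>0. \<forall>h \<kappa> G u. weak_eq \<Omega> m \<kappa> G u \<longrightarrow> (\<forall>bs\<in>directions m.
    (l2norm lborel (\<lambda>x. wderiv \<Omega> bs u (x + h) - wderiv \<Omega> bs u x))\<^sup>2 \<le> C * norm h * \<kappa>\<^sup>2)"
proof -
  obtain h0 C where h0: "h0 > 0" and C: "C \<ge> 0"
    and est: "\<And>h \<kappa> G u bs. norm h \<le> h0 \<Longrightarrow> weak_eq \<Omega> m \<kappa> G u \<Longrightarrow> bs\<in>directions m \<Longrightarrow>
      (l2norm lborel (\<lambda>x. wderiv \<Omega> bs u (x + h) - wderiv \<Omega> bs u x))\<^sup>2 \<le> C * norm h * \<kappa>\<^sup>2"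
    using translation_estimate_small by meson
  show ?thesis
  proof (intro exI[of _ "C + 4 / h0"] conjI allI impI ballI)
    show "0 \<le> C + 4 / h0" using C h0 by simp
    fix h :: "real^2" and \<kappa> G u and bs :: "(real^2) list" assume u: "weak_eq \<Omega> m \<kappa> G u" and bs: "bs \<in> directions m"
    let ?U = "wderiv \<Omega> bs u"
    note U = weak_eq_square_integrable[OF u bs]
    show "(l2norm lborel (\<lambda>x. ?U (x + h) - ?U x))\<^sup>2 \<le> (C + 4 / h0) * norm h * \<kappa>\<^sup>2"
    proof (cases "norm h \<le> h0")
      case True
      have "C * norm h * \<kappa>\<^sup>2 \<le> (C + 4 / h0) * norm h * \<kappa>\<^sup>2" using h0 by (intro mult_right_mono) auto
      then show ?thesis using est[OF True u bs] by linarith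
    next
      case False
      have "l2norm lborel (\<lambda>x. ?U (x + h) - ?U x) \<le> l2norm lborel (\<lambda>x. ?U (x + h)) + l2norm lborel ?U"
        by (intro l2norm_diff_le square_integrable_translate U)
      also have "\<dots> \<le> 2 * \<kappa>"
        using l2norm_translate[of ?U h] U square_integrableD(1)[OF U(1)] by simp
      finally have "(l2norm lborel (\<lambda>x. ?U (x + h) - ?U x))\<^sup>2 \<le> (2 * \<kappa>)\<^sup>2" by (intro power_mono) auto
      also have "\<dots> = 4 * \<kappa>\<^sup>2" by (simp add: power2_eq_square)
      also have "\<dots> \<le> (C + 4 / h0) * norm h * \<kappa>\<^sup>2"
      proof (intro mult_right_mono)
        have "4 \<le> 4 / h0 * norm h" using False h0 by (simp add: field_simps)
        also have "\<dots> \<le> (C + 4 / h0) * norm h" using C by (intro mult_right_mono) auto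
        finally show "4 \<le> (C + 4 / h0) * norm h" .
      qed auto
      finally show ?thesis .
    qed
  qed
qed

end

section \<open>From translation estimates to Slobodeckij seminorms\<close>

lemma nn_integral_abs_powr_finite:
  fixes a R :: real
  assumes a: "-1 < a" and R: "R \<ge> 0"
  shows "(\<integral>\<^sup>+ x. ennreal (indicator {-R..R} x * \<bar>x\<bar> powr a) \<partial>lborel) < \<infinity>"
proof -
  have p: "(\<integral>\<^sup>+ x. ennreal (indicator {0..R} x * x powr a) \<partial>lborel) = ennreal (R powr (a + 1) / (a + 1))"
    by (rule nn_integral_has_integral_lebesgue[OF _ has_integral_powr_from_0[OF a R]]) auto
  have n: "(\<integral>\<^sup>+ x. ennreal (indicator {0..R} (- x) * (- x) powr a) \<partial>lborel) = ennreal (R powr (a + 1) / (a + 1))"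
    using nn_integral_real_affine[of "\<lambda>x. ennreal (indicator {0..R} x * x powr a)" "-1" 0] p by simp
  have "(\<integral>\<^sup>+ x. ennreal (indicator {-R..R} x * \<bar>x\<bar> powr a) \<partial>lborel)
    \<le> (\<integral>\<^sup>+ x. ennreal (indicator {0..R} x * x powr a) + ennreal (indicator {0..R} (- x) * (- x) powr a) \<partial>lborel)"
    by (intro nn_integral_mono) (auto simp: indicator_def abs_if)
  also have "\<dots> = ennreal (R powr (a + 1) / (a + 1)) + ennreal (R powr (a + 1) / (a + 1))"
    unfolding n[symmetric] p[symmetric] by (subst nn_integral_add) (auto simp: n p)
  also have "\<dots> < \<infinity>" by simp
  finally show ?thesis .
qed

text \<open>In the plane \<open>|h|\<^sup>-\<^sup>7\<^sup>/\<^sup>4\<close> is at most the product of \<open>|h\<^sub>b|\<^sup>-\<^sup>7\<^sup>/\<^sup>8\<close> over the two coordinates, so one-dimensional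
  integrals suffice. The coordinate axes, where a factor degenerates, form a null set.\<close>

lemma nn_integral_norm_powr_finite:
  fixes R :: real
  assumes R: "R \<ge> 0"
  shows "(\<integral>\<^sup>+ h. ennreal (indicator (cball 0 R) h * norm (h :: real^2) powr (- (7/4))) \<partial>lborel) < \<infinity>"
proof -
  define f where "f = (\<lambda>x::real. ennreal (indicator {-R..R} x * \<bar>x\<bar> powr (- (7/8))))"
  have [measurable]: "f \<in> borel_measurable borel" unfolding f_def by measurable
  have ax: "AE h in lborel. h \<bullet> b \<noteq> 0" if "b \<in> Basis" for b :: "real^2"
  proof -
    have "negligible {h. h \<bullet> b = 0}" by (rule negligible_standard_hyperplane[OF that])
    then have "{h. h \<bullet> b = 0} \<in> null_sets lebesgue" by (simp add: negligible_iff_null_sets)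
    from AE_not_in[OF this] show ?thesis by (simp add: AE_completion_iff)
  qed
  have ae: "AE h in lborel. \<forall>b\<in>(Basis :: (real^2) set). h \<bullet> b \<noteq> 0"
    using ax by (intro AE_finite_allI) auto
  have "(\<integral>\<^sup>+ h. ennreal (indicator (cball 0 R) h * norm (h :: real^2) powr (- (7/4))) \<partial>lborel)
    \<le> (\<integral>\<^sup>+ h. (\<Prod>b\<in>(Basis :: (real^2) set). f (h \<bullet> b)) \<partial>lborel)"
  proof (rule nn_integral_mono_AE)
    show "AE h in lborel. ennreal (indicator (cball 0 R) h * norm (h :: real^2) powr (- (7/4))) \<le> (\<Prod>b\<in>(Basis :: (real^2) set). f (h \<bullet> b))"
      using ae
    proof eventually_elim
      case (elim h)
      show ?case
      proof (cases "h \<in> cball 0 R")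
        case True
        have "norm h powr (- (7/8)) \<le> \<bar>h \<bullet> b\<bar> powr (- (7/8))" if "b \<in> Basis" for b
          using Basis_le_norm[OF that, of h] elim that by (intro powr_mono2') auto
        then have "(\<Prod>b\<in>(Basis :: (real^2) set). norm h powr (- (7/8))) \<le> (\<Prod>b\<in>Basis. \<bar>h \<bullet> b\<bar> powr (- (7/8)))"
          by (intro prod_mono) auto
        moreover have "(\<Prod>b\<in>(Basis :: (real^2) set). norm h powr (- (7/8))) = norm h powr (- (7/4))"
          by (simp add: power2_eq_square powr_add[symmetric])
        moreover have "(\<Prod>b\<in>(Basis :: (real^2) set). f (h \<bullet> b)) = ennreal (\<Prod>b\<in>Basis. \<bar>h \<bullet> b\<bar> powr (- (7/8)))"
        proof -
          have "f (h \<bullet> b) = ennreal (\<bar>h \<bullet> b\<bar> powr (- (7/8)))" if "b \<in> Basis" for b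
          proof -
            have "h \<bullet> b \<in> {-R..R}" using Basis_le_norm[OF that, of h] True by (auto simp: abs_le_iff)
            then show ?thesis by (simp add: f_def)
          qed
          then show ?thesis by (simp add: prod_ennreal)
        qed
        ultimately show ?thesis using True by (simp add: ennreal_leI)
      qed simp
    qed
  qed
  also have "\<dots> = (\<Prod>b\<in>(Basis :: (real^2) set). (\<integral>\<^sup>+ x. f x \<partial>lborel))"
    by (rule nn_integral_lborel_prod) auto
  also have "\<dots> < \<infinity>"
  proof -
    have "(\<integral>\<^sup>+ x. f x \<partial>lborel) < \<infinity>"
      unfolding f_def using R by (intro nn_integral_abs_powr_finite) auto
    then show ?thesis by (simp add: power_less_top_ennreal)
  qed
  finally show ?thesis .
qed

lemma nn_integral_square_eq:
  assumes "square_integrable M f"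
  shows "(\<integral>\<^sup>+ x. ennreal ((f x)\<^sup>2) \<partial>M) = ennreal ((l2norm M f)\<^sup>2)"
  unfolding l2norm_sq using square_integrableD(2)[OF assms] by (intro nn_integral_eq_integral) auto

lemma nn_integral_lborel_translate:
  fixes f :: "'a::euclidean_space \<Rightarrow> ennreal"
  assumes "f \<in> borel_measurable borel"
  shows "(\<integral>\<^sup>+ x. f (a + x) \<partial>lborel) = (\<integral>\<^sup>+ x. f x \<partial>lborel)"
proof -
  have "(\<integral>\<^sup>+ x. f x \<partial>lborel) = (\<integral>\<^sup>+ x. f x \<partial>distr lborel borel ((+) a))" by (simp add: lborel_distr_plus)
  also have "\<dots> = (\<integral>\<^sup>+ x. f (a + x) \<partial>lborel)" using assms by (subst nn_integral_distr) auto
  finally show ?thesis ..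
qed

lemma measurable_increment_kernel:
  fixes U :: "'a::euclidean_space \<Rightarrow> real"
  assumes U: "U \<in> borel_measurable borel"
  shows "(\<lambda>(x, h). ennreal (indicator (cball 0 R) h * \<bar>U x - U (x + h)\<bar>\<^sup>2 / norm h powr c))
    \<in> borel_measurable (lborel \<Otimes>\<^sub>M lborel)"
proof -
  let ?M = "(lborel :: 'a measure) \<Otimes>\<^sub>M (lborel :: 'a measure)"
  have f: "(\<lambda>z. fst z) \<in> ?M \<rightarrow>\<^sub>M borel" and s: "(\<lambda>z. snd z) \<in> ?M \<rightarrow>\<^sub>M borel"
    using measurable_fst[of "lborel :: 'a measure" "lborel :: 'a measure"] measurable_snd[of "lborel :: 'a measure" "lborel :: 'a measure"] by simp_all
  have fs: "(\<lambda>z. fst z + snd z) \<in> ?M \<rightarrow>\<^sub>M borel" using f s by (rule borel_measurable_add)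
  have n: "(\<lambda>z. norm (snd z)) \<in> borel_measurable ?M"
    by (rule measurable_compose[OF s borel_measurable_norm])
  have i: "(\<lambda>z. indicator (cball 0 R) (snd z) :: real) \<in> borel_measurable ?M"
    by (rule measurable_compose[OF s]) (simp add: borel_measurable_indicator)
  note [measurable] = measurable_compose[OF f U] measurable_compose[OF fs U] n i
  have "(\<lambda>z. ennreal (indicator (cball 0 R) (snd z) * \<bar>U (fst z) - U (fst z + snd z)\<bar>\<^sup>2 / norm (snd z) powr c)) \<in> borel_measurable ?M"
    by measurable
  then show ?thesis by (simp add: case_prod_beta')
qed

text \<open>By Fubini the seminorm is the integral over \<open>h\<close> of \<open>|h|\<^sup>-\<^sup>2\<^sup>-\<^sup>2\<^sup>\<theta>\<close> times the squared norm of the increment. The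
  latter is at most \<open>2 \<parallel>U\<parallel> (A |h|)\<^sup>1\<^sup>/\<^sup>2\<close>, one factor being estimated trivially and one by the hypothesis, and
  the resulting power is locally integrable for \<open>\<theta> < 1/4\<close>; here \<open>\<theta> = 1/8\<close>. Using both bounds gives up
  half of the available order but leaves the factor \<open>\<parallel>U\<parallel>\<close>: convergence in \<open>V\<close> of functions with bounded
  data then implies convergence in the fractional norm.\<close>

lemma Slobodeckij_bound:
  fixes U :: "real^2 \<Rightarrow> real"
  assumes U: "square_integrable lborel U" and A: "A \<ge> 0"
    and est: "\<And>h. (l2norm lborel (\<lambda>x. U (x + h) - U x))\<^sup>2 \<le> A * norm h"
  shows "(\<integral>\<^sup>+ x. \<integral>\<^sup>+ h. ennreal (indicator (cball 0 R) h * \<bar>U x - U (x + h)\<bar>\<^sup>2 / norm h powr (9/4)) \<partial>lborel \<partial>lborel)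
    \<le> ennreal (2 * l2norm lborel U * sqrt A) * (\<integral>\<^sup>+ h. ennreal (indicator (cball 0 R) h * norm (h :: real^2) powr (- (7/4))) \<partial>lborel)"
proof -
  have [measurable]: "U \<in> borel_measurable borel" using U by (simp add: square_integrable_def)
  let ?N = "l2norm lborel U"
  let ?k = "\<lambda>x h. ennreal (indicator (cball 0 R) h * \<bar>U x - U (x + h)\<bar>\<^sup>2 / norm h powr (9/4))"
  have "(\<integral>\<^sup>+ x. \<integral>\<^sup>+ h. ?k x h \<partial>lborel \<partial>lborel) = (\<integral>\<^sup>+ h. \<integral>\<^sup>+ x. ?k x h \<partial>lborel \<partial>lborel)"
    by (rule lborel_pair.Fubini'[symmetric]) (rule measurable_increment_kernel, simp)
  also have "\<dots> \<le> (\<integral>\<^sup>+ h. ennreal (2 * ?N * sqrt A) * ennreal (indicator (cball 0 R) h * norm (h :: real^2) powr (- (7/4))) \<partial>lborel)"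
  proof (rule nn_integral_mono)
    fix h :: "real^2"
    define D where "D = (\<lambda>x. U (x + h) - U x)"
    have D: "square_integrable lborel D" unfolding D_def by (intro square_integrable_diff square_integrable_translate U)
    have [measurable]: "D \<in> borel_measurable borel" using D by (simp add: square_integrable_def)
    have D1: "l2norm lborel D \<le> 2 * ?N"
    proof -
      have "l2norm lborel D \<le> l2norm lborel (\<lambda>x. U (x + h)) + ?N"
        unfolding D_def by (intro l2norm_diff_le square_integrable_translate U)
      then show ?thesis using l2norm_translate[of U h] by simp
    qed
    have D2: "l2norm lborel D \<le> sqrt A * sqrt (norm h)"
      unfolding real_sqrt_mult[symmetric] using est[of h] by (intro real_le_rsqrt) (simp add: D_def)
    have le: "(l2norm lborel D)\<^sup>2 \<le> (2 * ?N) * (sqrt A * sqrt (norm h))"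
      unfolding power2_eq_square by (intro mult_mono D1 D2) auto
    have pw: "norm h powr (- (9/4)) * sqrt (norm h) = norm h powr (- (7/4))" if "h \<noteq> 0"
      using that by (simp add: powr_half_sqrt[symmetric] powr_add[symmetric])
    have main: "indicator (cball 0 R) h * norm h powr (- (9/4)) * (l2norm lborel D)\<^sup>2
        \<le> (2 * ?N * sqrt A) * (indicator (cball 0 R) h * norm h powr (- (7/4)))" if "h \<noteq> 0"
    proof -
      have "norm h powr (- (9/4)) * (l2norm lborel D)\<^sup>2 \<le> norm h powr (- (9/4)) * ((2 * ?N) * (sqrt A * sqrt (norm h)))"
        by (intro mult_left_mono le) auto
      also have "\<dots> = (2 * ?N * sqrt A) * (norm h powr (- (9/4)) * sqrt (norm h))" by simp
      also have "\<dots> = (2 * ?N * sqrt A) * norm h powr (- (7/4))" by (simp only: pw[OF that])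
      finally show ?thesis by (simp add: indicator_def)
    qed
    have "(\<integral>\<^sup>+ x. ?k x h \<partial>lborel) = (\<integral>\<^sup>+ x. ennreal (indicator (cball 0 R) h * norm h powr (- (9/4))) * ennreal ((D x)\<^sup>2) \<partial>lborel)"
      by (intro nn_integral_cong) (simp add: D_def ennreal_mult[symmetric] powr_minus_divide power2_commute)
    also have "\<dots> = ennreal (indicator (cball 0 R) h * norm h powr (- (9/4))) * ennreal ((l2norm lborel D)\<^sup>2)"
      by (simp add: nn_integral_cmult nn_integral_square_eq[OF D])
    also have "\<dots> = ennreal (indicator (cball 0 R) h * norm h powr (- (9/4)) * (l2norm lborel D)\<^sup>2)"
      by (simp add: ennreal_mult)
    also have "\<dots> \<le> ennreal ((2 * ?N * sqrt A) * (indicator (cball 0 R) h * norm h powr (- (7/4))))"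
      using main by (cases "h = 0") (auto intro: ennreal_leI)
    also have "\<dots> = ennreal (2 * ?N * sqrt A) * ennreal (indicator (cball 0 R) h * norm h powr (- (7/4)))"
      using A by (intro ennreal_mult) auto
    finally show "(\<integral>\<^sup>+ x. ?k x h \<partial>lborel) \<le> ennreal (2 * ?N * sqrt A) * ennreal (indicator (cball 0 R) h * norm h powr (- (7/4)))" .
  qed
  also have "\<dots> = ennreal (2 * ?N * sqrt A) * (\<integral>\<^sup>+ h. ennreal (indicator (cball 0 R) h * norm (h :: real^2) powr (- (7/4))) \<partial>lborel)"
  proof (rule nn_integral_cmult)
    have [measurable]: "(\<lambda>h :: real^2. norm h) \<in> borel_measurable borel" "(\<lambda>h :: real^2. indicator (cball 0 R) h :: real) \<in> borel_measurable borel"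
      by (simp_all add: borel_measurable_indicator)
    have "(\<lambda>h :: real^2. ennreal (indicator (cball 0 R) h * norm h powr (- (7/4)))) \<in> borel_measurable borel"
      by measurable
    then show "(\<lambda>h :: real^2. ennreal (indicator (cball 0 R) h * norm h powr (- (7/4)))) \<in> borel_measurable lborel" by simp
  qed
  finally show ?thesis .
qed

lemma nn_integral_lebesgue_on_borel:
  fixes f :: "'a::euclidean_space \<Rightarrow> ennreal"
  assumes "\<Omega> \<in> sets borel"
  shows "(\<integral>\<^sup>+ x. f x \<partial>lebesgue_on \<Omega>) = (\<integral>\<^sup>+ x. f x * indicator \<Omega> x \<partial>lborel)"
  using assms by (subst nn_integral_restrict_space) (auto simp: nn_integral_completion)

lemma finite_measure_lebesgue_on_open_bounded:
  "open \<Omega> \<Longrightarrow> bounded \<Omega> \<Longrightarrow> finite_measure (lebesgue_on \<Omega>)"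
  by (intro finite_measure_lebesgue_on bounded_set_imp_lmeasurable) auto

text \<open>Its square is the Slobodeckij kernel, so the seminorm is an \<open>L\<^sup>2\<close> norm on the product space and obeys
  Minkowski's inequality.\<close>

definition difference_quotient :: "real \<Rightarrow> ('a::euclidean_space \<Rightarrow> real) \<Rightarrow> 'a \<times> 'a \<Rightarrow> real" where
  "difference_quotient \<theta> v z = (v (fst z) - v (snd z)) / norm (fst z - snd z) powr ((real DIM('a) + 2 * \<theta>) / 2)"

lemma difference_quotient_sq: "(difference_quotient \<theta> v z)\<^sup>2 = slobodeckij_kernel \<theta> v z"
proof -
  have "(norm (fst z - snd z) powr ((real DIM('a) + 2 * \<theta>) / 2))\<^sup>2 = norm (fst z - snd z) powr (real DIM('a) + 2 * \<theta>)"
    by (simp add: power2_eq_square powr_add[symmetric])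
  then show ?thesis
    by (simp add: difference_quotient_def slobodeckij_kernel_def power_divide case_prod_beta)
qed

lemma measurable_difference_quotient:
  fixes v :: "'a::euclidean_space \<Rightarrow> real"
  assumes v: "v \<in> borel_measurable (lebesgue_on \<Omega>)"
  shows "difference_quotient \<theta> v \<in> borel_measurable (lebesgue_on \<Omega> \<Otimes>\<^sub>M lebesgue_on \<Omega>)"
proof -
  note [measurable] = v
  have [measurable]: "(\<lambda>x::'a. x) \<in> lebesgue_on \<Omega> \<rightarrow>\<^sub>M borel"
    using id_borel_measurable_lebesgue_on[of \<Omega>] by (simp add: id_def)
  have "(\<lambda>z. fst z) \<in> lebesgue_on \<Omega> \<Otimes>\<^sub>M lebesgue_on \<Omega> \<rightarrow>\<^sub>M borel" "(\<lambda>z. snd z) \<in> lebesgue_on \<Omega> \<Otimes>\<^sub>M lebesgue_on \<Omega> \<rightarrow>\<^sub>M borel"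
    using measurable_compose[OF measurable_fst, of "\<lambda>x. x" "lebesgue_on \<Omega>" borel "lebesgue_on \<Omega>"]
      measurable_compose[OF measurable_snd, of "\<lambda>x. x" "lebesgue_on \<Omega>" borel "lebesgue_on \<Omega>"] by auto
  then have 1: "(\<lambda>z. norm (fst z - snd z)) \<in> borel_measurable (lebesgue_on \<Omega> \<Otimes>\<^sub>M lebesgue_on \<Omega>)"
    by measurable
  have 2: "(\<lambda>z. v (fst z)) \<in> borel_measurable (lebesgue_on \<Omega> \<Otimes>\<^sub>M lebesgue_on \<Omega>)" "(\<lambda>z. v (snd z)) \<in> borel_measurable (lebesgue_on \<Omega> \<Otimes>\<^sub>M lebesgue_on \<Omega>)"
    by (rule measurable_compose[OF measurable_fst v], rule measurable_compose[OF measurable_snd v])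
  show ?thesis unfolding difference_quotient_def[abs_def] using 1 2
    by measurable
qed

text \<open>Passing to a Borel representative makes Lebesgue--Borel measure available, and the substitution
  \<open>y = x + h\<close> turns the double integral over \<open>\<Omega>\<close> into one over increments.\<close>

lemma nn_integral_kernel_le:
  fixes U :: "real^2 \<Rightarrow> real"
  assumes \<Omega>: "open \<Omega>" and R: "\<And>x y. x \<in> \<Omega> \<Longrightarrow> y \<in> \<Omega> \<Longrightarrow> dist x y \<le> R" and bdd: "bounded \<Omega>"
    and U: "U \<in> borel_measurable borel" and v: "v \<in> borel_measurable (lebesgue_on \<Omega>)" and vU: "AE x in lebesgue_on \<Omega>. v x = U x"
  shows "(\<integral>\<^sup>+ z. ennreal (slobodeckij_kernel (1/8) v z) \<partial>(lebesgue_on \<Omega> \<Otimes>\<^sub>M lebesgue_on \<Omega>))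
     \<le> (\<integral>\<^sup>+ x. \<integral>\<^sup>+ h. ennreal (indicator (cball 0 R) h * \<bar>U x - U (x + h)\<bar>\<^sup>2 / norm h powr (9/4)) \<partial>lborel \<partial>lborel)"
proof -
  interpret finite_measure "lebesgue_on \<Omega>" by (rule finite_measure_lebesgue_on_open_bounded[OF \<Omega> bdd])
  have \<Omega>b: "\<Omega> \<in> sets borel" using \<Omega> by simp
  note [measurable] = U \<Omega>b
  have [measurable]: "(\<lambda>z. ennreal (slobodeckij_kernel (1/8) v z)) \<in> borel_measurable (lebesgue_on \<Omega> \<Otimes>\<^sub>M lebesgue_on \<Omega>)"
    unfolding difference_quotient_sq[symmetric] using measurable_difference_quotient[OF v] by simp
  let ?k = "\<lambda>x y. ennreal (\<bar>U x - U y\<bar>\<^sup>2 / norm (x - y) powr (9/4))"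
  let ?j = "\<lambda>x h. ennreal (indicator (cball 0 R) h * \<bar>U x - U (x + h)\<bar>\<^sup>2 / norm h powr (9/4))"
  have "(\<integral>\<^sup>+ z. ennreal (slobodeckij_kernel (1/8) v z) \<partial>(lebesgue_on \<Omega> \<Otimes>\<^sub>M lebesgue_on \<Omega>))
    = (\<integral>\<^sup>+ x. \<integral>\<^sup>+ y. ennreal (slobodeckij_kernel (1/8) v (x, y)) \<partial>lebesgue_on \<Omega> \<partial>lebesgue_on \<Omega>)"
    by (rule nn_integral_fst[symmetric]) simp
  also have "\<dots> = (\<integral>\<^sup>+ x. \<integral>\<^sup>+ y. ?k x y \<partial>lebesgue_on \<Omega> \<partial>lebesgue_on \<Omega>)"
  proof (rule nn_integral_cong_AE)
    show "AE x in lebesgue_on \<Omega>. (\<integral>\<^sup>+ y. ennreal (slobodeckij_kernel (1/8) v (x, y)) \<partial>lebesgue_on \<Omega>) = (\<integral>\<^sup>+ y. ?k x y \<partial>lebesgue_on \<Omega>)"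
      using vU
    proof eventually_elim
      case (elim x)
      show ?case
      proof (rule nn_integral_cong_AE)
        show "AE y in lebesgue_on \<Omega>. ennreal (slobodeckij_kernel (1/8) v (x, y)) = ?k x y"
          using vU by eventually_elim (simp add: slobodeckij_kernel_def elim)
      qed
    qed
  qed
  also have "\<dots> \<le> (\<integral>\<^sup>+ x. \<integral>\<^sup>+ h. ?j x h \<partial>lborel \<partial>lborel)"
    unfolding nn_integral_lebesgue_on_borel[OF \<Omega>b]
  proof (rule nn_integral_mono)
    fix x :: "real^2"
    show "(\<integral>\<^sup>+ y. ?k x y * indicator \<Omega> y \<partial>lborel) * indicator \<Omega> x \<le> (\<integral>\<^sup>+ h. ?j x h \<partial>lborel)"
    proof (cases "x \<in> \<Omega>")
      case True
      have "(\<integral>\<^sup>+ y. ?k x y * indicator \<Omega> y \<partial>lborel) = (\<integral>\<^sup>+ h. ?k x (x + h) * indicator \<Omega> (x + h) \<partial>lborel)"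
        by (rule nn_integral_lborel_translate[symmetric]) measurable
      also have "\<dots> \<le> (\<integral>\<^sup>+ h. ?j x h \<partial>lborel)"
      proof (rule nn_integral_mono)
        fix h :: "real^2"
        show "?k x (x + h) * indicator \<Omega> (x + h) \<le> ?j x h"
        proof (cases "x + h \<in> \<Omega>")
          case xh: True
          then have "h \<in> cball 0 R" using R[OF True xh] by (simp add: dist_norm)
          then show ?thesis using xh by simp
        qed simp
      qed
      finally show ?thesis using True by simp
    qed simp
  qed
  finally show ?thesis .
qed

context
  fixes \<Omega> :: "(real^2) set" and m :: nat
  assumes \<Omega>: "open \<Omega>" and bdd: "bounded \<Omega>"
begin

abbreviation (input) "frac_order \<equiv> real m + 1/8"

lemma floor_frac_order: "nat \<lfloor>frac_order\<rfloor> = m" "frac frac_order = 1/8"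
proof -
  have "\<lfloor>frac_order\<rfloor> = int m" by linarith
  then show "nat \<lfloor>frac_order\<rfloor> = m" "frac frac_order = 1/8" by (simp_all add: frac_def)
qed

abbreviation "\<Omega>2 \<equiv> lebesgue_on \<Omega> \<Otimes>\<^sub>M lebesgue_on \<Omega>"

lemma weak_deriv_measurable: "u \<in> sobolev \<Omega> m \<Longrightarrow> bs \<in> directions m \<Longrightarrow> weak_deriv \<Omega> bs u \<in> borel_measurable (lebesgue_on \<Omega>)"
  using weak_deriv_in_L2(2)[OF \<Omega>, of u m bs] directions_subset_multi_indices[of m] by (auto simp: L2_def)

lemma frac_sobolev_iff:
  "u \<in> frac_sobolev \<Omega> frac_order \<longleftrightarrow> u \<in> sobolev \<Omega> m \<and>
    (\<forall>bs\<in>directions m. square_integrable \<Omega>2 (difference_quotient (1/8) (weak_deriv \<Omega> bs u)))"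
  using measurable_difference_quotient[OF weak_deriv_measurable]
  unfolding frac_sobolev_def Let_def floor_frac_order square_integrable_def difference_quotient_sq by auto

lemma frac_sobolev_norm_eq:
  "frac_sobolev_norm \<Omega> frac_order u = sqrt ((sobolev_norm \<Omega> m u)\<^sup>2 +
    (L2_set (\<lambda>bs. l2norm \<Omega>2 (difference_quotient (1/8) (weak_deriv \<Omega> bs u))) (directions m))\<^sup>2)"
proof -
  have "(L2_set (\<lambda>bs. l2norm \<Omega>2 (difference_quotient (1/8) (weak_deriv \<Omega> bs u))) (directions m))\<^sup>2
    = (\<Sum>bs\<in>directions m. (l2norm \<Omega>2 (difference_quotient (1/8) (weak_deriv \<Omega> bs u)))\<^sup>2)"
    unfolding L2_set_def by (intro real_sqrt_pow2 sum_nonneg) simp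
  then show ?thesis
    unfolding frac_sobolev_norm_def Let_def floor_frac_order
    by (simp add: l2norm_sq difference_quotient_sq)
qed

lemma frac_sobolev_norm_nonneg: "0 \<le> frac_sobolev_norm \<Omega> frac_order u"
  unfolding frac_sobolev_norm_eq by simp

lemma difference_quotient_weak_deriv_diff:
  assumes u: "u \<in> sobolev \<Omega> m" and v: "v \<in> sobolev \<Omega> m" and bs: "bs \<in> directions m"
  shows "AE z in \<Omega>2. difference_quotient (1/8) (weak_deriv \<Omega> bs (\<lambda>x. u x - v x)) z
    = difference_quotient (1/8) (weak_deriv \<Omega> bs u) z - difference_quotient (1/8) (weak_deriv \<Omega> bs v) z"
proof -
  interpret finite_measure "lebesgue_on \<Omega>" by (rule finite_measure_lebesgue_on_open_bounded[OF \<Omega> bdd])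
  interpret P: pair_sigma_finite "lebesgue_on \<Omega>" "lebesgue_on \<Omega>" ..
  note uv = sobolev_diff[OF \<Omega> u v]
  have mi: "bs \<in> multi_indices m" using bs directions_subset_multi_indices by auto
  have ae: "AE x in lebesgue_on \<Omega>. weak_deriv \<Omega> bs (\<lambda>x. u x - v x) x = weak_deriv \<Omega> bs u x - weak_deriv \<Omega> bs v x"
    by (rule has_weak_deriv_unique[OF weak_deriv_in_L2(1)[OF \<Omega> uv mi]
          has_weak_deriv_diff[OF weak_deriv_in_L2(1)[OF \<Omega> u mi] weak_deriv_in_L2(1)[OF \<Omega> v mi] multi_indicesD[OF mi] \<Omega>] multi_indicesD[OF mi] \<Omega>])
  note m = measurable_difference_quotient[OF weak_deriv_measurable[OF u bs]] measurable_difference_quotient[OF weak_deriv_measurable[OF v bs]]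
     measurable_difference_quotient[OF weak_deriv_measurable[OF uv bs]]
  show ?thesis
  proof (rule P.AE_pair_measure)
    show "{z \<in> space \<Omega>2. difference_quotient (1/8) (weak_deriv \<Omega> bs (\<lambda>x. u x - v x)) z
      = difference_quotient (1/8) (weak_deriv \<Omega> bs u) z - difference_quotient (1/8) (weak_deriv \<Omega> bs v) z} \<in> sets \<Omega>2"
      by (rule borel_measurable_eq[OF m(3) borel_measurable_diff[OF m(1,2)]])
    show "AE x in lebesgue_on \<Omega>. AE y in lebesgue_on \<Omega>. difference_quotient (1/8) (weak_deriv \<Omega> bs (\<lambda>x. u x - v x)) (x, y)
      = difference_quotient (1/8) (weak_deriv \<Omega> bs u) (x, y) - difference_quotient (1/8) (weak_deriv \<Omega> bs v) (x, y)"
      using ae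
    proof eventually_elim
      case (elim x)
      show ?case using ae by eventually_elim (simp add: difference_quotient_def elim diff_divide_distrib)
    qed
  qed
qed

lemma frac_sobolev_norm_triangle:
  assumes u: "u \<in> frac_sobolev \<Omega> frac_order" and v: "v \<in> frac_sobolev \<Omega> frac_order"
  shows "\<bar>frac_sobolev_norm \<Omega> frac_order u - frac_sobolev_norm \<Omega> frac_order v\<bar> \<le> frac_sobolev_norm \<Omega> frac_order (\<lambda>x. u x - v x)"
proof -
  have us: "u \<in> sobolev \<Omega> m" and vs: "v \<in> sobolev \<Omega> m" using u v by (auto simp: frac_sobolev_iff)
  let ?a = "\<lambda>u. L2_set (\<lambda>bs. l2norm lborel (wderiv \<Omega> bs u)) (multi_indices m)"
  let ?q = "\<lambda>u bs. difference_quotient (1/8) (weak_deriv \<Omega> bs u)"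
  let ?b = "\<lambda>u. L2_set (\<lambda>bs. l2norm \<Omega>2 (?q u bs)) (directions m)"
  note uv = sobolev_diff[OF \<Omega> us vs]
  note e = frac_sobolev_norm_eq
  have q: "square_integrable \<Omega>2 (?q u bs)" "square_integrable \<Omega>2 (?q v bs)" if "bs \<in> directions m" for bs
    using u v that by (auto simp: frac_sobolev_iff)
  have n: "l2norm \<Omega>2 (?q (\<lambda>x. u x - v x) bs) = l2norm \<Omega>2 (\<lambda>z. ?q u bs z - ?q v bs z)" if bs: "bs \<in> directions m" for bs
    using difference_quotient_weak_deriv_diff[OF us vs bs] square_integrableD(1)[OF q(1)[OF bs]] square_integrableD(1)[OF q(2)[OF bs]]
      measurable_difference_quotient[OF weak_deriv_measurable[OF uv bs]]
    by (intro l2norm_cong_AE) auto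
  have tri: "x \<le> y + z \<Longrightarrow> 0 \<le> x \<Longrightarrow> x' \<le> y' + z' \<Longrightarrow> 0 \<le> x' \<Longrightarrow> sqrt (x\<^sup>2 + x'\<^sup>2) \<le> sqrt (y\<^sup>2 + y'\<^sup>2) + sqrt (z\<^sup>2 + z'\<^sup>2)" for x y z x' y' z' :: real
  proof -
    assume "x \<le> y + z" "0 \<le> x" "x' \<le> y' + z'" "0 \<le> x'"
    then have "sqrt (x\<^sup>2 + x'\<^sup>2) \<le> sqrt ((y + z)\<^sup>2 + (y' + z')\<^sup>2)"
      by (intro real_sqrt_le_mono add_mono power_mono) auto
    also have "\<dots> \<le> sqrt (y\<^sup>2 + y'\<^sup>2) + sqrt (z\<^sup>2 + z'\<^sup>2)" by (rule real_sqrt_sum_squares_triangle_ineq)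
    finally show ?thesis .
  qed
  have a1: "?a u \<le> ?a v + ?a (\<lambda>x. u x - v x)"
  proof -
    have "?a u \<le> L2_set (\<lambda>bs. l2norm lborel (wderiv \<Omega> bs v) + l2norm lborel (wderiv \<Omega> bs (\<lambda>x. u x - v x))) (multi_indices m)"
    proof (rule L2_set_mono)
      fix bs :: "(real^2) list" assume bs: "bs \<in> multi_indices m"
      show "l2norm lborel (wderiv \<Omega> bs u) \<le> l2norm lborel (wderiv \<Omega> bs v) + l2norm lborel (wderiv \<Omega> bs (\<lambda>x. u x - v x))"
        unfolding l2norm_wderiv_diff[OF \<Omega> us vs bs]
        using l2norm_triangle[OF wderiv(4)[OF \<Omega> vs bs] square_integrable_diff[OF wderiv(4)[OF \<Omega> us bs] wderiv(4)[OF \<Omega> vs bs]]] by simp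
    qed simp
    also have "\<dots> \<le> ?a v + ?a (\<lambda>x. u x - v x)" by (rule L2_set_triangle_ineq)
    finally show ?thesis .
  qed
  have a2: "?a v \<le> ?a u + ?a (\<lambda>x. u x - v x)"
  proof -
    have "?a v \<le> L2_set (\<lambda>bs. l2norm lborel (wderiv \<Omega> bs u) + l2norm lborel (wderiv \<Omega> bs (\<lambda>x. u x - v x))) (multi_indices m)"
    proof (rule L2_set_mono)
      fix bs :: "(real^2) list" assume bs: "bs \<in> multi_indices m"
      show "l2norm lborel (wderiv \<Omega> bs v) \<le> l2norm lborel (wderiv \<Omega> bs u) + l2norm lborel (wderiv \<Omega> bs (\<lambda>x. u x - v x))"
        unfolding l2norm_wderiv_diff[OF \<Omega> us vs bs]
        using l2norm_diff_le[OF wderiv(4)[OF \<Omega> us bs] square_integrable_diff[OF wderiv(4)[OF \<Omega> us bs] wderiv(4)[OF \<Omega> vs bs]]] by simp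
    qed simp
    also have "\<dots> \<le> ?a u + ?a (\<lambda>x. u x - v x)" by (rule L2_set_triangle_ineq)
    finally show ?thesis .
  qed
  have b1: "?b u \<le> ?b v + ?b (\<lambda>x. u x - v x)"
  proof -
    have "?b u \<le> L2_set (\<lambda>bs. l2norm \<Omega>2 (?q v bs) + l2norm \<Omega>2 (?q (\<lambda>x. u x - v x) bs)) (directions m)"
    proof (rule L2_set_mono)
      fix bs :: "(real^2) list" assume bs: "bs \<in> directions m"
      show "l2norm \<Omega>2 (?q u bs) \<le> l2norm \<Omega>2 (?q v bs) + l2norm \<Omega>2 (?q (\<lambda>x. u x - v x) bs)"
        unfolding n[OF bs] using l2norm_triangle[OF q(2)[OF bs] square_integrable_diff[OF q[OF bs]]] by simp
    qed simp
    also have "\<dots> \<le> ?b v + ?b (\<lambda>x. u x - v x)" by (rule L2_set_triangle_ineq)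
    finally show ?thesis .
  qed
  have b2: "?b v \<le> ?b u + ?b (\<lambda>x. u x - v x)"
  proof -
    have "?b v \<le> L2_set (\<lambda>bs. l2norm \<Omega>2 (?q u bs) + l2norm \<Omega>2 (?q (\<lambda>x. u x - v x) bs)) (directions m)"
    proof (rule L2_set_mono)
      fix bs :: "(real^2) list" assume bs: "bs \<in> directions m"
      show "l2norm \<Omega>2 (?q v bs) \<le> l2norm \<Omega>2 (?q u bs) + l2norm \<Omega>2 (?q (\<lambda>x. u x - v x) bs)"
        unfolding n[OF bs] using l2norm_diff_le[OF q(1)[OF bs] square_integrable_diff[OF q[OF bs]]] by simp
    qed simp
    also have "\<dots> \<le> ?b u + ?b (\<lambda>x. u x - v x)" by (rule L2_set_triangle_ineq)
    finally show ?thesis .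
  qed
  show ?thesis
    using tri[OF a1 _ b1] tri[OF a2 _ b2]
    unfolding e sobolev_norm_eq[OF \<Omega> us] sobolev_norm_eq[OF \<Omega> vs] sobolev_norm_eq[OF \<Omega> uv] by simp
qed

lemma zero_frac_sobolev: "(\<lambda>x. 0) \<in> frac_sobolev \<Omega> frac_order"
  unfolding frac_sobolev_iff
proof (intro conjI ballI)
  show z: "(\<lambda>x. 0) \<in> sobolev \<Omega> m" by (rule sobolev0_sobolev[OF \<Omega> zero_sobolev0[OF \<Omega>]])
  fix bs :: "(real^2) list" assume bs: "bs \<in> directions m"
  from difference_quotient_weak_deriv_diff[OF z z bs]
  have "AE z in \<Omega>2. \<bar>difference_quotient (1/8) (weak_deriv \<Omega> bs (\<lambda>x. 0)) z\<bar> \<le> \<bar>0\<bar>" by simp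
  then show "square_integrable \<Omega>2 (difference_quotient (1/8) (weak_deriv \<Omega> bs (\<lambda>x. 0)))"
    by (rule square_integrable_dominated(1)[OF square_integrable_zero measurable_difference_quotient[OF weak_deriv_measurable[OF z bs]]])
qed

text \<open>The translation estimate enters \<open>Slobodeckij_bound\<close> with \<open>A = C \<kappa>\<^sup>2\<close>, which makes the squared seminorm of order
  \<open>\<parallel>u\<parallel>\<^sub>V \<kappa>\<close>; the derivatives of order at most \<open>m\<close> obey the same bound by Poincare's inequality. For fixed \<open>\<kappa>\<close>
  the bound tends to zero with \<open>\<parallel>u\<parallel>\<^sub>V\<close>.\<close>

lemma fractional_regularity:
  assumes m: "m \<ge> 1" and lip: "lipschitz_boundary \<Omega>"
  shows "\<exists>C\<ge>0. \<forall>\<kappa> G u. weak_eq \<Omega> m \<kappa> G u \<longrightarrow> u \<in> frac_sobolev \<Omega> frac_order \<and>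
    (frac_sobolev_norm \<Omega> frac_order u)\<^sup>2 \<le> C * V_norm \<Omega> m u * \<kappa>"
proof -
  obtain C where C: "C \<ge> 0" and est: "\<And>h \<kappa> G u bs. weak_eq \<Omega> m \<kappa> G u \<Longrightarrow> bs\<in>directions m \<Longrightarrow>
    (l2norm lborel (\<lambda>x. wderiv \<Omega> bs u (x + h) - wderiv \<Omega> bs u x))\<^sup>2 \<le> C * norm h * \<kappa>\<^sup>2"
    using translation_estimate[OF \<Omega> bdd m lip] by blast
  obtain P where P: "P > 0" "\<And>u bs. u \<in> sobolev0 \<Omega> m \<Longrightarrow> bs \<in> multi_indices m \<Longrightarrow> l2norm lborel (wderiv \<Omega> bs u) \<le> P * V_norm \<Omega> m u"
    using Poincare[OF \<Omega> bdd, of m] by blast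
  obtain R where R: "\<And>x y. x \<in> \<Omega> \<Longrightarrow> y \<in> \<Omega> \<Longrightarrow> dist x y \<le> R" "R \<ge> 0"
    using bdd unfolding bounded_two_points by (metis dist_self linear order_trans)
  define I where "I = (\<integral>\<^sup>+ h. ennreal (indicator (cball 0 R) h * norm (h :: real^2) powr (- (7/4))) \<partial>lborel)"
  have If: "I < \<infinity>" unfolding I_def by (rule nn_integral_norm_powr_finite[OF R(2)])
  define J where "J = enn2real I"
  have J: "J \<ge> 0" "I = ennreal J" using If by (auto simp: J_def)
  define N where "N = real (card (multi_indices m :: (real^2) list set))"
  define N' where "N' = real (card (directions m :: (real^2) list set))"
  define K where "K = N * P\<^sup>2 + N' * (2 * sqrt C * J)"
  show ?thesis
  proof (rule exI[of _ K], intro conjI allI impI)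
    show "0 \<le> K" using C J by (simp add: K_def N_def N'_def)
    fix \<kappa> G u assume w: "weak_eq \<Omega> m \<kappa> G u"
    have u0: "u \<in> sobolev0 \<Omega> m" using w by (simp add: weak_eq_def)
    note us = sobolev0_sobolev[OF \<Omega> u0]
    define V where "V = V_norm \<Omega> m u"
    have V: "0 \<le> V" by (simp add: V_def V_norm_nonneg[OF \<Omega>])
    have V\<kappa>: "V \<le> \<kappa>"
    proof -
      have "0 \<le> L2_norm \<Omega> G" by (simp add: L2_norm_eq)
      then show ?thesis using w unfolding weak_eq_def V_def by linarith
    qed
    have ker: "square_integrable \<Omega>2 (difference_quotient (1/8) (weak_deriv \<Omega> bs u))"
      "(l2norm \<Omega>2 (difference_quotient (1/8) (weak_deriv \<Omega> bs u)))\<^sup>2 \<le> 2 * sqrt C * J * (V * \<kappa>)" if bs: "bs \<in> directions m" for bs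
    proof -
      have mi: "bs \<in> multi_indices m" using bs directions_subset_multi_indices by auto
      let ?U = "wderiv \<Omega> bs u"
      let ?q = "difference_quotient (1/8) (weak_deriv \<Omega> bs u)"
      have A: "C * \<kappa>\<^sup>2 \<ge> 0" using C by simp
      have "(\<integral>\<^sup>+ z. ennreal (slobodeckij_kernel (1/8) (weak_deriv \<Omega> bs u) z) \<partial>\<Omega>2)
         \<le> (\<integral>\<^sup>+ x. \<integral>\<^sup>+ h. ennreal (indicator (cball 0 R) h * \<bar>?U x - ?U (x + h)\<bar>\<^sup>2 / norm h powr (9/4)) \<partial>lborel \<partial>lborel)"
        by (rule nn_integral_kernel_le[OF \<Omega> R(1) bdd wderiv(1)[OF \<Omega> us mi] weak_deriv_measurable[OF us bs] wderiv(3)[OF \<Omega> us mi]])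
      also have "\<dots> \<le> ennreal (2 * l2norm lborel ?U * sqrt (C * \<kappa>\<^sup>2)) * I"
        unfolding I_def using est[OF w bs]
        by (intro Slobodeckij_bound[OF wderiv(4)[OF \<Omega> us mi] A]) (simp add: algebra_simps)
      also have "\<dots> = ennreal (2 * l2norm lborel ?U * (sqrt C * \<kappa>) * J)"
        using V V\<kappa> C J by (simp add: real_sqrt_mult ennreal_mult)
      also have "\<dots> \<le> ennreal (2 * V * (sqrt C * \<kappa>) * J)"
        using l2norm_wderiv_le(2)[OF \<Omega> us bs] V V\<kappa> C J unfolding V_def[symmetric]
        by (intro ennreal_leI mult_right_mono mult_left_mono) auto
      finally have le: "(\<integral>\<^sup>+ z. ennreal ((?q z)\<^sup>2) \<partial>\<Omega>2) \<le> ennreal (2 * sqrt C * J * (V * \<kappa>))"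
        by (simp add: difference_quotient_sq algebra_simps)
      have i: "integrable \<Omega>2 (\<lambda>z. (?q z)\<^sup>2)"
        using measurable_difference_quotient[OF weak_deriv_measurable[OF us bs]] le
        by (intro integrableI_nonneg) (auto intro: le_less_trans)
      then show sq: "square_integrable \<Omega>2 ?q"
        using measurable_difference_quotient[OF weak_deriv_measurable[OF us bs]] by (simp add: square_integrable_def)
      have "0 \<le> 2 * sqrt C * J * (V * \<kappa>)" using V V\<kappa> C J by simp
      then show "(l2norm \<Omega>2 ?q)\<^sup>2 \<le> 2 * sqrt C * J * (V * \<kappa>)"
        using le nn_integral_square_eq[OF sq] by (simp add: ennreal_le_iff)
    qed
    then show "u \<in> frac_sobolev \<Omega> frac_order" using us by (simp add: frac_sobolev_iff)
    have "(frac_sobolev_norm \<Omega> frac_order u)\<^sup>2 = (\<Sum>bs\<in>multi_indices m. (l2norm lborel (wderiv \<Omega> bs u))\<^sup>2)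
      + (\<Sum>bs\<in>directions m. (l2norm \<Omega>2 (difference_quotient (1/8) (weak_deriv \<Omega> bs u)))\<^sup>2)"
      unfolding frac_sobolev_norm_eq sobolev_norm_eq[OF \<Omega> us] L2_set_def by (simp add: sum_nonneg)
    also have "\<dots> \<le> (\<Sum>bs\<in>(multi_indices m :: (real^2) list set). P\<^sup>2 * (V * \<kappa>)) + (\<Sum>bs\<in>(directions m :: (real^2) list set). 2 * sqrt C * J * (V * \<kappa>))"
    proof (intro add_mono sum_mono ker)
      fix bs :: "(real^2) list" assume bs: "bs \<in> multi_indices m"
      have "(l2norm lborel (wderiv \<Omega> bs u))\<^sup>2 \<le> (P * V)\<^sup>2"
        using P(2)[OF u0 bs] by (intro power_mono) (auto simp: V_def)
      also have "\<dots> = P\<^sup>2 * (V * V)" by (simp add: power2_eq_square)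
      also have "\<dots> \<le> P\<^sup>2 * (V * \<kappa>)" using V V\<kappa> by (intro mult_left_mono) auto
      finally show "(l2norm lborel (wderiv \<Omega> bs u))\<^sup>2 \<le> P\<^sup>2 * (V * \<kappa>)" .
    qed
    also have "\<dots> = K * V_norm \<Omega> m u * \<kappa>" by (simp add: K_def N_def N'_def V_def algebra_simps)
    finally show "(frac_sobolev_norm \<Omega> frac_order u)\<^sup>2 \<le> K * V_norm \<Omega> m u * \<kappa>" .
  qed
qed

end

section \<open>The cubic nonlinearity\<close>

text \<open>The fundamental theorem of calculus along the line through \<open>x\<close>, starting outside the support.\<close>

lemma test_le_nn_integral_along:
  fixes w :: "'a::euclidean_space \<Rightarrow> real"
  assumes w: "test w" and b: "b \<in> Basis"
  shows "ennreal \<bar>w x\<bar> \<le> (\<integral>\<^sup>+ s. ennreal \<bar>pd b w (x + s *\<^sub>R b)\<bar> \<partial>lborel)"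
proof -
  obtain R where R: "R > 0" "\<And>y. w y \<noteq> 0 \<Longrightarrow> norm y \<le> R"
    using testD(2)[OF w] bounded_pos by (metis (mono_tags, lifting) mem_Collect_eq)
  define T where "T = R + norm x + 1"
  have T0: "T > 0" using R(1) by (simp add: T_def add_pos_nonneg)
  have wT: "w (x + (- T) *\<^sub>R b) = 0"
  proof (rule ccontr)
    assume "w (x + (- T) *\<^sub>R b) \<noteq> 0"
    then have "norm (x + (- T) *\<^sub>R b) \<le> R" by (rule R(2))
    moreover have "norm ((- T) *\<^sub>R b) - norm x \<le> norm (x + (- T) *\<^sub>R b)"
      using norm_diff_ineq[of "(- T) *\<^sub>R b" x] by (simp add: add.commute)
    ultimately show False using b T0 by (simp add: T_def)
  qed
  let ?d = "\<lambda>s. pd b w (x + s *\<^sub>R b)"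
  have cont: "continuous_on {-T..0} ?d"
    by (rule continuous_on_compose2[OF smooth_continuous[OF smooth_pd[OF testD(1)[OF w] b], of UNIV]])
      (auto intro!: continuous_intros)
  have "(?d has_integral (w (x + 0 *\<^sub>R b) - w (x + (- T) *\<^sub>R b))) {-T..0}"
  proof (rule fundamental_theorem_of_calculus)
    show "((\<lambda>s. w (x + s *\<^sub>R b)) has_vector_derivative ?d s) (at s within {-T..0})" for s
      using derivative_along[OF testD(1)[OF w], of x b s]
      by (auto simp: pd_apply has_real_derivative_iff_has_vector_derivative intro: has_vector_derivative_at_within)
  qed (use T0 in simp)
  then have "w x = integral {-T..0} ?d" using wT by (simp add: integral_unique)
  then have "\<bar>w x\<bar> \<le> integral {-T..0} (\<lambda>s. \<bar>?d s\<bar>)"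
    using integral_norm_bound_integral[of ?d "{-T..0}" "\<lambda>s. \<bar>?d s\<bar>"] integrable_continuous_real[OF cont]
      integrable_continuous_real[OF continuous_on_rabs[OF cont]] by simp
  then have "ennreal \<bar>w x\<bar> \<le> ennreal (integral {-T..0} (\<lambda>s. \<bar>?d s\<bar>))" by (rule ennreal_leI)
  also have "\<dots> = (\<integral>\<^sup>+ s. ennreal (indicator {-T..0} s * \<bar>?d s\<bar>) \<partial>lborel)"
    by (rule nn_integral_has_integral_lebesgue[symmetric])
      (auto intro!: integrable_integral integrable_continuous_real continuous_on_rabs cont)
  also have "\<dots> \<le> (\<integral>\<^sup>+ s. ennreal \<bar>?d s\<bar> \<partial>lborel)"
    by (intro nn_integral_mono) (auto simp: indicator_def)
  finally show ?thesis .
qed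

text \<open>Integration over lines. Weight the integrand with the indicator of \<open>x\<^sub>b \<in> [0, 1]\<close>, whose
  integral is \<open>1\<close>, so that the product formula for Lebesgue measure over the basis applies; then exchange
  the integrals over \<open>x\<close> and over the shift \<open>s\<close> and translate.\<close>

lemma nn_integral_slices:
  fixes f :: "real^2 \<Rightarrow> ennreal"
  assumes f: "f \<in> borel_measurable borel" and B: "Basis = {b, c}" "b \<noteq> c"
  shows "(\<integral>\<^sup>+ t. (\<integral>\<^sup>+ s. f (s *\<^sub>R b + t *\<^sub>R c) \<partial>lborel) \<partial>lborel) = (\<integral>\<^sup>+ x. f x \<partial>lborel)"
proof -
  note [measurable] = f
  define g where "g = (\<lambda>t. \<integral>\<^sup>+ s. f (s *\<^sub>R b + t *\<^sub>R c) \<partial>lborel)"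
  have [measurable]: "g \<in> borel_measurable borel" unfolding g_def by measurable
  have rep: "x = (x \<bullet> b) *\<^sub>R b + (x \<bullet> c) *\<^sub>R c" for x :: "real^2"
  proof -
    have "(\<Sum>d\<in>{b, c}. (x \<bullet> d) *\<^sub>R d) = x" unfolding B(1)[symmetric] by (rule euclidean_representation)
    then show ?thesis using B(2) by (simp only: sum.insert_if finite.intros sum.empty) simp
  qed
  have bb: "b \<bullet> b = 1" using B by (metis inner_same_Basis insertI1)
  define F where "F = (\<lambda>d. if d = b then indicator {0..1} else g)"
  have "(\<integral>\<^sup>+ t. g t \<partial>lborel) = (\<Prod>d\<in>(Basis :: (real^2) set). (\<integral>\<^sup>+ t. F d t \<partial>lborel))"
    using B(2) by (simp add: B(1) F_def)
  also have "\<dots> = (\<integral>\<^sup>+ x. (\<Prod>d\<in>(Basis :: (real^2) set). F d (x \<bullet> d)) \<partial>lborel)"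
    by (rule nn_integral_lborel_prod[symmetric]) (auto simp: F_def)
  also have "\<dots> = (\<integral>\<^sup>+ x. (\<integral>\<^sup>+ s. indicator {0..1} (x \<bullet> b) * f (x + s *\<^sub>R b) \<partial>lborel) \<partial>lborel)"
  proof (rule nn_integral_cong)
    fix x :: "real^2"
    have "g (x \<bullet> c) = (\<integral>\<^sup>+ s. f (((x \<bullet> b) + s) *\<^sub>R b + (x \<bullet> c) *\<^sub>R c) \<partial>lborel)"
      unfolding g_def by (rule nn_integral_lborel_translate[symmetric]) measurable
    also have "\<dots> = (\<integral>\<^sup>+ s. f (x + s *\<^sub>R b) \<partial>lborel)"
      by (subst (3) rep) (simp add: scaleR_add_left ac_simps)
    finally show "(\<Prod>d\<in>(Basis :: (real^2) set). F d (x \<bullet> d)) = (\<integral>\<^sup>+ s. indicator {0..1} (x \<bullet> b) * f (x + s *\<^sub>R b) \<partial>lborel)"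
      using B(2) by (simp add: B(1) F_def nn_integral_cmult)
  qed
  also have "\<dots> = (\<integral>\<^sup>+ s. (\<integral>\<^sup>+ x. indicator {0..1} (x \<bullet> b) * f (x + s *\<^sub>R b) \<partial>lborel) \<partial>lborel)"
    by (rule lborel_pair.Fubini'[symmetric]) measurable
  also have "\<dots> = (\<integral>\<^sup>+ s. (\<integral>\<^sup>+ x. indicator {0..1} (x \<bullet> b - s) * f x \<partial>lborel) \<partial>lborel)"
  proof (rule nn_integral_cong)
    fix s :: real
    have "(\<integral>\<^sup>+ x. indicator {0..1} ((s *\<^sub>R b + x) \<bullet> b - s) * f (s *\<^sub>R b + x) \<partial>lborel) = (\<integral>\<^sup>+ x. indicator {0..1} (x \<bullet> b - s) * f x \<partial>lborel)"
      by (rule nn_integral_lborel_translate) measurable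
    then show "(\<integral>\<^sup>+ x. indicator {0..1} (x \<bullet> b) * f (x + s *\<^sub>R b) \<partial>lborel) = (\<integral>\<^sup>+ x. indicator {0..1} (x \<bullet> b - s) * f x \<partial>lborel)"
      by (simp add: inner_add_left bb add.commute)
  qed
  also have "\<dots> = (\<integral>\<^sup>+ x. (\<integral>\<^sup>+ s. indicator {0..1} (x \<bullet> b - s) * f x \<partial>lborel) \<partial>lborel)"
    by (rule lborel_pair.Fubini') measurable
  also have "\<dots> = (\<integral>\<^sup>+ x. f x \<partial>lborel)"
  proof (rule nn_integral_cong)
    fix x :: "real^2"
    have "(\<integral>\<^sup>+ s. indicator {0..1} (x \<bullet> b - s) * f x \<partial>lborel) = (\<integral>\<^sup>+ s. indicator {x \<bullet> b - 1..x \<bullet> b} s * f x \<partial>lborel)"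
      by (intro nn_integral_cong) (auto simp: indicator_def)
    also have "\<dots> = f x" by (simp add: nn_integral_multc)
    finally show "(\<integral>\<^sup>+ s. indicator {0..1} (x \<bullet> b - s) * f x \<partial>lborel) = f x" .
  qed
  finally show ?thesis by (simp add: g_def)
qed

text \<open>The value \<open>|w(x)|\<close> is at most an integral along either axis, and the product of the two bounds is a
  function of \<open>x\<^sub>c\<close> times a function of \<open>x\<^sub>b\<close>.\<close>

lemma Gagliardo:
  fixes w :: "real^2 \<Rightarrow> real"
  assumes w: "test w" and B: "Basis = {b, c}" "b \<noteq> c"
  shows "(\<integral>x. (w x)\<^sup>2 \<partial>lborel) \<le> (\<integral>x. \<bar>pd b w x\<bar> \<partial>lborel) * (\<integral>x. \<bar>pd c w x\<bar> \<partial>lborel)"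
proof -
  have bB: "b \<in> Basis" and cB: "c \<in> Basis" using B by auto
  have B': "Basis = {c, b}" using B(1) by auto
  note [measurable] = test_measurable[OF test_pd[OF w bB]] test_measurable[OF test_pd[OF w cB]]
  have rep: "x = (x \<bullet> b) *\<^sub>R b + (x \<bullet> c) *\<^sub>R c" for x :: "real^2"
  proof -
    have "(\<Sum>d\<in>{b, c}. (x \<bullet> d) *\<^sub>R d) = x" unfolding B(1)[symmetric] by (rule euclidean_representation)
    then show ?thesis using B(2) by (simp only: sum.insert_if finite.intros sum.empty) simp
  qed
  define g where "g = (\<lambda>t. \<integral>\<^sup>+ s. ennreal \<bar>pd b w (s *\<^sub>R b + t *\<^sub>R c)\<bar> \<partial>lborel)"
  define k where "k = (\<lambda>t. \<integral>\<^sup>+ s. ennreal \<bar>pd c w (s *\<^sub>R c + t *\<^sub>R b)\<bar> \<partial>lborel)"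
  have [measurable]: "g \<in> borel_measurable borel" "k \<in> borel_measurable borel" unfolding g_def k_def by measurable
  have le1: "ennreal \<bar>w x\<bar> \<le> g (x \<bullet> c)" for x
  proof -
    have "ennreal \<bar>w x\<bar> \<le> (\<integral>\<^sup>+ s. ennreal \<bar>pd b w (x + s *\<^sub>R b)\<bar> \<partial>lborel)" by (rule test_le_nn_integral_along[OF w bB])
    also have "\<dots> = (\<integral>\<^sup>+ s. ennreal \<bar>pd b w ((x \<bullet> b + s) *\<^sub>R b + (x \<bullet> c) *\<^sub>R c)\<bar> \<partial>lborel)"
      by (subst (1) rep) (simp add: scaleR_add_left ac_simps)
    also have "\<dots> = g (x \<bullet> c)" unfolding g_def by (rule nn_integral_lborel_translate) measurable
    finally show ?thesis .
  qed
  have le2: "ennreal \<bar>w x\<bar> \<le> k (x \<bullet> b)" for x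
  proof -
    have "ennreal \<bar>w x\<bar> \<le> (\<integral>\<^sup>+ s. ennreal \<bar>pd c w (x + s *\<^sub>R c)\<bar> \<partial>lborel)" by (rule test_le_nn_integral_along[OF w cB])
    also have "\<dots> = (\<integral>\<^sup>+ s. ennreal \<bar>pd c w ((x \<bullet> c + s) *\<^sub>R c + (x \<bullet> b) *\<^sub>R b)\<bar> \<partial>lborel)"
      by (subst (1) rep) (simp add: scaleR_add_left ac_simps)
    also have "\<dots> = k (x \<bullet> b)" unfolding k_def by (rule nn_integral_lborel_translate) measurable
    finally show ?thesis .
  qed
  \<comment> \<open>The factor bounding \<open>w\<close> by lines along \<open>b\<close> depends on the other coordinate only, and vice versa.\<close>
  define F where "F = (\<lambda>d. if d = b then k else g)"
  have "(\<integral>\<^sup>+ x. ennreal ((w x)\<^sup>2) \<partial>lborel) \<le> (\<integral>\<^sup>+ x. (\<Prod>d\<in>(Basis :: (real^2) set). F d (x \<bullet> d)) \<partial>lborel)"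
  proof (rule nn_integral_mono)
    fix x :: "real^2"
    have "ennreal ((w x)\<^sup>2) = ennreal \<bar>w x\<bar> * ennreal \<bar>w x\<bar>" by (simp add: ennreal_mult[symmetric] power2_eq_square)
    also have "\<dots> \<le> k (x \<bullet> b) * g (x \<bullet> c)" by (rule mult_mono[OF le2 le1]) auto
    also have "\<dots> = (\<Prod>d\<in>(Basis :: (real^2) set). F d (x \<bullet> d))" using B(2) by (simp add: B(1) F_def)
    finally show "ennreal ((w x)\<^sup>2) \<le> (\<Prod>d\<in>(Basis :: (real^2) set). F d (x \<bullet> d))" .
  qed
  also have "\<dots> = (\<Prod>d\<in>(Basis :: (real^2) set). (\<integral>\<^sup>+ t. F d t \<partial>lborel))"
    by (rule nn_integral_lborel_prod) (auto simp: F_def)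
  also have "\<dots> = (\<integral>\<^sup>+ t. k t \<partial>lborel) * (\<integral>\<^sup>+ t. g t \<partial>lborel)"
    using B(2) by (simp add: B(1) F_def)
  also have "(\<integral>\<^sup>+ t. g t \<partial>lborel) = (\<integral>\<^sup>+ x. ennreal \<bar>pd b w x\<bar> \<partial>lborel)"
    unfolding g_def by (rule nn_integral_slices[OF _ B]) measurable
  also have "(\<integral>\<^sup>+ t. k t \<partial>lborel) = (\<integral>\<^sup>+ x. ennreal \<bar>pd c w x\<bar> \<partial>lborel)"
    unfolding k_def using B(2) by (intro nn_integral_slices[OF _ B']) auto
  also have "(\<integral>\<^sup>+ x. ennreal \<bar>pd c w x\<bar> \<partial>lborel) = ennreal (\<integral>x. \<bar>pd c w x\<bar> \<partial>lborel)"
    using test_integrable[OF test_pd[OF w cB]] by (intro nn_integral_eq_integral) auto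
  also have "(\<integral>\<^sup>+ x. ennreal \<bar>pd b w x\<bar> \<partial>lborel) = ennreal (\<integral>x. \<bar>pd b w x\<bar> \<partial>lborel)"
    using test_integrable[OF test_pd[OF w bB]] by (intro nn_integral_eq_integral) auto
  finally have "(\<integral>\<^sup>+ x. ennreal ((w x)\<^sup>2) \<partial>lborel) \<le> ennreal ((\<integral>x. \<bar>pd b w x\<bar> \<partial>lborel) * (\<integral>x. \<bar>pd c w x\<bar> \<partial>lborel))"
    by (simp add: ennreal_mult[symmetric] mult.commute)
  moreover have "(\<integral>\<^sup>+ x. ennreal ((w x)\<^sup>2) \<partial>lborel) = ennreal (\<integral>x. (w x)\<^sup>2 \<partial>lborel)"
    using square_integrableD(2)[OF test_square_integrable[OF w]] by (intro nn_integral_eq_integral) auto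
  ultimately show ?thesis by (simp add: ennreal_le_iff)
qed

lemma integral_abs_mult_le:
  assumes "square_integrable M f" "square_integrable M g"
  shows "(\<integral>x. \<bar>f x * g x\<bar> \<partial>M) \<le> l2norm M f * l2norm M g"
  using Cauchy_Schwarz_l2norm[OF square_integrable_abs[OF assms(1)] square_integrable_abs[OF assms(2)]]
  by (simp add: l2norm_abs abs_mult)

text \<open>Apply the previous inequality to \<open>\<psi>\<^sup>2\<close> for the fourth moment, then to \<open>\<psi>\<^sup>3\<close>.\<close>

lemma sixth_moment_le:
  fixes \<psi> :: "real^2 \<Rightarrow> real"
  assumes \<psi>: "test \<psi>" and B: "Basis = {b, c}" "b \<noteq> c"
  shows "(\<integral>x. (\<psi> x) ^ 6 \<partial>lborel) \<le> 36 * (l2norm lborel \<psi> * l2norm lborel (pd b \<psi>) * l2norm lborel (pd c \<psi>))\<^sup>2"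
proof -
  have bB: "b \<in> Basis" and cB: "c \<in> Basis" using B by auto
  define n where "n = l2norm lborel \<psi>"
  define p where "p = l2norm lborel (pd b \<psi>)"
  define q where "q = l2norm lborel (pd c \<psi>)"
  have [simp]: "n \<ge> 0" "p \<ge> 0" "q \<ge> 0" by (simp_all add: n_def p_def q_def)
  note D = smooth_differentiable[OF testD(1)[OF \<psi>]]
  have t2: "test (\<lambda>x. \<psi> x * \<psi> x)" by (intro test_mult1 \<psi> testD)
  have t3: "test (\<lambda>x. \<psi> x * \<psi> x * \<psi> x)" by (intro test_mult1 \<psi> testD)
  have d2: "pd d (\<lambda>x. \<psi> x * \<psi> x) = (\<lambda>x. 2 * (\<psi> x * pd d \<psi> x))" for d
    by (intro ext) (simp add: pd_mult[OF D D])
  have d3: "pd d (\<lambda>x. \<psi> x * \<psi> x * \<psi> x) = (\<lambda>x. 3 * ((\<psi> x * \<psi> x) * pd d \<psi> x))" for d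
    by (intro ext) (simp add: pd_mult[OF smooth_differentiable[OF testD(1)[OF t2]] D] d2)
  have i2: "(\<integral>x. \<bar>pd d (\<lambda>x. \<psi> x * \<psi> x) x\<bar> \<partial>lborel) \<le> 2 * (n * l2norm lborel (pd d \<psi>))" if "d \<in> Basis" for d
    unfolding d2 abs_mult[of 2] n_def using integral_abs_mult_le[OF test_square_integrable[OF \<psi>] test_square_integrable[OF test_pd[OF \<psi> that]]]
    by simp
  have i3: "(\<integral>x. \<bar>pd d (\<lambda>x. \<psi> x * \<psi> x * \<psi> x) x\<bar> \<partial>lborel) \<le> 3 * (l2norm lborel (\<lambda>x. \<psi> x * \<psi> x) * l2norm lborel (pd d \<psi>))" if "d \<in> Basis" for d
    unfolding d3 abs_mult[of 3] using integral_abs_mult_le[OF test_square_integrable[OF t2] test_square_integrable[OF test_pd[OF \<psi> that]]]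
    by simp
  have "(l2norm lborel (\<lambda>x. \<psi> x * \<psi> x))\<^sup>2 \<le> (\<integral>x. \<bar>pd b (\<lambda>x. \<psi> x * \<psi> x) x\<bar> \<partial>lborel) * (\<integral>x. \<bar>pd c (\<lambda>x. \<psi> x * \<psi> x) x\<bar> \<partial>lborel)"
    unfolding l2norm_sq by (rule Gagliardo[OF t2 B])
  also have "\<dots> \<le> (2 * (n * p)) * (2 * (n * q))"
    using i2[OF bB] i2[OF cB] unfolding p_def[symmetric] q_def[symmetric] by (intro mult_mono) auto
  finally have four: "(l2norm lborel (\<lambda>x. \<psi> x * \<psi> x))\<^sup>2 \<le> 4 * n\<^sup>2 * p * q" by (simp add: power2_eq_square algebra_simps)
  have "(\<integral>x. (\<psi> x) ^ 6 \<partial>lborel) = (\<integral>x. (\<psi> x * \<psi> x * \<psi> x)\<^sup>2 \<partial>lborel)"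
    by (intro Bochner_Integration.integral_cong refl) (simp add: eval_nat_numeral algebra_simps)
  also have "\<dots> \<le> (\<integral>x. \<bar>pd b (\<lambda>x. \<psi> x * \<psi> x * \<psi> x) x\<bar> \<partial>lborel) * (\<integral>x. \<bar>pd c (\<lambda>x. \<psi> x * \<psi> x * \<psi> x) x\<bar> \<partial>lborel)"
    by (rule Gagliardo[OF t3 B])
  also have "\<dots> \<le> (3 * (l2norm lborel (\<lambda>x. \<psi> x * \<psi> x) * p)) * (3 * (l2norm lborel (\<lambda>x. \<psi> x * \<psi> x) * q))"
    using i3[OF bB] i3[OF cB] unfolding p_def[symmetric] q_def[symmetric] by (intro mult_mono) auto
  also have "\<dots> = 9 * p * q * (l2norm lborel (\<lambda>x. \<psi> x * \<psi> x))\<^sup>2" by (simp add: power2_eq_square algebra_simps)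
  also have "\<dots> \<le> 9 * p * q * (4 * n\<^sup>2 * p * q)" by (intro mult_left_mono four) auto
  also have "\<dots> = 36 * (n * p * q)\<^sup>2" by (simp add: power2_eq_square algebra_simps)
  finally show ?thesis by (simp add: n_def p_def q_def)
qed

lemma Basis_real2: obtains b c :: "real^2" where "Basis = {b, c}" "b \<noteq> c"
proof -
  have "card (Basis :: (real^2) set) = 2" by simp
  then have "\<exists>b c :: real^2. Basis = {b, c} \<and> b \<noteq> c" by (simp only: card_2_iff)
  then show ?thesis using that by blast
qed

text \<open>The bound on test functions passes to the limit by Fatou's lemma, along a subsequence that
  converges almost everywhere.\<close>

lemma cube_in_L2:
  fixes \<Omega> :: "(real^2) set"
  assumes \<Omega>: "open \<Omega>" and bdd: "bounded \<Omega>" and m: "m \<ge> 1"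
  shows "\<exists>C\<ge>0. \<forall>u\<in>sobolev0 \<Omega> m. (\<lambda>x. (u x) ^ 3) \<in> L2 \<Omega> \<and> L2_norm \<Omega> (\<lambda>x. (u x) ^ 3) \<le> C * (V_norm \<Omega> m u) ^ 3"
proof -
  obtain P where P: "P > 0" "\<And>u bs. u \<in> sobolev0 \<Omega> m \<Longrightarrow> bs \<in> multi_indices m \<Longrightarrow> l2norm lborel (wderiv \<Omega> bs u) \<le> P * V_norm \<Omega> m u"
    using Poincare[OF \<Omega> bdd, of m] by blast
  obtain b c :: "real^2" where B: "Basis = {b, c}" "b \<noteq> c" by (rule Basis_real2)
  have mi: "[] \<in> multi_indices m" "[b] \<in> multi_indices m" "[c] \<in> multi_indices m"
    using m B by (auto simp: multi_indices_def)
  show ?thesis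
  proof (rule exI[of _ "6 * P ^ 3"], intro conjI ballI)
    show "0 \<le> 6 * P ^ 3" using P(1) by simp
    fix u assume u: "u \<in> sobolev0 \<Omega> m"
    note us = sobolev0_sobolev[OF \<Omega> u]
    define V where "V = V_norm \<Omega> m u"
    have V: "V \<ge> 0" by (simp add: V_def V_norm_nonneg[OF \<Omega>])
    define U where "U = wderiv \<Omega> [] u"
    note Um = wderiv[OF \<Omega> us mi(1), folded U_def]
    obtain p where p: "\<And>n. test_function \<Omega> (p n)"
      "\<And>bs. bs \<in> multi_indices m \<Longrightarrow> (\<lambda>n. l2norm lborel (\<lambda>x. wderiv \<Omega> bs u x - partial_deriv (rev bs) (p n) x)) \<longlonglongrightarrow> 0"
      using sobolev0_approx[OF \<Omega> u] by blast
    define a where "a = (\<lambda>n. 36 * (l2norm lborel (p n) * l2norm lborel (pd b (p n)) * l2norm lborel (pd c (p n)))\<^sup>2)"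
    have sixth: "(\<integral>x. (p n x) ^ 6 \<partial>lborel) \<le> a n" for n
      unfolding a_def by (rule sixth_moment_le[OF test_function_test[OF p(1)] B])
    have lim: "a \<longlonglongrightarrow> 36 * (l2norm lborel U * l2norm lborel (wderiv \<Omega> [b] u) * l2norm lborel (wderiv \<Omega> [c] u))\<^sup>2"
      unfolding a_def U_def
      using tendsto_wderiv_norm[OF \<Omega> us p(1) mi(1) p(2)[OF mi(1)]] tendsto_wderiv_norm[OF \<Omega> us p(1) mi(2) p(2)[OF mi(2)]]
        tendsto_wderiv_norm[OF \<Omega> us p(1) mi(3) p(2)[OF mi(3)]]
      by (intro tendsto_intros) simp_all
    define L where "L = 36 * (l2norm lborel U * l2norm lborel (wderiv \<Omega> [b] u) * l2norm lborel (wderiv \<Omega> [c] u))\<^sup>2"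
    have LV: "L \<le> 36 * ((P * V) * (P * V) * (P * V))\<^sup>2"
      unfolding L_def U_def V_def using P(1) V
      by (intro mult_left_mono power_mono mult_mono P(2)[OF u] mi) (auto simp: V_def)
    have "(\<lambda>n. \<integral>x. norm ((U x - p n x)\<^sup>2) \<partial>lborel) \<longlonglongrightarrow> 0"
      using tendsto_power[OF p(2)[OF mi(1)], of 2] unfolding l2norm_sq U_def[symmetric] by simp
    moreover have sqd: "square_integrable lborel (\<lambda>x. U x - p n x)" for n
      by (intro square_integrable_diff Um(4) test_square_integrable test_function_test[OF p(1)])
    ultimately obtain r where r: "strict_mono r" "AE x in lborel. (\<lambda>n. (U x - p (r n) x)\<^sup>2) \<longlonglongrightarrow> 0"
      using tendsto_L1_AE_subseq[of lborel "\<lambda>n x. (U x - p n x)\<^sup>2"] square_integrableD(2)[OF sqd] by blast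
    have ae: "AE x in lborel. (\<lambda>n. p (r n) x) \<longlonglongrightarrow> U x"
      using r(2)
    proof eventually_elim
      case (elim x)
      then have "(\<lambda>n. sqrt ((U x - p (r n) x)\<^sup>2)) \<longlonglongrightarrow> sqrt 0" by (rule tendsto_real_sqrt)
      then have "(\<lambda>n. \<bar>p (r n) x - U x\<bar>) \<longlonglongrightarrow> 0" by (simp add: abs_minus_commute)
      then have "(\<lambda>n. p (r n) x - U x) \<longlonglongrightarrow> 0" by (rule tendsto_rabs_zero_cancel)
      then show ?case by (rule LIM_zero_cancel)
    qed
    have pm: "p n \<in> borel_measurable borel" for n by (rule test_measurable[OF test_function_test[OF p(1)]])
    have "(\<integral>\<^sup>+ x. ennreal ((U x) ^ 6) \<partial>lborel) = (\<integral>\<^sup>+ x. liminf (\<lambda>n. ennreal ((p (r n) x) ^ 6)) \<partial>lborel)"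
    proof (rule nn_integral_cong_AE)
      show "AE x in lborel. ennreal ((U x) ^ 6) = liminf (\<lambda>n. ennreal ((p (r n) x) ^ 6))"
        using ae
      proof eventually_elim
        case (elim x)
        have "(\<lambda>n. ennreal ((p (r n) x) ^ 6)) \<longlonglongrightarrow> ennreal ((U x) ^ 6)" by (intro tendsto_ennrealI tendsto_power elim)
        then show ?case by (rule lim_imp_Liminf[OF sequentially_bot, symmetric])
      qed
    qed
    also have "\<dots> \<le> liminf (\<lambda>n. \<integral>\<^sup>+ x. ennreal ((p (r n) x) ^ 6) \<partial>lborel)"
      using pm by (intro nn_integral_liminf) simp
    also have "\<dots> \<le> liminf (\<lambda>n. ennreal (a (r n)))"
    proof (rule Liminf_mono, intro always_eventually allI)
      fix n
      have "integrable lborel (\<lambda>x. (p (r n) x) ^ 6)"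
      proof -
        let ?t = "\<lambda>x. p (r n) x * p (r n) x * p (r n) x"
        have "test ?t" by (intro test_mult1 testD(1) test_function_test[OF p(1)])
        then have "integrable lborel (\<lambda>x. (?t x)\<^sup>2)" using test_square_integrable square_integrableD(2) by blast
        moreover have "(\<lambda>x. (?t x)\<^sup>2) = (\<lambda>x. (p (r n) x) ^ 6)" by (simp add: eval_nat_numeral algebra_simps)
        ultimately show ?thesis by simp
      qed
      then have "(\<integral>\<^sup>+ x. ennreal ((p (r n) x) ^ 6) \<partial>lborel) = ennreal (\<integral>x. (p (r n) x) ^ 6 \<partial>lborel)"
        by (intro nn_integral_eq_integral) auto
      then show "(\<integral>\<^sup>+ x. ennreal ((p (r n) x) ^ 6) \<partial>lborel) \<le> ennreal (a (r n))"
        using sixth[of "r n"] by (simp add: ennreal_leI)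
    qed
    also have "\<dots> = ennreal L"
    proof (rule lim_imp_Liminf)
      show "(\<lambda>n. ennreal (a (r n))) \<longlonglongrightarrow> ennreal L"
        using LIMSEQ_subseq_LIMSEQ[OF lim r(1)] unfolding L_def by (intro tendsto_ennrealI) (simp add: o_def)
    qed simp
    finally have fin: "(\<integral>\<^sup>+ x. ennreal (((U x) ^ 3)\<^sup>2) \<partial>lborel) \<le> ennreal L" by (simp add: power_mult[symmetric])
    have m3: "(\<lambda>x. (U x) ^ 3) \<in> borel_measurable borel" using Um(1) by simp
    have L0: "L \<ge> 0" by (simp add: L_def)
    have sq3: "square_integrable lborel (\<lambda>x. (U x) ^ 3)"
      unfolding square_integrable_def using m3 fin borel_measurable_power[OF Um(1), of 6]
      by (auto intro!: integrableI_nonneg intro: le_less_trans)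
    have n3: "l2norm lborel (\<lambda>x. (U x) ^ 3) \<le> 6 * (P * V) ^ 3"
    proof (rule power2_le_imp_le)
      have "ennreal ((l2norm lborel (\<lambda>x. (U x) ^ 3))\<^sup>2) \<le> ennreal L"
        using fin nn_integral_square_eq[OF sq3] by simp
      then have "(l2norm lborel (\<lambda>x. (U x) ^ 3))\<^sup>2 \<le> L" using L0 by (simp add: ennreal_le_iff)
      also have "\<dots> \<le> 36 * ((P * V) * (P * V) * (P * V))\<^sup>2" by (rule LV)
      also have "\<dots> = (6 * (P * V) ^ 3)\<^sup>2" by (simp add: eval_nat_numeral algebra_simps)
      finally show "(l2norm lborel (\<lambda>x. (U x) ^ 3))\<^sup>2 \<le> (6 * (P * V) ^ 3)\<^sup>2" .
    qed (use P(1) V in simp)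
    have \<Omega>s: "\<Omega> \<in> sets lebesgue" using \<Omega> by auto
    have z3: "(U x) ^ 3 = 0" if "x \<notin> \<Omega>" for x using Um(2)[OF that] by simp
    have sqo: "square_integrable (lebesgue_on \<Omega>) (\<lambda>x. (U x) ^ 3)"
      using square_integrable_lebesgue_on_borel[OF \<Omega>s m3 z3] sq3 by simp
    have um: "u \<in> borel_measurable (lebesgue_on \<Omega>)" using us by (auto simp: sobolev_def L2_def)
    have aeq: "AE x in lebesgue_on \<Omega>. (u x) ^ 3 = (U x) ^ 3"
      using wderiv_Nil[OF \<Omega> us] unfolding U_def by eventually_elim simp
    have "square_integrable (lebesgue_on \<Omega>) (\<lambda>x. (u x) ^ 3)"
      using um aeq by (intro square_integrable_dominated(1)[OF sqo]) auto
    then show "(\<lambda>x. (u x) ^ 3) \<in> L2 \<Omega>" by (simp add: L2_iff)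
    have "L2_norm \<Omega> (\<lambda>x. (u x) ^ 3) = l2norm (lebesgue_on \<Omega>) (\<lambda>x. (U x) ^ 3)"
      unfolding L2_norm_eq
      by (rule l2norm_cong_AE[OF borel_measurable_power[OF um] measurable_lebesgue_on_borel[OF m3] aeq])
    also have "\<dots> = l2norm lborel (\<lambda>x. (U x) ^ 3)"
      by (rule l2norm_lebesgue_on_borel[OF \<Omega>s m3 z3])
    also have "\<dots> \<le> 6 * (P * V) ^ 3" by (rule n3)
    finally show "L2_norm \<Omega> (\<lambda>x. (u x) ^ 3) \<le> 6 * P ^ 3 * (V_norm \<Omega> m u) ^ 3"
      by (simp add: V_def power_mult_distrib)
  qed
qed

lemma phi_in_L2:
  fixes \<Omega> :: "(real^2) set"
  assumes \<Omega>: "open \<Omega>" and bdd: "bounded \<Omega>" and m: "m \<ge> 1"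
  shows "\<exists>C\<ge>0. \<forall>u\<in>sobolev0 \<Omega> m. (\<lambda>x. phi (u x)) \<in> L2 \<Omega> \<and>
    L2_norm \<Omega> (\<lambda>x. phi (u x)) \<le> C * ((V_norm \<Omega> m u) ^ 3 + V_norm \<Omega> m u)"
proof -
  obtain C where C: "C \<ge> 0" "\<And>u. u \<in> sobolev0 \<Omega> m \<Longrightarrow> (\<lambda>x. (u x) ^ 3) \<in> L2 \<Omega>"
    "\<And>u. u \<in> sobolev0 \<Omega> m \<Longrightarrow> L2_norm \<Omega> (\<lambda>x. (u x) ^ 3) \<le> C * (V_norm \<Omega> m u) ^ 3"
    using cube_in_L2[OF \<Omega> bdd m] by blast
  obtain P where P: "P > 0" "\<And>u bs. u \<in> sobolev0 \<Omega> m \<Longrightarrow> bs \<in> multi_indices m \<Longrightarrow> l2norm lborel (wderiv \<Omega> bs u) \<le> P * V_norm \<Omega> m u"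
    using Poincare[OF \<Omega> bdd, of m] by blast
  show ?thesis
  proof (rule exI[of _ "C + P"], intro conjI ballI)
    show "0 \<le> C + P" using C P by simp
    fix u assume u: "u \<in> sobolev0 \<Omega> m"
    note us = sobolev0_sobolev[OF \<Omega> u]
    let ?V = "V_norm \<Omega> m u"
    have V: "?V \<ge> 0" by (rule V_norm_nonneg[OF \<Omega>])
    have u2: "square_integrable (lebesgue_on \<Omega>) u" using us by (simp add: sobolev_def L2_iff)
    have u3: "square_integrable (lebesgue_on \<Omega>) (\<lambda>x. (u x) ^ 3)" using C(2)[OF u] by (simp add: L2_iff)
    show "(\<lambda>x. phi (u x)) \<in> L2 \<Omega>" unfolding phi_def L2_iff by (rule square_integrable_diff[OF u3 u2])
    have "L2_norm \<Omega> u = l2norm (lebesgue_on \<Omega>) (wderiv \<Omega> [] u)"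
      unfolding L2_norm_eq using wderiv_Nil[OF \<Omega> us] square_integrableD(1)[OF u2]
        measurable_lebesgue_on_borel[OF wderiv(1)[OF \<Omega> us Nil_multi_indices]]
      by (intro l2norm_cong_AE) auto
    also have "\<dots> = l2norm lborel (wderiv \<Omega> [] u)"
      using \<Omega> by (intro l2norm_lebesgue_on_borel wderiv[OF \<Omega> us Nil_multi_indices]) auto
    also have "\<dots> \<le> P * ?V" by (rule P(2)[OF u Nil_multi_indices])
    finally have n1: "L2_norm \<Omega> u \<le> P * ?V" .
    have "L2_norm \<Omega> (\<lambda>x. phi (u x)) \<le> L2_norm \<Omega> (\<lambda>x. (u x) ^ 3) + L2_norm \<Omega> u"
      unfolding phi_def L2_norm_eq by (rule l2norm_diff_le[OF u3 u2])
    also have "\<dots> \<le> C * ?V ^ 3 + P * ?V" by (intro add_mono C(3) u n1)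
    also have "\<dots> \<le> (C + P) * (?V ^ 3 + ?V)"
      using C(1) P(1) V by (simp add: algebra_simps)
    finally show "L2_norm \<Omega> (\<lambda>x. phi (u x)) \<le> (C + P) * (?V ^ 3 + ?V)" .
  qed
qed

section \<open>Measurability in time\<close>

lemma borel_measurable_AE_LIMSEQ:
  fixes g :: "'a::euclidean_space \<Rightarrow> real"
  assumes S: "S \<in> sets lebesgue" and f: "\<And>n. f n \<in> borel_measurable (lebesgue_on S)"
    and lim: "AE t in lebesgue_on S. (\<lambda>n. f n t) \<longlonglongrightarrow> g t"
  shows "g \<in> borel_measurable (lebesgue_on S)"
proof (rule measurable_AE_lebesgue_on[OF _ S])
  show "(\<lambda>t. lim (\<lambda>n. f n t)) \<in> borel_measurable (lebesgue_on S)"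
    by (rule borel_measurable_lim_metric[OF f])
  show "AE t in lebesgue_on S. lim (\<lambda>n. f n t) = g t"
    using lim by eventually_elim (rule limI)
qed

lemma approximate_minimum:
  fixes f :: "'a \<Rightarrow> real"
  assumes "A \<noteq> {}" "\<And>a. a \<in> A \<Longrightarrow> 0 \<le> f a" "e > 0"
  shows "\<exists>a. a \<in> A \<and> (\<forall>b\<in>A. f a \<le> f b + e)"
proof -
  have bdd: "bdd_below (f ` A)" using assms(2) by (intro bdd_belowI[of _ 0]) auto
  have "Inf (f ` A) < Inf (f ` A) + e" using assms(3) by simp
  then obtain a where a: "a \<in> A" "f a < Inf (f ` A) + e"
    using assms(1) bdd by (subst (asm) cInf_less_iff) auto
  moreover have "Inf (f ` A) \<le> f b" if "b \<in> A" for b using that bdd by (intro cInf_lower) auto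
  ultimately show ?thesis by (intro exI[of _ a]) fastforce
qed

text \<open>Let \<open>\<sigma>\<^sub>n\<close> be simple functions tending to \<open>u\<close>. On each cell where \<open>\<sigma>\<^sub>n\<close> and \<open>\<kappa>\<close> are constant, replace \<open>\<sigma>\<^sub>n\<close> by a
  value of \<open>u\<close> on that cell that is almost closest to it. This at most doubles the distance to \<open>u\<close>, up to
  \<open>1/(n + 1)\<close>, and the new values inherit whatever is known of those of \<open>u\<close>, namely membership in \<open>Q k\<close>.\<close>

lemma simple_approximation_by_values:
  fixes N :: "('a \<Rightarrow> real) \<Rightarrow> real" and \<kappa> :: "'t \<Rightarrow> nat"
  assumes sm: "strongly_measurable M X N u"
    and \<kappa>: "\<kappa> \<in> measurable M (count_space UNIV)"
    and Q: "AE t in M. u t \<in> Q (\<kappa> t)"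
    and nonneg: "\<And>a. 0 \<le> N a"
    and sym: "\<And>a b. a \<in> X \<Longrightarrow> b \<in> X \<Longrightarrow> N (\<lambda>x. a x - b x) = N (\<lambda>x. b x - a x)"
    and tri: "\<And>a b c. a \<in> X \<Longrightarrow> b \<in> X \<Longrightarrow> c \<in> X \<Longrightarrow> N (\<lambda>x. a x - c x) \<le> N (\<lambda>x. a x - b x) + N (\<lambda>x. b x - c x)"
  shows "\<exists>s. (\<forall>n. simple_function M (s n) \<and> s n ` space M \<subseteq> insert (\<lambda>x. 0) (\<Union>k. Q k)) \<and>
    (AE t in M. (\<lambda>n. N (\<lambda>x. u t x - s n t x)) \<longlonglongrightarrow> 0 \<and> (\<forall>n>\<kappa> t. s n t \<in> Q (\<kappa> t)))"
proof -
  obtain \<sigma> where \<sigma>: "\<And>n. X_simple M X (\<sigma> n)" "AE t in M. (\<lambda>n. N (\<lambda>x. u t x - \<sigma> n t x)) \<longlonglongrightarrow> 0"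
    and uX: "AE t in M. u t \<in> X"
    using sm by (auto simp: strongly_measurable_def)
  have \<sigma>X: "\<sigma> n t \<in> X" if "t \<in> space M" for n t using \<sigma>(1) that by (auto simp: X_simple_def)
  define P where "P = (\<lambda>t. u t \<in> X \<and> u t \<in> Q (\<kappa> t) \<and> (\<lambda>n. N (\<lambda>x. u t x - \<sigma> n t x)) \<longlonglongrightarrow> 0)"
  have AEP: "AE t in M. P t" using \<sigma>(2) uX Q by eventually_elim (simp add: P_def)
  define cell where "cell = (\<lambda>n v k. {t \<in> space M. P t \<and> \<sigma> n t = v \<and> \<kappa> t = k})"
  define pick where "pick = (\<lambda>n v k. SOME t. t \<in> cell n v k \<and>
    (\<forall>t'\<in>cell n v k. N (\<lambda>x. u t x - v x) \<le> N (\<lambda>x. u t' x - v x) + inverse (real (Suc n))))"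
  have pick: "pick n v k \<in> cell n v k"
    "\<And>t'. t' \<in> cell n v k \<Longrightarrow> N (\<lambda>x. u (pick n v k) x - v x) \<le> N (\<lambda>x. u t' x - v x) + inverse (real (Suc n))"
    if "cell n v k \<noteq> {}" for n v k
  proof -
    have "\<exists>t. t \<in> cell n v k \<and> (\<forall>t'\<in>cell n v k. N (\<lambda>x. u t x - v x) \<le> N (\<lambda>x. u t' x - v x) + inverse (real (Suc n)))"
      by (rule approximate_minimum[OF that]) (auto simp: nonneg)
    from someI_ex[OF this] show "pick n v k \<in> cell n v k"
      "\<And>t'. t' \<in> cell n v k \<Longrightarrow> N (\<lambda>x. u (pick n v k) x - v x) \<le> N (\<lambda>x. u t' x - v x) + inverse (real (Suc n))"
      unfolding pick_def by blast+
  qed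
  \<comment> \<open>The value \<open>min n (\<kappa> t) = n\<close> collects all larger \<open>\<kappa>\<close>, so that \<open>s n\<close> has finite range; there it is \<open>0\<close>.\<close>
  define F where "F = (\<lambda>n p. if snd p < n \<and> cell n (fst p) (snd p) \<noteq> {} then u (pick n (fst p) (snd p)) else (\<lambda>x. 0))"
  define s where "s = (\<lambda>n t. F n (\<sigma> n t, min n (\<kappa> t)))"
  have FQ: "F n p \<in> insert (\<lambda>x. 0) (\<Union>k. Q k)" for n p
    using pick(1)[of n "fst p" "snd p"] by (auto simp: F_def cell_def P_def)
  have simple: "simple_function M (s n)" for n
  proof -
    have "simple_function M (\<lambda>t. min n (\<kappa> t))"
      unfolding simple_function_def
    proof (intro conjI ballI)
      show "finite ((\<lambda>t. min n (\<kappa> t)) ` space M)" by (rule finite_subset[of _ "{..n}"]) auto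
      fix i
      have "(\<lambda>t. min n (\<kappa> t)) -` {i} \<inter> space M = \<kappa> -` {k. min n k = i} \<inter> space M" by auto
      then show "(\<lambda>t. min n (\<kappa> t)) -` {i} \<inter> space M \<in> sets M" using measurable_sets[OF \<kappa>, of "{k. min n k = i}"] by simp
    qed
    moreover have "simple_function M (\<sigma> n)" using \<sigma>(1) by (simp add: X_simple_def)
    ultimately have "simple_function M (\<lambda>t. (\<sigma> n t, min n (\<kappa> t)))" by (intro simple_function_Pair)
    from simple_function_compose1[OF this, of "F n"] show ?thesis by (simp add: s_def)
  qed
  have val: "s n t \<in> Q (\<kappa> t) \<and> N (\<lambda>x. u t x - s n t x) \<le> 2 * N (\<lambda>x. u t x - \<sigma> n t x) + inverse (real (Suc n))"
    if t: "t \<in> space M" "P t" and n: "\<kappa> t < n" for n t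
  proof -
    let ?v = "\<sigma> n t"
    define t' where "t' = pick n ?v (\<kappa> t)"
    have c: "t \<in> cell n ?v (\<kappa> t)" using t by (simp add: cell_def)
    then have ne: "cell n ?v (\<kappa> t) \<noteq> {}" by blast
    have st: "s n t = u t'" using n ne by (simp add: s_def F_def t'_def min_absorb2)
    have t': "t' \<in> space M" "P t'" "\<kappa> t' = \<kappa> t" using pick(1)[OF ne] by (auto simp: t'_def cell_def)
    have X: "u t \<in> X" "u t' \<in> X" "?v \<in> X" using t t' \<sigma>X by (auto simp: P_def)
    have "N (\<lambda>x. u t x - u t' x) \<le> N (\<lambda>x. u t x - ?v x) + N (\<lambda>x. ?v x - u t' x)" by (rule tri[OF X(1,3,2)])
    also have "N (\<lambda>x. ?v x - u t' x) = N (\<lambda>x. u t' x - ?v x)" by (rule sym[OF X(3,2)])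
    also have "\<dots> \<le> N (\<lambda>x. u t x - ?v x) + inverse (real (Suc n))" unfolding t'_def by (rule pick(2)[OF ne c])
    finally have "N (\<lambda>x. u t x - u t' x) \<le> 2 * N (\<lambda>x. u t x - ?v x) + inverse (real (Suc n))" by simp
    moreover have "u t' \<in> Q (\<kappa> t)" using t' by (simp add: P_def)
    ultimately show ?thesis by (simp add: st)
  qed
  have "AE t in M. (\<lambda>n. N (\<lambda>x. u t x - s n t x)) \<longlonglongrightarrow> 0 \<and> (\<forall>n>\<kappa> t. s n t \<in> Q (\<kappa> t))"
    using AEP AE_space
  proof eventually_elim
    case (elim t)
    have l: "(\<lambda>n. 2 * N (\<lambda>x. u t x - \<sigma> n t x) + inverse (real (Suc n))) \<longlonglongrightarrow> 2 * 0 + 0"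
      using elim(1) by (intro tendsto_intros LIMSEQ_inverse_real_of_nat) (simp add: P_def)
    have "(\<lambda>n. N (\<lambda>x. u t x - s n t x)) \<longlonglongrightarrow> 0"
    proof (rule tendsto_sandwich[OF _ _ tendsto_const])
      show "(\<lambda>n. 2 * N (\<lambda>x. u t x - \<sigma> n t x) + inverse (real (Suc n))) \<longlonglongrightarrow> 0" using l by simp
      show "\<forall>\<^sub>F n in sequentially. N (\<lambda>x. u t x - s n t x) \<le> 2 * N (\<lambda>x. u t x - \<sigma> n t x) + inverse (real (Suc n))"
        using eventually_gt_at_top[of "\<kappa> t"] by eventually_elim (use val elim in blast)
    qed (simp add: nonneg)
    then show ?case using val elim by blast
  qed
  moreover have "s n ` space M \<subseteq> insert (\<lambda>x. 0) (\<Union>k. Q k)" for n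
    unfolding s_def using FQ by blast
  ultimately show ?thesis using simple by blast
qed

section \<open>The regularity theorem\<close>

lemma weak_eq_mono: "weak_eq \<Omega> m \<kappa> G u \<Longrightarrow> \<kappa> \<le> \<kappa>' \<Longrightarrow> weak_eq \<Omega> m \<kappa>' G u"
  by (auto simp: weak_eq_def)

text \<open>The equation is linear in \<open>u\<close>.\<close>

lemma weak_eq_diff:
  assumes \<Omega>: "open \<Omega>" and u: "weak_eq \<Omega> m \<kappa> G u" and v: "weak_eq \<Omega> m \<mu> H v"
  shows "weak_eq \<Omega> m (\<kappa> + \<mu>) (\<lambda>x. G x - H x) (\<lambda>x. u x - v x)"
proof -
  have u0: "u \<in> sobolev0 \<Omega> m" and v0: "v \<in> sobolev0 \<Omega> m" and G: "G \<in> L2 \<Omega>" and H: "H \<in> L2 \<Omega>"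
    using u v by (auto simp: weak_eq_def)
  note us = sobolev0_sobolev[OF \<Omega> u0] and vs = sobolev0_sobolev[OF \<Omega> v0]
  have GH: "square_integrable (lebesgue_on \<Omega>) G" "square_integrable (lebesgue_on \<Omega>) H" using G H by (auto simp: L2_iff)
  show ?thesis
    unfolding weak_eq_def
  proof (intro conjI allI impI)
    show "(\<lambda>x. u x - v x) \<in> sobolev0 \<Omega> m" by (rule sobolev0_diff[OF \<Omega> u0 v0])
    show "(\<lambda>x. G x - H x) \<in> L2 \<Omega>" unfolding L2_iff by (rule square_integrable_diff[OF GH])
    have z: "(\<lambda>x. 0) \<in> sobolev \<Omega> m" by (rule sobolev0_sobolev[OF \<Omega> zero_sobolev0[OF \<Omega>]])
    have "V_norm \<Omega> m (\<lambda>x. u x - v x) \<le> V_norm \<Omega> m u + V_norm \<Omega> m v"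
      using V_norm_triangle[OF \<Omega> us z vs] V_norm_commute[OF \<Omega> z vs] by simp
    moreover have "L2_norm \<Omega> (\<lambda>x. G x - H x) \<le> L2_norm \<Omega> G + L2_norm \<Omega> H"
      unfolding L2_norm_eq by (rule l2norm_diff_le[OF GH])
    moreover have "V_norm \<Omega> m u + L2_norm \<Omega> G \<le> \<kappa>" "V_norm \<Omega> m v + L2_norm \<Omega> H \<le> \<mu>" using u v by (auto simp: weak_eq_def)
    ultimately show "V_norm \<Omega> m (\<lambda>x. u x - v x) + L2_norm \<Omega> (\<lambda>x. G x - H x) \<le> \<kappa> + \<mu>" by linarith
    fix w assume w: "test_function \<Omega> w"
    note ws = test_function_sobolev[OF \<Omega> w, of m]
    have wL: "square_integrable (lebesgue_on \<Omega>) w" using test_function_L2[OF \<Omega> w] by (simp add: L2_iff)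
    have "bilin \<Omega> m (\<lambda>x. u x - v x) w = bilin \<Omega> m u w - bilin \<Omega> m v w"
      unfolding bilin_eq[OF \<Omega> sobolev_diff[OF \<Omega> us vs] ws] bilin_eq[OF \<Omega> us ws] bilin_eq[OF \<Omega> vs ws] sum_subtractf[symmetric]
    proof (rule sum.cong[OF refl])
      fix bs :: "'a list" assume "bs \<in> directions m"
      then have bs: "bs \<in> multi_indices m" using directions_subset_multi_indices by auto
      note sq = wderiv(4)[OF \<Omega> us bs] wderiv(4)[OF \<Omega> vs bs] wderiv(4)[OF \<Omega> ws bs] wderiv(4)[OF \<Omega> sobolev_diff[OF \<Omega> us vs] bs]
      have "(\<integral>x. wderiv \<Omega> bs (\<lambda>x. u x - v x) x * wderiv \<Omega> bs w x \<partial>lborel)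
        = (\<integral>x. wderiv \<Omega> bs u x * wderiv \<Omega> bs w x - wderiv \<Omega> bs v x * wderiv \<Omega> bs w x \<partial>lborel)"
      proof (rule integral_cong_AE)
        show "AE x in lborel. wderiv \<Omega> bs (\<lambda>x. u x - v x) x * wderiv \<Omega> bs w x
          = wderiv \<Omega> bs u x * wderiv \<Omega> bs w x - wderiv \<Omega> bs v x * wderiv \<Omega> bs w x"
          using wderiv_diff[OF \<Omega> us vs bs] by eventually_elim (simp add: left_diff_distrib)
      qed (use square_integrableD(1)[OF sq(1)] square_integrableD(1)[OF sq(2)] square_integrableD(1)[OF sq(3)] square_integrableD(1)[OF sq(4)] in auto)
      also have "\<dots> = (\<integral>x. wderiv \<Omega> bs u x * wderiv \<Omega> bs w x \<partial>lborel) - (\<integral>x. wderiv \<Omega> bs v x * wderiv \<Omega> bs w x \<partial>lborel)"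
        by (intro Bochner_Integration.integral_diff integrable_mult_square_integrable sq)
      finally show "(\<integral>x. wderiv \<Omega> bs (\<lambda>x. u x - v x) x * wderiv \<Omega> bs w x \<partial>lborel)
        = (\<integral>x. wderiv \<Omega> bs u x * wderiv \<Omega> bs w x \<partial>lborel) - (\<integral>x. wderiv \<Omega> bs v x * wderiv \<Omega> bs w x \<partial>lborel)" .
    qed
    also have "\<dots> = L2_inner \<Omega> G w - L2_inner \<Omega> H w" using u v w by (simp add: weak_eq_def)
    also have "\<dots> = L2_inner \<Omega> (\<lambda>x. G x - H x) w"
      unfolding L2_inner_def using integrable_mult_square_integrable[OF GH(1) wL] integrable_mult_square_integrable[OF GH(2) wL]
      by (simp add: left_diff_distrib)
    finally show "bilin \<Omega> m (\<lambda>x. u x - v x) w = L2_inner \<Omega> (\<lambda>x. G x - H x) w" .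
  qed
qed

lemma L2_norm_bochner_square_integrable:
  assumes f: "f \<in> bochner_L2 T (L2 \<Omega>) (L2_norm \<Omega>)"
  shows "square_integrable (lebesgue_on {0<..<T}) (\<lambda>t. L2_norm \<Omega> (f t))"
proof -
  have i: "integrable (lebesgue_on {0<..<T}) (\<lambda>t. (L2_norm \<Omega> (f t))\<^sup>2)" using f by (simp add: bochner_L2_def)
  have "(\<lambda>t. sqrt ((L2_norm \<Omega> (f t))\<^sup>2)) \<in> borel_measurable (lebesgue_on {0<..<T})"
    using borel_measurable_integrable[OF i] by measurable
  then show ?thesis using i by (simp add: square_integrable_def L2_norm_eq)
qed

text \<open>At almost every time, \<open>u(t)\<close> solves the elliptic equation with right-hand side \<open>f - \<partial>\<^sub>t u - \<phi>(u)\<close>. The norm of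
  \<open>\<phi>(u)\<close> is bounded uniformly in \<open>t\<close> since \<open>u \<in> L\<^sup>\<infinity>(0,T;V)\<close>, so the size of the data is square-integrable in
  time.\<close>

lemma weak_solution_weak_eq:
  fixes \<Omega> :: "(real^2) set"
  assumes \<Omega>: "open \<Omega>" and bdd: "bounded \<Omega>" and m: "m \<ge> 1"
    and f: "f \<in> bochner_L2 T (L2 \<Omega>) (L2_norm \<Omega>)" and u: "weak_solution m \<Omega> T f u0 u"
  shows "\<exists>\<gamma> G. square_integrable (lebesgue_on {0<..<T}) \<gamma> \<and> (AE t in lebesgue_on {0<..<T}. weak_eq \<Omega> m (\<gamma> t) (G t) (u t))"
proof -
  let ?M = "lebesgue_on {0<..<T}"
  interpret M: finite_measure ?M by (rule finite_measure_lebesgue_on_open_bounded) auto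
  obtain g where uL: "u \<in> bochner_Linf T (sobolev0 \<Omega> m) (V_norm \<Omega> m)" and g: "g \<in> bochner_L2 T (L2 \<Omega>) (L2_norm \<Omega>)"
    and eq: "AE t in ?M. \<forall>w\<in>sobolev0 \<Omega> m.
           L2_inner \<Omega> (g t) w + bilin \<Omega> m (u t) w + L2_inner \<Omega> (\<lambda>x. phi (u t x)) w = L2_inner \<Omega> (f t) w"
    using u by (auto simp: weak_solution_def)
  obtain C where C: "AE t in ?M. V_norm \<Omega> m (u t) \<le> C" using uL by (auto simp: bochner_Linf_def)
  define c where "c = max C 0"
  have c: "c \<ge> 0" "AE t in ?M. V_norm \<Omega> m (u t) \<le> c" using C by (auto simp: c_def elim: eventually_mono)
  obtain K where K: "K \<ge> 0" "\<And>u. u \<in> sobolev0 \<Omega> m \<Longrightarrow> (\<lambda>x. phi (u x)) \<in> L2 \<Omega>"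
    "\<And>u. u \<in> sobolev0 \<Omega> m \<Longrightarrow> L2_norm \<Omega> (\<lambda>x. phi (u x)) \<le> K * ((V_norm \<Omega> m u) ^ 3 + V_norm \<Omega> m u)"
    using phi_in_L2[OF \<Omega> bdd m] by blast
  define \<gamma> where "\<gamma> = (\<lambda>t. L2_norm \<Omega> (f t) + L2_norm \<Omega> (g t) + (K * (c ^ 3 + c) + c))"
  define G where "G = (\<lambda>t x. f t x - g t x - phi (u t x))"
  have "square_integrable ?M (\<lambda>t. K * (c ^ 3 + c) + c)"
    by (simp add: square_integrable_def)
  then have "square_integrable ?M \<gamma>"
    unfolding \<gamma>_def
    by (rule square_integrable_add[OF square_integrable_add[OF L2_norm_bochner_square_integrable[OF f] L2_norm_bochner_square_integrable[OF g]]])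
  moreover have "AE t in ?M. weak_eq \<Omega> m (\<gamma> t) (G t) (u t)"
  proof -
    have "AE t in ?M. u t \<in> sobolev0 \<Omega> m" "AE t in ?M. f t \<in> L2 \<Omega>" "AE t in ?M. g t \<in> L2 \<Omega>"
      using uL f g by (auto simp: bochner_Linf_def bochner_L2_def strongly_measurable_def)
    then show ?thesis using eq c(2)
    proof eventually_elim
      case (elim t)
      have sf: "square_integrable (lebesgue_on \<Omega>) (f t)" and sg: "square_integrable (lebesgue_on \<Omega>) (g t)"
        and sp: "square_integrable (lebesgue_on \<Omega>) (\<lambda>x. phi (u t x))"
        using elim K(2)[of "u t"] by (auto simp: L2_iff)
      show ?case
        unfolding weak_eq_def
      proof (intro conjI allI impI)
        show "u t \<in> sobolev0 \<Omega> m" by (rule elim)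
        show "G t \<in> L2 \<Omega>" unfolding G_def L2_iff by (intro square_integrable_diff sf sg sp)
        have "L2_norm \<Omega> (G t) \<le> (L2_norm \<Omega> (f t) + L2_norm \<Omega> (g t)) + L2_norm \<Omega> (\<lambda>x. phi (u t x))"
          unfolding G_def L2_norm_eq
          by (rule order_trans[OF l2norm_diff_le[OF square_integrable_diff[OF sf sg] sp]])
            (intro add_right_mono l2norm_diff_le sf sg)
        moreover have "L2_norm \<Omega> (\<lambda>x. phi (u t x)) \<le> K * (c ^ 3 + c)"
          by (rule order_trans[OF K(3)[OF elim(1)]])
            (intro mult_left_mono add_mono power_mono elim V_norm_nonneg[OF \<Omega>] K)
        ultimately show "V_norm \<Omega> m (u t) + L2_norm \<Omega> (G t) \<le> \<gamma> t" using elim(5) unfolding \<gamma>_def by linarith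
        fix w assume w: "test_function \<Omega> w"
        have wL: "square_integrable (lebesgue_on \<Omega>) w" using test_function_L2[OF \<Omega> w] by (simp add: L2_iff)
        have "bilin \<Omega> m (u t) w = L2_inner \<Omega> (f t) w - L2_inner \<Omega> (g t) w - L2_inner \<Omega> (\<lambda>x. phi (u t x)) w"
          using elim(4) test_function_sobolev0[OF \<Omega> w, of m] by force
        also have "\<dots> = L2_inner \<Omega> (G t) w"
          unfolding L2_inner_def G_def using integrable_mult_square_integrable[OF sf wL] integrable_mult_square_integrable[OF sg wL]
            integrable_mult_square_integrable[OF sp wL] by (simp add: left_diff_distrib)
        finally show "bilin \<Omega> m (u t) w = L2_inner \<Omega> (G t) w" .
      qed
    qed
  qed
  ultimately show ?thesis by blast
qed

text \<open>Simple functions that take their values among those of \<open>u\<close> have data bounded along with \<open>\<gamma>\<close>, so by the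
  interpolation bound in \<open>fractional_regularity\<close> their convergence to \<open>u(t)\<close> in \<open>V\<close> is also convergence in the
  fractional norm. This gives strong measurability, and the same bound gives square integrability.\<close>

lemma bochner_fractional_regularity:
  fixes \<Omega> :: "(real^2) set"
  assumes \<Omega>: "open \<Omega>" and bdd: "bounded \<Omega>" and m: "m \<ge> 1" and lip: "lipschitz_boundary \<Omega>"
    and sm: "strongly_measurable (lebesgue_on {0<..<T}) (sobolev0 \<Omega> m) (V_norm \<Omega> m) u"
    and \<gamma>: "square_integrable (lebesgue_on {0<..<T}) \<gamma>"
    and eq: "AE t in lebesgue_on {0<..<T}. weak_eq \<Omega> m (\<gamma> t) (G t) (u t)"
  shows "u \<in> bochner_L2 T (frac_sobolev \<Omega> (real m + 1/8)) (frac_sobolev_norm \<Omega> (real m + 1/8))"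
proof -
  let ?M = "lebesgue_on {0<..<T}"
  let ?X = "frac_sobolev \<Omega> (real m + 1/8)"
  let ?N = "frac_sobolev_norm \<Omega> (real m + 1/8)"
  obtain C where C: "C \<ge> 0" and reg: "\<And>\<kappa> G u. weak_eq \<Omega> m \<kappa> G u \<Longrightarrow> u \<in> ?X"
    "\<And>\<kappa> G u. weak_eq \<Omega> m \<kappa> G u \<Longrightarrow> (?N u)\<^sup>2 \<le> C * V_norm \<Omega> m u * \<kappa>"
    using fractional_regularity[OF \<Omega> bdd m lip] by blast
  define Q where "Q = (\<lambda>k::nat. {v. \<exists>G. weak_eq \<Omega> m (real k) G v})"
  \<comment> \<open>Rounding up gives a size bound with countably many values.\<close>
  define \<kappa> where "\<kappa> = (\<lambda>t. nat \<lceil>\<gamma> t\<rceil>)"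
  have [measurable]: "\<gamma> \<in> borel_measurable ?M" using \<gamma> by (simp add: square_integrable_def)
  have \<kappa>m: "\<kappa> \<in> measurable ?M (count_space UNIV)" unfolding \<kappa>_def by measurable
  have Q: "AE t in ?M. u t \<in> Q (\<kappa> t)"
    using eq
  proof eventually_elim
    case (elim t)
    have "\<gamma> t \<le> real (\<kappa> t)" unfolding \<kappa>_def by linarith
    from weak_eq_mono[OF elim this] show ?case by (auto simp: Q_def)
  qed
  have QX: "Q k \<subseteq> ?X" for k using reg(1) by (auto simp: Q_def)
  \<comment> \<open>Differences of two values again solve an equation with bounded data, so the interpolation bound applies.\<close>
  have conv0: "?N (\<lambda>x. a x - b x) \<le> sqrt (C * V_norm \<Omega> m (\<lambda>x. a x - b x) * (real k + real k))" if ab: "a \<in> Q k" "b \<in> Q k" for a b k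
  proof -
    obtain G H where "weak_eq \<Omega> m (real k) G a" "weak_eq \<Omega> m (real k) H b" using ab unfolding Q_def by blast
    from reg(2)[OF weak_eq_diff[OF \<Omega> this]] show ?thesis by (rule real_le_rsqrt)
  qed
  have "\<exists>s. (\<forall>n. simple_function ?M (s n) \<and> s n ` space ?M \<subseteq> insert (\<lambda>x. 0) (\<Union>k. Q k)) \<and>
    (AE t in ?M. (\<lambda>n. V_norm \<Omega> m (\<lambda>x. u t x - s n t x)) \<longlonglongrightarrow> 0 \<and> (\<forall>n>\<kappa> t. s n t \<in> Q (\<kappa> t)))"
  proof (rule simple_approximation_by_values[OF sm \<kappa>m Q V_norm_nonneg[OF \<Omega>]])
    fix a b c assume "a \<in> sobolev0 \<Omega> m" "b \<in> sobolev0 \<Omega> m" "c \<in> sobolev0 \<Omega> m"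
    then show "V_norm \<Omega> m (\<lambda>x. a x - c x) \<le> V_norm \<Omega> m (\<lambda>x. a x - b x) + V_norm \<Omega> m (\<lambda>x. b x - c x)"
      by (intro V_norm_triangle[OF \<Omega>] sobolev0_sobolev[OF \<Omega>])
  next
    fix a b assume "a \<in> sobolev0 \<Omega> m" "b \<in> sobolev0 \<Omega> m"
    then show "V_norm \<Omega> m (\<lambda>x. a x - b x) = V_norm \<Omega> m (\<lambda>x. b x - a x)"
      by (intro V_norm_commute[OF \<Omega>] sobolev0_sobolev[OF \<Omega>])
  qed
  then obtain s where s0: "\<forall>n. simple_function ?M (s n) \<and> s n ` space ?M \<subseteq> insert (\<lambda>x. 0) (\<Union>k. Q k)"
    and lim: "AE t in ?M. (\<lambda>n. V_norm \<Omega> m (\<lambda>x. u t x - s n t x)) \<longlonglongrightarrow> 0 \<and> (\<forall>n>\<kappa> t. s n t \<in> Q (\<kappa> t))"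
    by (elim exE conjE) (rule that)
  have s: "simple_function ?M (s n)" "s n ` space ?M \<subseteq> insert (\<lambda>x. 0) (\<Union>k. Q k)" for n
    using spec[OF s0, of n] by (rule conjunct1, rule conjunct2)
  have sX: "s n t \<in> ?X" if "t \<in> space ?M" for n t
  proof -
    have "s n t \<in> insert (\<lambda>x. 0) (\<Union>k. Q k)" by (rule subsetD[OF s(2) imageI[OF that]])
    then consider "s n t = (\<lambda>x. 0)" | k where "s n t \<in> Q k" by auto
    then show ?thesis
    proof cases
      case 1 then show ?thesis using zero_frac_sobolev[OF \<Omega> bdd, of m] by simp
    next
      case 2 then show ?thesis by (rule subsetD[OF QX])
    qed
  qed
  have uX: "AE t in ?M. u t \<in> ?X" using Q by eventually_elim (rule subsetD[OF QX])
  have conv: "AE t in ?M. (\<lambda>n. ?N (\<lambda>x. u t x - s n t x)) \<longlonglongrightarrow> 0"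
    using lim Q
  proof eventually_elim
    case (elim t)
    have l: "(\<lambda>n. sqrt (C * V_norm \<Omega> m (\<lambda>x. u t x - s n t x) * (real (\<kappa> t) + real (\<kappa> t)))) \<longlonglongrightarrow> sqrt (C * 0 * (real (\<kappa> t) + real (\<kappa> t)))"
      using elim(1) by (intro tendsto_intros) auto
    show ?case
    proof (rule tendsto_sandwich[OF _ _ tendsto_const])
      show "(\<lambda>n. sqrt (C * V_norm \<Omega> m (\<lambda>x. u t x - s n t x) * (real (\<kappa> t) + real (\<kappa> t)))) \<longlonglongrightarrow> 0" using l by simp
      show "\<forall>\<^sub>F n in sequentially. ?N (\<lambda>x. u t x - s n t x) \<le> sqrt (C * V_norm \<Omega> m (\<lambda>x. u t x - s n t x) * (real (\<kappa> t) + real (\<kappa> t)))"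
        using eventually_gt_at_top[of "\<kappa> t"]
      proof eventually_elim
        case n: (elim n)
        show ?case by (rule conv0[OF elim(2) conjunct2[OF elim(1), rule_format, OF n]])
      qed
    qed (simp add: frac_sobolev_norm_nonneg[OF \<Omega> bdd])
  qed
  have sm': "strongly_measurable ?M ?X ?N u"
    unfolding strongly_measurable_def X_simple_def
    by (intro conjI exI[of _ s] allI uX conv s(1) image_subsetI sX)
  have meas: "(\<lambda>t. ?N (u t)) \<in> borel_measurable ?M"
  proof (rule borel_measurable_AE_LIMSEQ)
    show "(\<lambda>t. ?N (s n t)) \<in> borel_measurable ?M" for n
      using simple_function_compose1[OF s(1)[of n], of ?N] by (rule borel_measurable_simple_function)
    show "AE t in ?M. (\<lambda>n. ?N (s n t)) \<longlonglongrightarrow> ?N (u t)"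
      using conv uX AE_space
    proof eventually_elim
      case (elim t)
      show ?case
      proof (rule LIM_zero_cancel, rule Lim_null_comparison[OF _ elim(1)])
        show "\<forall>\<^sub>F n in sequentially. norm (?N (s n t) - ?N (u t)) \<le> ?N (\<lambda>x. u t x - s n t x)"
          using frac_sobolev_norm_triangle[OF \<Omega> bdd elim(2) sX[OF elim(3)]] by (simp add: abs_minus_commute)
      qed
    qed
  qed simp
  have "integrable ?M (\<lambda>t. (?N (u t))\<^sup>2)"
  proof (rule Bochner_Integration.integrable_bound)
    show "integrable ?M (\<lambda>t. C * (\<gamma> t)\<^sup>2)" using square_integrableD(2)[OF \<gamma>] by auto
    show "(\<lambda>t. (?N (u t))\<^sup>2) \<in> borel_measurable ?M" using meas by simp
    show "AE t in ?M. norm ((?N (u t))\<^sup>2) \<le> norm (C * (\<gamma> t)\<^sup>2)"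
      using eq
    proof eventually_elim
      case (elim t)
      have V: "0 \<le> V_norm \<Omega> m (u t)" "V_norm \<Omega> m (u t) \<le> \<gamma> t"
      proof -
        have "0 \<le> L2_norm \<Omega> (G t)" by (simp add: L2_norm_eq)
        then show "V_norm \<Omega> m (u t) \<le> \<gamma> t" using elim unfolding weak_eq_def by linarith
      qed (rule V_norm_nonneg[OF \<Omega>])
      have "(?N (u t))\<^sup>2 \<le> C * V_norm \<Omega> m (u t) * \<gamma> t" by (rule reg(2)[OF elim])
      also have "\<dots> \<le> C * \<gamma> t * \<gamma> t" using C V by (intro mult_right_mono mult_left_mono) auto
      finally show ?case using C by (simp add: power2_eq_square mult.assoc)
    qed
  qed
  with sm' show ?thesis by (simp add: bochner_L2_def)
qed

theorem theorem2p2: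
  fixes m :: nat and \<Omega> :: "(real^2) set"
  assumes "m \<in> {1, 2}" and "polygonal_lipschitz_domain \<Omega>"
  shows "\<exists>\<sigma>::real. 0 < \<sigma> \<and> \<sigma> \<le> 1 \<and>
    (\<forall>(T::real) (f :: real \<Rightarrow> real^2 \<Rightarrow> real) (u0 :: real^2 \<Rightarrow> real) (u :: real \<Rightarrow> real^2 \<Rightarrow> real).
       0 < T \<longrightarrow> f \<in> bochner_L2 T (L2 \<Omega>) (L2_norm \<Omega>) \<longrightarrow> u0 \<in> sobolev0 \<Omega> m \<longrightarrow>
       weak_solution m \<Omega> T f u0 u \<longrightarrow>
       u \<in> bochner_L2 T (frac_sobolev \<Omega> (real m + \<sigma>)) (frac_sobolev_norm \<Omega> (real m + \<sigma>)))"
proof (intro exI[of _ "1/8"] conjI allI impI)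
  fix T :: real and f :: "real \<Rightarrow> real^2 \<Rightarrow> real" and u0 :: "real^2 \<Rightarrow> real" and u :: "real \<Rightarrow> real^2 \<Rightarrow> real"
  assume f: "f \<in> bochner_L2 T (L2 \<Omega>) (L2_norm \<Omega>)" and u: "weak_solution m \<Omega> T f u0 u"
  have \<Omega>: "open \<Omega>" "bounded \<Omega>" "lipschitz_boundary \<Omega>" and m: "m \<ge> 1"
    using assms by (auto simp: polygonal_lipschitz_domain_def)
  obtain \<gamma> G where "square_integrable (lebesgue_on {0<..<T}) \<gamma>" "AE t in lebesgue_on {0<..<T}. weak_eq \<Omega> m (\<gamma> t) (G t) (u t)"
    using weak_solution_weak_eq[OF \<Omega>(1,2) m f u] by blast
  moreover have "strongly_measurable (lebesgue_on {0<..<T}) (sobolev0 \<Omega> m) (V_norm \<Omega> m) u"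
    using u by (simp add: weak_solution_def bochner_Linf_def)
  ultimately show "u \<in> bochner_L2 T (frac_sobolev \<Omega> (real m + 1/8)) (frac_sobolev_norm \<Omega> (real m + 1/8))"
    by (intro bochner_fractional_regularity[OF \<Omega>(1,2) m \<Omega>(3)])
qed simp_all

end
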